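(* Let $G=(V,E)$ be a simple, connected, non-bipartite graph with edge ideal $I_G$. Then for every $k\ge 1$, $$\mathrm{Ass}(I_G^k)=\Big\{\mathfrak m^{\mathbf 1_U}\ \Big|\ U\subset V,\ \mathcal D^*(U)\neq\emptyset,\ \min_{W\in\mathcal D^*(U)}\nu^*(G_W)\le k-1\Big\}.$$
   Context: Graphs are finite and simple. Write $V=\{P_1,\dots,P_d\}$ and $R=K[x_1,\dots,x_d]$ with $K$ a field. The edge ideal of $G$ is $I_G=(x_ix_j : P_iP_j\in E)\subset R$. For $U\subset V$, $\mathfrak m^{\mathbf 1_U}$ is the prime ideal generated by the $x_i$ with $P_i\in U$, and $G_U$ is the subgraph of $G$ induced on $U$. $\mathrm{Ass}(J)$ is the set of associated primes of $R/J$. For $S\subset V$, $N(S)$ is the set of vertices adjacent to at least one vertex of $S$ (so $N(\emptyset)=\emptyset$). Dominant* sets. Let $U\subset V$ and $Z=V\setminus U$. If $Z$ is not an independent set, put $\mathcal D^*(U)=\emptyset$. If $Z$ is independent, a set $W\subset V\setminus(Z\cup N(Z))$ is $U$-dominant if $V=N(W)\cup N(Z)\cup Z$; it is $U$-dominant* if it is $U$-dominant and every connected component of $G_W$ contains an odd cycle (the set $W=\emptyset$ is allowed, and is $U$-dominant* exactly when $V=N(Z)\cup Z$). $\mathcal D^*(U)$ is the set of all $U$-dominant* sets $W\subset U$. Ears. Given a graph $H'$, adding an ear to $H'$ means taking two vertices $a,b$ of $H'$ and adding a path from $a$ to $b$ all of whose vertices other than $a,b$ are new; $a=b$ is allowed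 (closed ear, i.e. a cycle through $a$). An ear is odd (even) if it has an odd (even) number of edges. A generalized ear decomposition of a connected graph $H$ is a sequence $F_0,F_1,\dots,F_s$ with union $H$ such that $F_0$ is a cycle (counted as an odd or even ear according to its length) or a bridge of $H$, and for $i\ge 1$ each $F_i$ is either an ear added to $F_0\cup\dots\cup F_{i-1}$ or a bridge of $H$ with exactly one endpoint in $F_0\cup\dots\cup F_{i-1}$. Bridges are not counted as ears when counting even ears. $\varphi(H)$ is the minimum number of even ears in a generalized ear decomposition of $H$; $\psi(H)$ is the number of bridges of $H$. For a disconnected graph, $\varphi$ and $\psi$ are the sums over the connected components. For $\emptyset\ne W\in\mathcal D^*(U)$ put $\nu^*(G_W)=\frac12\big(\mathrm{card}(W)+\varphi(G_W)+\psi(G_W)-t_W\big)$, where $t_W$ is the number of connected components of $G_W$; for $W=\emptyset$ put $\nu^*(G_W)=0$. *)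

theory Defs
  imports
    "HOL-Library.Poly_Mapping"
    "HOL-Algebra.Ideal_Product"
    "HOL-Algebra.QuotRing"
    "HOL-Algebra.Algebraic_Closure_Type"
begin

section \<open>Polynomial rings, powers of ideals, associated primes\<close>

text \<open>
  Polynomials in the variables \<open>x\<^sub>v\<close> (\<open>v\<close> ranging over the type \<open>'v\<close>) over \<open>'k\<close> are finitely
  supported functions from monomials, i.e.\ exponent vectors, to coefficients.
\<close>

type_synonym ('v, 'k) mvpoly = "(('v, nat) poly_mapping, 'k) poly_mapping"

definition mvpoly_ring :: "('v, 'k::field) mvpoly ring" where
  "mvpoly_ring = ring_of_type_algebra"

definition mvvar :: "'v \<Rightarrow> ('v, 'k::field) mvpoly" where
  "mvvar v = Poly_Mapping.single (Poly_Mapping.single v 1) 1"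

definition ideal_pow :: "('a, 'b) ring_scheme \<Rightarrow> 'a set \<Rightarrow> nat \<Rightarrow> 'a set" where
  "ideal_pow R I k = I [^]\<^bsub>ideals_set R\<^esub> k"

text \<open>
  The associated primes of the \<open>R\<close>-module \<open>R/J\<close>: the prime ideals that are annihilators of an
  element \<open>m\<close> of \<open>R/J\<close>, where \<open>r\<close> acts on \<open>m\<close> as multiplication by its residue class \<open>J + r\<close>.
\<close>

definition associated_primes :: "('a, 'b) ring_scheme \<Rightarrow> 'a set \<Rightarrow> 'a set set" where
  "associated_primes R J =
     {P. primeideal P R \<and>
         (\<exists>m \<in> carrier (R Quot J).
            P = {r \<in> carrier R. (J +>\<^bsub>R\<^esub> r) \<otimes>\<^bsub>R Quot J\<^esub> m = \<zero>\<^bsub>R Quot J\<^esub>})}"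

section \<open>Simple graphs\<close>

text \<open>A graph is a pair of a vertex set and a set of two-element sets of vertices.\<close>

type_synonym 'v graph = "'v set \<times> 'v set set"

abbreviation verts :: "'v graph \<Rightarrow> 'v set" where "verts G \<equiv> fst G"
abbreviation edges :: "'v graph \<Rightarrow> 'v set set" where "edges G \<equiv> snd G"

definition simple_graph :: "'v graph \<Rightarrow> bool" where
  "simple_graph G \<longleftrightarrow> finite (verts G) \<and> (\<forall>e \<in> edges G. e \<subseteq> verts G \<and> card e = 2)"

definition adj :: "'v graph \<Rightarrow> 'v \<Rightarrow> 'v \<Rightarrow> bool" where
  "adj G u v \<longleftrightarrow> {u, v} \<in> edges G"

definition nbhd :: "'v graph \<Rightarrow> 'v set \<Rightarrow> 'v set" where
  "nbhd G S = {v \<in> verts G. \<exists>u \<in> S. adj G u v}"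

definition indep_set :: "'v graph \<Rightarrow> 'v set \<Rightarrow> bool" where
  "indep_set G Z \<longleftrightarrow> (\<forall>u \<in> Z. \<forall>v \<in> Z. \<not> adj G u v)"

definition induced :: "'v graph \<Rightarrow> 'v set \<Rightarrow> 'v graph" where
  "induced G W = (verts G \<inter> W, {e \<in> edges G. e \<subseteq> W})"

definition graph_union :: "'v graph \<Rightarrow> 'v graph \<Rightarrow> 'v graph" where
  "graph_union G H = (verts G \<union> verts H, edges G \<union> edges H)"

definition connected_graph :: "'v graph \<Rightarrow> bool" where
  "connected_graph G \<longleftrightarrow>
     verts G \<noteq> {} \<and> (\<forall>u \<in> verts G. \<forall>v \<in> verts G. (adj G)\<^sup>*\<^sup>* u v)"

definition bipartite :: "'v graph \<Rightarrow> bool" where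
  "bipartite G \<longleftrightarrow>
     (\<exists>A B. A \<union> B = verts G \<and> A \<inter> B = {} \<and> (\<forall>e \<in> edges G. \<exists>a \<in> A. \<exists>b \<in> B. e = {a, b}))"

definition components :: "'v graph \<Rightarrow> 'v graph set" where
  "components G = {induced G {v \<in> verts G. (adj G)\<^sup>*\<^sup>* u v} |u. u \<in> verts G}"

definition is_bridge :: "'v graph \<Rightarrow> 'v set \<Rightarrow> bool" where
  "is_bridge G e \<longleftrightarrow>
     e \<in> edges G \<and> (\<exists>u v. e = {u, v} \<and> \<not> (adj (verts G, edges G - {e}))\<^sup>*\<^sup>* u v)"

section \<open>Paths, cycles, and generalized ear decompositions\<close>

text \<open>
  Paths and cycles are given by the list of their successive vertices; the first vertex of a cycle
  is repeated at the end of its list.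
\<close>

definition walk_graph :: "'v list \<Rightarrow> 'v graph" where
  "walk_graph p = (set p, {{p ! i, p ! Suc i} |i. Suc i < length p})"

definition num_edges :: "'v list \<Rightarrow> nat" where
  "num_edges p = length p - 1"

definition is_path :: "'v list \<Rightarrow> bool" where
  "is_path p \<longleftrightarrow> num_edges p \<ge> 1 \<and> distinct p"

definition is_cycle :: "'v list \<Rightarrow> bool" where
  "is_cycle p \<longleftrightarrow> num_edges p \<ge> 3 \<and> hd p = last p \<and> distinct (tl p)"

definition has_odd_cycle :: "'v graph \<Rightarrow> bool" where
  "has_odd_cycle G \<longleftrightarrow>
     (\<exists>p. is_cycle p \<and> odd (num_edges p) \<and>
          set p \<subseteq> verts G \<and> edges (walk_graph p) \<subseteq> edges G)"

text \<open>
  In the next definition, disjointness of the edge sets is only a restriction when the ear consists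
  of a single edge: that edge must not be present in \<open>H\<close> already.
\<close>

definition is_ear :: "'v graph \<Rightarrow> 'v list \<Rightarrow> bool" where
  "is_ear H p \<longleftrightarrow>
     (is_path p \<or> is_cycle p) \<and>
     set p \<inter> verts H = {hd p, last p} \<and>
     edges (walk_graph p) \<inter> edges H = {}"

definition is_bridge_walk :: "'v graph \<Rightarrow> 'v list \<Rightarrow> bool" where
  "is_bridge_walk H p \<longleftrightarrow> (\<exists>a b. p = [a, b] \<and> is_bridge H {a, b})"

definition walks_union :: "'v list list \<Rightarrow> 'v graph" where
  "walks_union Fs = foldr (\<lambda>p H. graph_union (walk_graph p) H) Fs ({}, {})"

definition gen_ear_decomp :: "'v graph \<Rightarrow> 'v list list \<Rightarrow> bool" where
  "gen_ear_decomp H Fs \<longleftrightarrow>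
     Fs \<noteq> [] \<and>
     walks_union Fs = H \<and>
     (is_cycle (Fs ! 0) \<or> is_bridge_walk H (Fs ! 0)) \<and>
     (\<forall>i. 1 \<le> i \<and> i < length Fs \<longrightarrow>
        is_ear (walks_union (take i Fs)) (Fs ! i) \<or>
        is_bridge_walk H (Fs ! i) \<and> card (set (Fs ! i) \<inter> verts (walks_union (take i Fs))) = 1)"

text \<open>Bridges have exactly one edge, so they are never counted here.\<close>

definition num_even_ears :: "'v list list \<Rightarrow> nat" where
  "num_even_ears Fs = card {i. i < length Fs \<and> even (num_edges (Fs ! i))}"

text \<open>
  A single vertex has no generalized ear decomposition, since it contains neither a cycle nor a
  bridge; its value is set to \<open>0\<close>.
\<close>

definition ear_phi_conn :: "'v graph \<Rightarrow> nat" where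
  "ear_phi_conn H =
     (if edges H = {} then 0
      else (LEAST n. \<exists>Fs. gen_ear_decomp H Fs \<and> num_even_ears Fs = n))"

definition ear_phi :: "'v graph \<Rightarrow> nat" where
  "ear_phi H = (\<Sum>C \<in> components H. ear_phi_conn C)"

definition num_bridges :: "'v graph \<Rightarrow> nat" where
  "num_bridges H = (\<Sum>C \<in> components H. card {e. is_bridge C e})"

definition nu_star :: "'v graph \<Rightarrow> real" where
  "nu_star H =
     (if verts H = {} then 0
      else (real (card (verts H)) + real (ear_phi H) + real (num_bridges H)
            - real (card (components H))) / 2)"

section \<open>Dominant* sets\<close>

definition dominant :: "'v graph \<Rightarrow> 'v set \<Rightarrow> 'v set \<Rightarrow> bool" where
  "dominant G U W \<longleftrightarrow>
     (let Z = verts G - U in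
        W \<subseteq> verts G - (Z \<union> nbhd G Z) \<and> verts G = nbhd G W \<union> nbhd G Z \<union> Z)"

definition dominant_star :: "'v graph \<Rightarrow> 'v set \<Rightarrow> 'v set \<Rightarrow> bool" where
  "dominant_star G U W \<longleftrightarrow>
     dominant G U W \<and> (\<forall>C \<in> components (induced G W). has_odd_cycle C)"

definition dominant_star_sets :: "'v graph \<Rightarrow> 'v set \<Rightarrow> 'v set set" where
  "dominant_star_sets G U =
     (if indep_set G (verts G - U) then {W. W \<subseteq> U \<and> dominant_star G U W} else {})"

section \<open>Edge ideals and monomial primes\<close>

definition edge_ideal :: "'v graph \<Rightarrow> ('v, 'k::field) mvpoly set" where
  "edge_ideal G = genideal mvpoly_ring {mvvar i * mvvar j |i j. {i, j} \<in> edges G}"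

definition var_prime :: "'v set \<Rightarrow> ('v, 'k::field) mvpoly set" where
  "var_prime U = genideal mvpoly_ring (mvvar ` U)"

end

theory Submission
  imports Defs "HOL-Library.Multiset"
begin

text \<open>
A power of the edge ideal is a monomial ideal, so its associated primes are generated by variables
and are annihilators of monomials. A monomial with exponent vector \<open>a\<close> lies in the \<open>k\<close>-th power
iff the graph in which every vertex \<open>v\<close> is replaced by \<open>a v\<close> copies has a matching of size \<open>k\<close>.
That the annihilator is \<open>var_prime U\<close> means that adding a copy of any vertex of \<open>U\<close>, but no copies
of vertices outside \<open>U\<close>, increases the matching number. If \<open>a\<close> is reduced as far as possible,
Gallai's lemma shows that every vertex copy inside \<open>U\<close> lies in a factor-critical component, and
the vertices occurring there form a dominant* set \<open>W\<close>.

It remains to find the least number of copies making a connected non-bipartite graph \<open>H\<close>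
factor-critical, which is \<open>card V + \<phi> + \<psi>\<close>. An even ear becomes an odd one after duplicating
one of its ends, and so does a bridge, read as a closed walk of length two; hence every generalized
ear decomposition yields enough copies. Conversely, the odd ears of a factor-critical duplication
project to walks in \<open>H\<close>, which split into ears and pendant edges of the right total cost; a pendant
edge that does not remain a bridge is absorbed into a later ear without increasing the cost.
\<close>

subsection \<open>Walks\<close>

text \<open>A factor-critical component has an odd number \<open>2 * s + 1\<close> of copies and
  contributes at most \<open>s\<close> edges to any matching. Summing over components turns card +
  phi + psi into \<open>nu_star\<close>, to be compared with the largest matching size
  \<open>k - 1\<close>; a shortfall is filled by duplicating both ends of an edge.

  The exponents outside \<open>U\<close> can be raised without limit, so vertices there are never
  saturated. Hence they form an independent set without neighbours in \<open>W\<close>, and each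
  vertex of \<open>U\<close> needs a neighbour in \<open>W\<close> or outside \<open>U\<close>.

  Two obstacles shape the graph part. Building up: a decomposition may begin with a bridge or an
  even cycle, and a bipartite graph with an edge is never factor-critical. Until an odd cycle
  closes, the duplication is kept elementary bipartite, one copy below the budget; the reserve is
  spent when the colouring breaks. Tearing down: walks in the duplication may revisit vertices and
  edges of \<open>H\<close>, so cutting them can leave pendant edges that are not bridges.
  Minimizing the number of pendant edges at bounded cost excludes this.\<close>

fun wedges :: "'v list \<Rightarrow> 'v set set" where
  "wedges [] = {}"
| "wedges [a] = {}"
| "wedges (a # b # l) = insert {a, b} (wedges (b # l))"

lemma walk_graph_eq: "walk_graph p = (set p, wedges p)"
proof -
  have "{{p ! i, p ! Suc i} |i. Suc i < length p} = wedges p"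
  proof (induction p rule: wedges.induct)
    case (3 a b l)
    have "{{(a # b # l) ! i, (a # b # l) ! Suc i} |i. Suc i < length (a # b # l)} =
      insert {a, b} {{(b # l) ! i, (b # l) ! Suc i} |i. Suc i < length (b # l)}" (is "?L = ?R")
    proof
      show "?L \<subseteq> ?R"
      proof
        fix e assume "e \<in> ?L"
        then obtain i where i: "e = {(a # b # l) ! i, (a # b # l) ! Suc i}"
          "Suc i < length (a # b # l)" by blast
        show "e \<in> ?R"
          by (cases i) (use i in auto)
      qed
      have "{(b # l) ! i, (b # l) ! Suc i} \<in> ?L" if "Suc i < length (b # l)" for i
        using that by (intro CollectI exI[of _ "Suc i"]) auto
      moreover have "{a, b} \<in> ?L"
        by (intro CollectI exI[of _ 0]) auto
      ultimately show "?R \<subseteq> ?L" by blast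
    qed
    then show ?case using 3 by simp
  qed auto
  then show ?thesis by (simp add: walk_graph_def)
qed

lemma verts_graph_union [simp]: "verts (graph_union G H) = verts G \<union> verts H"
  and edges_graph_union [simp]: "edges (graph_union G H) = edges G \<union> edges H"
  by (simp_all add: graph_union_def)

lemma verts_walk_graph [simp]: "verts (walk_graph p) = set p"
  and edges_walk_graph [simp]: "edges (walk_graph p) = wedges p"
  by (simp_all add: walk_graph_eq)

lemma graph_eqI: "verts G = verts H \<Longrightarrow> edges G = edges H \<Longrightarrow> G = H"
  by (simp add: prod_eq_iff)

lemma wedges_append: "wedges (l1 @ t # l2) = wedges (l1 @ [t]) \<union> wedges (t # l2)"
  by (induction l1 rule: wedges.induct) auto

lemma wedges_snoc2: "wedges (l @ [a, b]) = insert {a, b} (wedges (l @ [a]))"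
  using wedges_append[of l a "[b]"] by auto

lemma wedges_rev [simp]: "wedges (rev p) = wedges p"
proof (induction p rule: wedges.induct)
  case (3 a b l)
  then show ?case using wedges_snoc2[of "rev l" b a] by (auto simp: insert_commute)
qed auto

lemma wedges_subset: "e \<in> wedges p \<Longrightarrow> e \<subseteq> set p"
  by (induction p rule: wedges.induct) auto

lemma wedges_split: "e \<in> wedges p \<Longrightarrow> \<exists>l1 u v l2. p = l1 @ u # v # l2 \<and> e = {u, v}"
proof (induction p rule: wedges.induct)
  case (3 a b l)
  show ?case
  proof (cases "e = {a, b}")
    case True
    then show ?thesis by (intro exI[of _ "[]"]) auto
  next
    case False
    then obtain l1 u v l2 where "b # l = l1 @ u # v # l2 \<and> e = {u, v}"
      using 3 by auto
    then show ?thesis by (intro exI[of _ "a # l1"]) auto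
  qed
qed auto

lemma wedges_adjacent: "{u, v} \<in> wedges (l1 @ u # v # l2)"
  using wedges_append[of l1 u "v # l2"] by auto

lemma hd_last_wedge:
  assumes "distinct p" "{hd p, last p} \<in> wedges p"
  shows "length p \<le> 2"
proof -
  obtain l1 u v l2 where p: "p = l1 @ u # v # l2" "{hd p, last p} = {u, v}"
    using wedges_split[OF assms(2)] by blast
  have "hd p \<noteq> v" "last p \<noteq> u"
    using assms(1) p(1) by (cases l1; auto)+
  then have "hd p = u" "last p = v" using p(2) by (auto simp: doubleton_eq_iff)
  then have "l1 = []" "l2 = []" using assms(1) p(1)
    by (cases l1; auto) (cases l2 rule: rev_cases; use assms(1) p(1) \<open>last p = v\<close> in auto)
  then show ?thesis using p by simp
qed

definition wf_graph :: "'v graph \<Rightarrow> bool" where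
  "wf_graph H \<longleftrightarrow> (\<forall>e \<in> edges H. e \<subseteq> verts H)"

lemma wf_walk_graph [simp]: "wf_graph (walk_graph p)"
  using wedges_subset by (fastforce simp: wf_graph_def)

lemma wf_graph_union [simp]: "wf_graph G \<Longrightarrow> wf_graph H \<Longrightarrow> wf_graph (graph_union G H)"
  by (auto simp: wf_graph_def)

subsection \<open>Ear sequences with pendant edges\<close>

text \<open>
  A step adds a walk \<open>x # l @ [z]\<close> whose inner vertices \<open>l\<close> are new. It is an ear, except for two
  degenerate shapes: a pendant edge occurs as the closed walk \<open>[x, y, x]\<close>, whose even length gives
  it the cost \<open>1\<close> of a bridge, and for \<open>l = []\<close> the edge may already be present. The last two
  arguments of \<open>gears\<close> are the total cost and the number of pendant edges.
\<close>

definition new_ear :: "'v graph \<Rightarrow> 'v \<Rightarrow> 'v list \<Rightarrow> 'v \<Rightarrow> bool" where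
  "new_ear H x l z \<longleftrightarrow> x \<in> verts H \<and> z \<in> verts H \<and> distinct l \<and> set l \<inter> verts H = {} \<and>
     (x = z \<longrightarrow> l \<noteq> [])"

inductive gears :: "'v graph \<Rightarrow> 'v graph \<Rightarrow> nat \<Rightarrow> nat \<Rightarrow> bool" for H0 where
  refl: "gears H0 H0 0 0"
| step: "gears H0 H n p \<Longrightarrow> new_ear H x l z \<Longrightarrow>
    gears H0 (graph_union H (walk_graph (x # l @ [z])))
      (n + of_bool (odd (length l))) (p + of_bool (x = z \<and> length l = 1))"

lemma gears_stepI:
  assumes "gears H0 H n p" "new_ear H x l z"
    "H' = graph_union H (walk_graph (x # l @ [z]))"
    "n' = n + of_bool (odd (length l))" "p' = p + of_bool (x = z \<and> length l = 1)"
  shows "gears H0 H' n' p'"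
  using gears.step[OF assms(1,2)] assms(3-5) by simp

lemma gears_trans:
  assumes "gears B C n' p'" "gears A B n p"
  shows "gears A C (n + n') (p + p')"
  using assms
proof (induction)
  case refl
  then show ?case by simp
next
  case (step H n' p' x l z)
  then show ?case by (intro gears_stepI[OF step.IH[OF step.prems] step.hyps(2)]) auto
qed

lemma gears_mono:
  assumes "gears A B n p"
  shows "verts A \<subseteq> verts B" "edges A \<subseteq> edges B"
  using assms by (induction) auto

lemma gears_wf: "gears A B n p \<Longrightarrow> wf_graph A \<Longrightarrow> wf_graph B"
  by (induction rule: gears.induct) auto

text \<open>The inner vertices of the ears lie in \<open>verts B\<close> but not in
  \<open>verts A\<close>, hence outside \<open>Y\<close>, and so they stay new. Edges of
  \<open>Y\<close> cannot interfere, because a step may repeat an edge that is already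
  present.\<close>

lemma gears_frame:
  assumes "gears A B n p" "verts Y \<inter> verts B \<subseteq> verts A"
  shows "gears (graph_union A Y) (graph_union B Y) n p"
  using assms
proof (induction)
  case refl
  then show ?case by (simp add: gears.refl)
next
  case (step H n p x l z)
  have IH: "gears (graph_union A Y) (graph_union H Y) n p"
    using step.IH step.prems by auto
  have "new_ear (graph_union H Y) x l z"
    using step.hyps(2) step.prems gears_mono(1)[OF step.hyps(1)]
    by (auto simp: new_ear_def)
  then show ?case by (rule gears_stepI[OF IH]) (auto intro!: graph_eqI)
qed

lemma new_ear_rev: "new_ear H x (rev l) z \<longleftrightarrow> new_ear H z l x"
  by (auto simp: new_ear_def)

lemma walk_graph_rev: "walk_graph (rev p) = walk_graph p"
  by (simp add: walk_graph_eq)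

lemma walk_graph_rev_ear: "walk_graph (x # rev l @ [z]) = walk_graph (z # l @ [x])"
  using walk_graph_rev[of "z # l @ [x]"] by simp

text \<open>One step of the path lemma below. The path \<open>Q\<close> to the end \<open>x\<close>
  is prolonged along \<open>l1\<close> to the inner vertex \<open>t\<close>, and the rest of the ear
  is kept as an ear from \<open>t\<close> to \<open>z\<close>; it is never a pendant edge since
  \<open>t \<noteq> z\<close>. The assumption \<open>par\<close> says that this rerouting does not
  raise the cost.\<close>

lemma gears_path_ear:
  assumes Q: "Q \<noteq> []" "last Q = x" "distinct Q" "gears (walk_graph Q) H m p'"
      "of_bool (even (q + (length l1 + 1) + num_edges Q)) + m \<le> n + of_bool (even (q + (length l1 + 1)))"
    and wf: "new_ear H x (l1 @ t # l2) z"
    and par: "of_bool (even (q + (length l1 + 1))) + of_bool (odd (length l2)) \<le>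
      (of_bool (even q) + of_bool (even (length l1 + length l2)) :: nat)"
  defines "R \<equiv> Q @ l1 @ [t]"
  shows "distinct R \<and> (\<exists>m'. gears (walk_graph R) (graph_union H (walk_graph (x # (l1 @ t # l2) @ [z]))) m' p' \<and>
     of_bool (even (q + num_edges R)) + m' \<le>
       n + of_bool (odd (length (l1 @ t # l2))) + of_bool (even q))"
proof -
  define Y where "Y = walk_graph (x # l1 @ [t])"
  have QH: "set Q \<subseteq> verts H" using gears_mono(1)[OF Q(4)] by simp
  have nw: "distinct (l1 @ t # l2)" "set (l1 @ t # l2) \<inter> verts H = {}" "z \<in> verts H" "x \<in> verts H"
    using wf by (auto simp: new_ear_def)
  have dR: "distinct R"
    unfolding R_def using Q(3) nw QH by auto
  have Qx: "Q = butlast Q @ [x]" using Q(1,2) by (metis append_butlast_last_id)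
  have xQ: "x \<in> set Q" using Q(1,2) by auto
  have R: "walk_graph R = graph_union (walk_graph Q) Y"
  proof (rule graph_eqI)
    show "verts (walk_graph R) = verts (graph_union (walk_graph Q) Y)"
      using xQ by (auto simp: R_def Y_def)
    have "R = butlast Q @ x # l1 @ [t]" unfolding R_def using Qx by (metis append.assoc append_Cons append_Nil)
    then show "edges (walk_graph R) = edges (graph_union (walk_graph Q) Y)"
      using wedges_append[of "butlast Q" x "l1 @ [t]"] Qx by (simp add: Y_def)
  qed
  have g1: "gears (walk_graph R) (graph_union H Y) m p'"
    unfolding R by (rule gears_frame[OF Q(4)]) (use nw xQ in \<open>auto simp: Y_def\<close>)
  have e2: "new_ear (graph_union H Y) t l2 z"
    using nw by (auto simp: new_ear_def Y_def)
  have tz: "t \<noteq> z" using nw by auto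
  have eqg: "graph_union H (walk_graph (x # (l1 @ t # l2) @ [z])) =
      graph_union (graph_union H Y) (walk_graph (t # l2 @ [z]))"
    using wedges_append[of "x # l1" t "l2 @ [z]"] by (intro graph_eqI) (auto simp: Y_def)
  have g2: "gears (walk_graph R) (graph_union H (walk_graph (x # (l1 @ t # l2) @ [z])))
      (m + of_bool (odd (length l2))) p'"
    by (rule gears_stepI[OF g1 e2 eqg]) (use tz in auto)
  have "num_edges R = num_edges Q + (length l1 + 1)"
    using Q(1) by (cases Q) (auto simp: R_def num_edges_def)
  then have "even (q + num_edges R) = even (q + (length l1 + 1) + num_edges Q)" by presburger
  then have "of_bool (even (q + num_edges R)) + (m + of_bool (odd (length l2))) \<le>
       n + of_bool (odd (length (l1 @ t # l2))) + of_bool (even q)"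
    using Q(5) par by simp
  then show ?thesis using dR g2 by blast
qed

text \<open>Here \<open>q\<close> stands for the number of edges of an ear that is to be continued
  through \<open>Q\<close>; only its parity matters. The inequality says that lengthening this ear
  by \<open>Q\<close> and hanging the rest of \<open>K\<close> on \<open>Q\<close> costs no more
  than the ear and the construction of \<open>K\<close> from \<open>y\<close> separately. The
  induction needs \<open>q\<close> arbitrary, as the part of the last ear up to \<open>t\<close>
  shifts the parity.\<close>

lemma gears_path:
  assumes "gears ({y}, {}) K n p" "t \<in> verts K"
  shows "\<exists>Q m p'. Q \<noteq> [] \<and> hd Q = y \<and> last Q = t \<and> distinct Q \<and>
     gears (walk_graph Q) K m p' \<and> p' \<le> p \<and>
     of_bool (even (q + num_edges Q)) + m \<le> n + of_bool (even q)"
  using assms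
proof (induction arbitrary: t q)
  case refl
  then have "t = y" by simp
  then show ?case
    by (intro exI[of _ "[y]"] exI[of _ 0])
      (use gears.refl[of "({y}, {})"] in \<open>auto simp: walk_graph_eq num_edges_def\<close>)
next
  case (step H n p x l z)
  show ?case
  proof (cases "t \<in> verts H")
    case True
    obtain Q m p' where Q: "Q \<noteq> []" "hd Q = y" "last Q = t" "distinct Q"
      "gears (walk_graph Q) H m p'" "p' \<le> p"
      "of_bool (even (q + num_edges Q)) + m \<le> n + of_bool (even q)"
      using step.IH[OF True, of q] by blast
    have "p' + of_bool (x = z \<and> length l = 1) \<le> p + of_bool (x = z \<and> length l = 1)"
      "of_bool (even (q + num_edges Q)) + (m + of_bool (odd (length l))) \<le>
        n + of_bool (odd (length l)) + of_bool (even q)"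
      using Q(6,7) by auto
    then show ?thesis
      using Q(1-4) gears.step[OF Q(5) step.hyps(2)] by blast
  next
    case False
    have *: "\<exists>Q m p'. Q \<noteq> [] \<and> hd Q = y \<and> last Q = t \<and> distinct Q \<and>
     gears (walk_graph Q) (graph_union H (walk_graph (x # l @ [z]))) m p' \<and> p' \<le> p \<and>
     of_bool (even (q + num_edges Q)) + m \<le> n + of_bool (odd (length l)) + of_bool (even q)"
      if ear: "new_ear H x l z" and l: "l = l1 @ t # l2"
        and par: "of_bool (even (q + (length l1 + 1))) + of_bool (odd (length l2)) \<le>
          (of_bool (even q) + of_bool (even (length l1 + length l2)) :: nat)" for x l z l1 l2
    proof -
      have "x \<in> verts H" using ear by (simp add: new_ear_def)
      then obtain Q m p' where Q: "Q \<noteq> []" "hd Q = y" "last Q = x" "distinct Q"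
        "gears (walk_graph Q) H m p'" "p' \<le> p"
        "of_bool (even (q + (length l1 + 1) + num_edges Q)) + m \<le> n + of_bool (even (q + (length l1 + 1)))"
        using step.IH[of x "q + (length l1 + 1)"] by blast
      have "Q @ l1 @ [t] \<noteq> []" "hd (Q @ l1 @ [t]) = y" "last (Q @ l1 @ [t]) = t"
        using Q(1,2) by auto
      then show ?thesis
        using gears_path_ear[OF Q(1,3,4,5,7) ear[unfolded l] par] Q(6)
        unfolding l by blast
    qed
    have "t \<in> set l" using False step.prems step.hyps(2) by (auto simp: new_ear_def)
    then obtain l1 l2 where l: "l = l1 @ t # l2" by (meson split_list)
    have "rev l = rev l2 @ t # rev l1" using l by simp
    note rev = *[OF iffD2[OF new_ear_rev step.hyps(2)] this]
    \<comment> \<open>The ear may be entered from either end. The choice matters only for odd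
      \<open>q\<close> and even \<open>length l\<close>: then \<open>t\<close> has to be approached
      from the end at even distance.\<close>
    have "(of_bool (even (q + (length l1 + 1))) + of_bool (odd (length l2)) \<le>
          (of_bool (even q) + of_bool (even (length l1 + length l2)) :: nat))
      \<or> (of_bool (even (q + (length l2 + 1))) + of_bool (odd (length l1)) \<le>
          (of_bool (even q) + of_bool (even (length l1 + length l2)) :: nat))"
      by (cases "even q"; cases "even (length l1)"; cases "even (length l2)"; simp)
    then have "\<exists>Q m p'. Q \<noteq> [] \<and> hd Q = y \<and> last Q = t \<and> distinct Q \<and>
     gears (walk_graph Q) (graph_union H (walk_graph (x # l @ [z]))) m p' \<and> p' \<le> p \<and>
     of_bool (even (q + num_edges Q)) + m \<le> n + of_bool (odd (length l)) + of_bool (even q)"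
    proof
      assume 1: "of_bool (even (q + (length l1 + 1))) + of_bool (odd (length l2)) \<le>
          (of_bool (even q) + of_bool (even (length l1 + length l2)) :: nat)"
      show ?thesis by (rule *[OF step.hyps(2) l 1])
    next
      assume "of_bool (even (q + (length l2 + 1))) + of_bool (odd (length l1)) \<le>
          (of_bool (even q) + of_bool (even (length l1 + length l2)) :: nat)"
      then show ?thesis using rev by (simp add: walk_graph_rev_ear add.commute)
    qed
    then show ?thesis using trans_le_add1 by blast
  qed
qed

text \<open>
  Either the pendant edge stays a bridge, or some later ear joins its two sides; this ear then
  continues through the pendant edge and, by the path lemma, through the part hanging on it.
\<close>

lemma gears_pendant_cross:
  assumes Kx: "gears K Kx n1 p1" and Ky: "gears ({y}, {}) Ky n2 p2"
    and disj: "verts Kx \<inter> verts Ky = {}" and H: "H = graph_union (graph_union Kx Ky) (walk_graph [x, y])"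
    and x: "x \<in> verts Kx" and s: "s \<in> verts Kx" and t: "t \<in> verts Ky"
    and l: "distinct l" "set l \<inter> verts H = {}" and nontriv: "\<not> (l = [] \<and> s = x \<and> t = y)"
  shows "\<exists>n' p'. gears K (graph_union H (walk_graph (s # l @ [t]))) n' p' \<and>
    n' \<le> n1 + n2 + of_bool (odd (length l)) + 1 \<and> p' \<le> p1 + p2"
proof -
  \<comment> \<open>The merged ear runs from \<open>x\<close> over the pendant edge to
    \<open>y\<close>, along \<open>Q\<close> to \<open>t\<close>, and back along \<open>l\<close> to
    \<open>s\<close>. It has \<open>length l + 2\<close> edges outside \<open>Q\<close>, which is
    the parity handed to the path lemma.\<close>
  obtain Q m p' where Q: "Q \<noteq> []" "hd Q = y" "last Q = t" "distinct Q"
    "gears (walk_graph Q) Ky m p'" "p' \<le> p2"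
    "of_bool (even (length l + 2 + num_edges Q)) + m \<le> n2 + of_bool (even (length l + 2))"
    using gears_path[OF Ky t, of "length l + 2"] by blast
  have QK: "set Q \<subseteq> verts Ky" using gears_mono(1)[OF Q(5)] by simp
  have tQ: "t \<in> set Q" and yQ: "y \<in> set Q" using Q(1-3) by auto
  have lK: "set l \<inter> verts Kx = {}" "set l \<inter> verts Ky = {}" using l(2) H by auto
  have ear: "new_ear Kx x (Q @ rev l) s"
    using x s Q(1,4) l(1) QK disj lK by (auto simp: new_ear_def)
  define G1 where "G1 = graph_union Kx (walk_graph (x # (Q @ rev l) @ [s]))"
  have len: "length Q = Suc (num_edges Q)" using Q(1) by (cases Q) (auto simp: num_edges_def)
  \<comment> \<open>The merged ear must not be a pendant edge again, or the number of pendant edges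
    would not drop. This could only happen if the new walk were the edge \<open>{x, y}\<close>
    itself.\<close>
  have nonpendant: "\<not> (x = s \<and> length (Q @ rev l) = 1)"
  proof
    assume a: "x = s \<and> length (Q @ rev l) = 1"
    then have "l = []" "length Q = 1" using Q(1) by (auto simp: add_is_1)
    then have "Q = [y]" using Q(2) by (cases Q) auto
    then show False using nontriv a \<open>l = []\<close> Q(3) by simp
  qed
  have g1: "gears K G1 (n1 + of_bool (even (length l + 2 + num_edges Q))) p1"
    by (rule gears_stepI[OF Kx ear]) (use nonpendant len in \<open>auto simp: G1_def\<close>)
  have wQ: "wedges (x # (Q @ rev l) @ [s]) = insert {x, y} (wedges Q) \<union> wedges (s # l @ [t])"
  proof -
    have Qt: "Q = butlast Q @ [t]" using Q(1,3) by (metis append_butlast_last_id)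
    have "x # (Q @ rev l) @ [s] = (x # butlast Q) @ t # (rev l @ [s])"
      by (subst Qt) simp
    then have "wedges (x # (Q @ rev l) @ [s]) = wedges ((x # butlast Q) @ [t]) \<union> wedges (t # rev l @ [s])"
      using wedges_append by metis
    moreover have "(x # butlast Q) @ [t] = x # Q" by (subst (2) Qt) simp
    moreover have "wedges (x # Q) = insert {x, y} (wedges Q)"
      using Q(1,2) by (cases Q) auto
    moreover have "wedges (t # rev l @ [s]) = wedges (s # l @ [t])"
      using wedges_rev[of "s # l @ [t]"] by simp
    ultimately show ?thesis by simp
  qed
  have "gears (graph_union (walk_graph Q) G1) (graph_union Ky G1) m p'"
    by (rule gears_frame[OF Q(5)]) (use disj lK x s in \<open>auto simp: G1_def\<close>)
  moreover have "graph_union (walk_graph Q) G1 = G1"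
    using wQ by (intro graph_eqI) (auto simp: G1_def)
  moreover have "graph_union Ky G1 = graph_union H (walk_graph (s # l @ [t]))"
    using tQ yQ QK wQ gears_mono(2)[OF Q(5)] by (intro graph_eqI) (auto simp: G1_def H)
  ultimately have "gears G1 (graph_union H (walk_graph (s # l @ [t]))) m p'" by simp
  from gears_trans[OF this g1]
  have "gears K (graph_union H (walk_graph (s # l @ [t])))
    (n1 + of_bool (even (length l + 2 + num_edges Q)) + m) (p1 + p')" .
  \<comment> \<open>The parity of the merged ear may be the worse one; the cost 1 of the pendant
    edge that has disappeared pays for this.\<close>
  moreover have "n1 + of_bool (even (length l + 2 + num_edges Q)) + m
      \<le> n1 + n2 + of_bool (odd (length l)) + 1"
    using Q(7) by (auto split: if_splits)
  ultimately show ?thesis using Q(6) by (meson add_left_mono)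
qed

text \<open>The cost \<open>n\<close> does not include the pendant edge, whose own cost is 1. Thus
  in the second alternative the pendant edge is traded away at no increase of the total cost, and
  the total number of pendant edges drops by at least one.\<close>

lemma gears_pendant:
  assumes "gears (graph_union K (walk_graph [x, y])) H n p" "x \<in> verts K" "y \<notin> verts K"
  shows "(\<exists>Kx Ky n1 n2 p1 p2. gears K Kx n1 p1 \<and> gears ({y}, {}) Ky n2 p2 \<and>
      verts Kx \<inter> verts Ky = {} \<and> H = graph_union (graph_union Kx Ky) (walk_graph [x, y]) \<and>
      n1 + n2 = n \<and> p1 + p2 = p) \<or>
    (\<exists>n' p'. gears K H n' p' \<and> n' \<le> n + 1 \<and> p' \<le> p)"
  using assms
proof (induction)
  case refl
  show ?case
    by (rule disjI1, intro exI[of _ K] exI[of _ "({y}, {})"] exI[of _ 0])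
      (use refl in \<open>auto intro!: gears.refl graph_eqI\<close>)
next
  case (step H n p s l t)
  let ?c = "of_bool (odd (length l)) :: nat" and ?d = "of_bool (s = t \<and> length l = 1) :: nat"
  let ?H = "graph_union H (walk_graph (s # l @ [t]))"
  note ear = step.hyps(2)[unfolded new_ear_def]
  consider (split) "\<exists>Kx Ky n1 n2 p1 p2. gears K Kx n1 p1 \<and> gears ({y}, {}) Ky n2 p2 \<and>
      verts Kx \<inter> verts Ky = {} \<and> H = graph_union (graph_union Kx Ky) (walk_graph [x, y]) \<and>
      n1 + n2 = n \<and> p1 + p2 = p"
    | (joined) "\<exists>n' p'. gears K H n' p' \<and> n' \<le> n + 1 \<and> p' \<le> p"
    using step.IH step.prems by blast
  then show ?case
  proof cases
    case joined
    then obtain n' p' where "gears K H n' p'" "n' \<le> n + 1" "p' \<le> p" by blast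
    then have "gears K ?H (n' + ?c) (p' + ?d)" "n' + ?c \<le> n + ?c + 1" "p' + ?d \<le> p + ?d"
      using gears.step[OF _ step.hyps(2)] by auto
    then show ?thesis by blast
  next
    case split
    then obtain Kx Ky n1 n2 p1 p2 where Kx: "gears K Kx n1 p1" and Ky: "gears ({y}, {}) Ky n2 p2"
      and disj: "verts Kx \<inter> verts Ky = {}" and H: "H = graph_union (graph_union Kx Ky) (walk_graph [x, y])"
      and np: "n1 + n2 = n" "p1 + p2 = p" by blast
    have xK: "x \<in> verts Kx" using gears_mono(1)[OF Kx] step.prems by auto
    have yK: "y \<in> verts Ky" using gears_mono(1)[OF Ky] by auto
    have lH: "set l \<inter> verts Kx = {}" "set l \<inter> verts Ky = {}" "set l \<inter> verts H = {}"
      using ear H by auto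
    have st: "s \<in> verts Kx \<or> s \<in> verts Ky" "t \<in> verts Kx \<or> t \<in> verts Ky"
      using ear H xK yK by auto
    have trivial: ?thesis if triv: "l = []" "{s, t} = {x, y}"
    proof -
      have "?H = H" using that H xK yK ear by (intro graph_eqI) auto
      moreover have "s \<noteq> t" using ear triv by auto
      moreover from this have "n1 + n2 = n + ?c" "p1 + p2 = p + ?d" using triv np by auto
      ultimately show ?thesis using Kx Ky disj H by metis
    qed
    consider (xx) "s \<in> verts Kx" "t \<in> verts Kx" | (yy) "s \<in> verts Ky" "t \<in> verts Ky"
      | (xy) "s \<in> verts Kx" "t \<in> verts Ky" | (yx) "s \<in> verts Ky" "t \<in> verts Kx"
      using st by blast
    then show ?thesis
    proof cases
      case xx
      define Kx' where "Kx' = graph_union Kx (walk_graph (s # l @ [t]))"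
      have "gears K Kx' (n1 + ?c) (p1 + ?d)"
        unfolding Kx'_def by (rule gears.step[OF Kx]) (use xx ear lH in \<open>auto simp: new_ear_def\<close>)
      moreover have "verts Kx' \<inter> verts Ky = {}" using disj xx lH by (auto simp: Kx'_def)
      moreover have "?H = graph_union (graph_union Kx' Ky) (walk_graph [x, y])"
        by (rule graph_eqI) (auto simp: Kx'_def H)
      moreover have "n1 + ?c + n2 = n + ?c" "p1 + ?d + p2 = p + ?d" using np by auto
      ultimately show ?thesis using Ky by blast
    next
      case yy
      define Ky' where "Ky' = graph_union Ky (walk_graph (s # l @ [t]))"
      have "gears ({y}, {}) Ky' (n2 + ?c) (p2 + ?d)"
        unfolding Ky'_def by (rule gears.step[OF Ky]) (use yy ear lH in \<open>auto simp: new_ear_def\<close>)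
      moreover have "verts Kx \<inter> verts Ky' = {}" using disj yy lH by (auto simp: Ky'_def)
      moreover have "?H = graph_union (graph_union Kx Ky') (walk_graph [x, y])"
        by (rule graph_eqI) (auto simp: Ky'_def H)
      moreover have "n1 + (n2 + ?c) = n + ?c" "p1 + (p2 + ?d) = p + ?d" using np by auto
      ultimately show ?thesis using Kx by blast
    next
      case xy
      show ?thesis
      proof (cases "l = [] \<and> s = x \<and> t = y")
        case True
        then show ?thesis using trivial by auto
      next
        case False
        show ?thesis
          using gears_pendant_cross[OF Kx Ky disj H xK xy _ lH(3) False] ear np
          by (meson trans_le_add1)
      qed
    next
      case yx
      show ?thesis
      proof (cases "l = [] \<and> s = y \<and> t = x")
        case True
        then show ?thesis using trivial by auto
      next
        case False
        have "\<exists>n' p'. gears K (graph_union H (walk_graph (t # rev l @ [s]))) n' p' \<and>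
            n' \<le> n1 + n2 + of_bool (odd (length (rev l))) + 1 \<and> p' \<le> p1 + p2"
          by (rule gears_pendant_cross[OF Kx Ky disj H xK yx(2,1)]) (use ear lH False in auto)
        then have "\<exists>n' p'. gears K ?H n' p' \<and> n' \<le> n + ?c + 1 \<and> p' \<le> p"
          unfolding walk_graph_rev_ear length_rev np .
        then show ?thesis by (meson trans_le_add1)
      qed
    qed
  qed
qed

subsection \<open>From ear sequences to generalized ear decompositions\<close>

lemma adj_sym: "adj H u v \<Longrightarrow> adj H v u"
  by (simp add: adj_def insert_commute)

lemma adj_rtranclp_sym: "(adj H)\<^sup>*\<^sup>* u v \<Longrightarrow> (adj H)\<^sup>*\<^sup>* v u"
  by (induction rule: rtranclp_induct) (auto intro: adj_sym converse_rtranclp_into_rtranclp)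

lemma adj_rtranclp_mono: "(adj H)\<^sup>*\<^sup>* u v \<Longrightarrow> edges H \<subseteq> edges H' \<Longrightarrow> (adj H')\<^sup>*\<^sup>* u v"
  by (erule rtranclp_mono[THEN predicate2D, rotated]) (auto simp: adj_def)

lemma walk_reachable:
  "wedges p \<subseteq> edges H \<Longrightarrow> u \<in> set p \<Longrightarrow> (adj H)\<^sup>*\<^sup>* (hd p) u"
proof (induction p rule: wedges.induct)
  case (3 a b l)
  show ?case
  proof (cases "u = a")
    case False
    then have "(adj H)\<^sup>*\<^sup>* b u" using 3 by auto
    moreover have "adj H a b" using 3 by (auto simp: adj_def)
    ultimately show ?thesis by (simp add: converse_rtranclp_into_rtranclp)
  qed simp
qed auto

lemma gears_reachable:
  assumes "gears ({r}, {}) H n p" "u \<in> verts H"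
  shows "(adj H)\<^sup>*\<^sup>* r u"
  using assms
proof (induction arbitrary: u)
  case (step H n p x l z)
  let ?H = "graph_union H (walk_graph (x # l @ [z]))"
  show ?case
  proof (cases "u \<in> verts H")
    case True
    then show ?thesis using adj_rtranclp_mono[OF step.IH] by simp
  next
    case False
    then have "(adj ?H)\<^sup>*\<^sup>* x u"
      using walk_reachable[of "x # l @ [z]" ?H u] step.prems by auto
    moreover have "(adj ?H)\<^sup>*\<^sup>* r x"
      using adj_rtranclp_mono[OF step.IH[of x]] step.hyps(2) by (simp add: new_ear_def)
    ultimately show ?thesis by simp
  qed
qed auto

text \<open>Only the two ends of an ear can coincide, so an edge could be traversed twice only by
  the closed walk of length two, which the third assumption excludes.\<close>

lemma ear_edge_unique:
  assumes "distinct (x # l)" "z \<notin> set l" "x = z \<Longrightarrow> l \<noteq> [] \<and> length l \<noteq> 1"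
    and w: "x # l @ [z] = w1 @ u # v # w2"
  shows "{u, v} \<notin> wedges (w1 @ [u])"
proof
  assume e: "{u, v} \<in> wedges (w1 @ [u])"
  then have v: "v \<in> set (w1 @ [u])" using wedges_subset by fast
  show False
  proof (cases w2 rule: rev_cases)
    case Nil
    then have xl: "x # l = w1 @ [u]" "z = v" using w by (metis append_eq_append_conv
        append.assoc append_Cons append_Nil last_snoc butlast_snoc)+
    then have "v = x" using v assms(2) by (metis set_ConsD)
    moreover have "{hd (w1 @ [u]), last (w1 @ [u])} = {u, v}"
      using xl(1) \<open>v = x\<close> by (metis insert_commute last_snoc list.sel(1))
    ultimately have "length (w1 @ [u]) \<le> 2"
      using hd_last_wedge[of "w1 @ [u]"] e assms(1) xl(1) by simp
    then have "length l \<le> 1" using xl(1) by (metis Suc_le_mono length_Cons numeral_2_eq_2 One_nat_def)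
    then show False using assms(3) xl(2) \<open>v = x\<close> by (cases l) auto
  next
    case (snoc w' z')
    then have "(x # l) @ [z] = (w1 @ u # v # w') @ [z']" using w by simp
    then have "x # l = w1 @ u # v # w'" by (metis append1_eq_conv)
    then show False using assms(1) v by auto
  qed
qed

text \<open>For an edge of \<open>H\<close> this expresses that it is not a bridge, in a form that
  is preserved when edges are added.\<close>

definition linked :: "'v graph \<Rightarrow> 'v set \<Rightarrow> bool" where
  "linked H e \<longleftrightarrow> (\<exists>u v. e = {u, v} \<and> (adj (verts H, edges H - {e}))\<^sup>*\<^sup>* u v)"

lemma linked_mono: "linked H e \<Longrightarrow> edges H \<subseteq> edges H' \<Longrightarrow> linked H' e"
  unfolding linked_def using adj_rtranclp_mono
  by (metis (no_types, lifting) Diff_mono order_refl snd_conv)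

lemma linked_not_bridge: "linked H e \<Longrightarrow> \<not> is_bridge H e"
  unfolding linked_def is_bridge_def by (auto simp: doubleton_eq_iff dest: adj_rtranclp_sym)

text \<open>Cutting the ear at \<open>e\<close> leaves two arcs, one attached to \<open>x\<close>
  and one to \<open>z\<close>, and the old graph joins \<open>x\<close> to \<open>z\<close> without
  using \<open>e\<close>.\<close>

lemma ear_edge_linked:
  assumes "new_ear H x l z" "\<not> (x = z \<and> length l = 1)" "(adj H)\<^sup>*\<^sup>* x z"
    and e: "e \<in> wedges (x # l @ [z])" "e \<notin> edges H"
  shows "linked (graph_union H (walk_graph (x # l @ [z]))) e"
proof -
  let ?F = "(verts (graph_union H (walk_graph (x # l @ [z]))),
    edges (graph_union H (walk_graph (x # l @ [z]))) - {e})"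
  have d: "distinct (x # l)" "z \<notin> set l" "x = z \<Longrightarrow> l \<noteq> [] \<and> length l \<noteq> 1" "distinct (z # rev l)"
    using assms(1,2) by (auto simp: new_ear_def)
  obtain w1 u v w2 where w: "x # l @ [z] = w1 @ u # v # w2" "e = {u, v}"
    using wedges_split[OF e(1)] by blast
  have "e \<notin> wedges (w1 @ [u])"
    using ear_edge_unique[OF d(1,2,3) w(1)] w(2) by simp
  then have "wedges (w1 @ [u]) \<subseteq> edges ?F"
    using w(1) wedges_append[of w1 u "v # w2"] by auto
  from walk_reachable[OF this, of u] have u: "(adj ?F)\<^sup>*\<^sup>* x u"
    using w(1) by (cases w1) auto
  have "rev (x # l @ [z]) = rev (w1 @ u # v # w2)" using w(1) by simp
  then have w': "z # rev l @ [x] = rev w2 @ v # u # rev w1" by simp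
  have "{v, u} \<notin> wedges (rev w2 @ [v])"
    by (rule ear_edge_unique[OF d(4) _ _ w']) (use d in auto)
  then have "e \<notin> wedges (rev w2 @ [v])" using w(2) by (simp add: insert_commute)
  then have "wedges (rev w2 @ [v]) \<subseteq> edges ?F"
    using wedges_append[of "rev w2" v "u # rev w1"] wedges_rev[of "x # l @ [z]"]
    by (auto simp flip: w' w(1))
  from walk_reachable[OF this, of v] have v: "(adj ?F)\<^sup>*\<^sup>* z v"
    using w' by (cases "rev w2") auto
  have "(adj ?F)\<^sup>*\<^sup>* x z"
    using assms(3) e(2) by (auto intro: adj_rtranclp_mono)
  then have "(adj ?F)\<^sup>*\<^sup>* u v"
    using u v by (meson adj_rtranclp_sym rtranclp_trans)
  then show ?thesis using w(2) by (auto simp: linked_def)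
qed

text \<open>The set \<open>B\<close> collects the pendant edges. Every other new edge lies on a
  cycle through the old graph, which is connected, and linked edges stay linked.\<close>

lemma gears_bridges:
  assumes "gears ({r}, {}) H n p"
  shows "\<exists>B. finite B \<and> card B \<le> p \<and> (\<forall>e \<in> edges H - B. linked H e)"
  using assms
proof (induction)
  case refl
  then show ?case by (intro exI[of _ "{}"]) auto
next
  case (step H n p x l z)
  let ?H = "graph_union H (walk_graph (x # l @ [z]))"
  obtain B where B: "finite B" "card B \<le> p" "\<forall>e \<in> edges H - B. linked H e"
    using step.IH by blast
  have mono: "linked ?H e" if "e \<in> edges H - B" for e
    using B(3) that by (auto intro: linked_mono)
  show ?case
  proof (cases "x = z \<and> length l = 1")
    case True
    then obtain y where l: "l = [y]" by (cases l) auto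
    have "edges ?H = insert {x, y} (edges H)" using True l by (auto simp: insert_commute)
    then show ?thesis
      using B(1,2) mono True
      by (intro exI[of _ "insert {x, y} B"]) (auto simp: card_insert_if)
  next
    case False
    have "(adj H)\<^sup>*\<^sup>* x z"
      using gears_reachable[OF step.hyps(1)] step.hyps(2) unfolding new_ear_def
      by (meson adj_rtranclp_sym rtranclp_trans)
    then have "linked ?H e" if "e \<in> edges ?H - B" for e
      using ear_edge_linked[OF step.hyps(2) False] that mono by auto
    then show ?thesis using B(1,2) by (intro exI[of _ B]) auto
  qed
qed

lemma card_bridges_le:
  assumes "gears ({r}, {}) H n p"
  shows "card {e. is_bridge H e} \<le> p"
proof -
  obtain B where B: "finite B" "card B \<le> p" "\<forall>e \<in> edges H - B. linked H e"
    using gears_bridges[OF assms] by blast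
  have "{e. is_bridge H e} \<subseteq> B"
    using B(3) linked_not_bridge by (metis DiffI is_bridge_def mem_Collect_eq subsetI)
  then show ?thesis using B(1,2) card_mono order_trans by blast
qed

text \<open>A walk from \<open>x\<close> that avoids the edge \<open>{x, y}\<close> never leaves
  \<open>Kx\<close>.\<close>

lemma gears_split_bridge:
  assumes Kx: "wf_graph Kx" "x \<in> verts Kx" and Ky: "wf_graph Ky" "y \<in> verts Ky"
    and disj: "verts Kx \<inter> verts Ky = {}"
  shows "is_bridge (graph_union (graph_union Kx Ky) (walk_graph [x, y])) {x, y}"
proof -
  let ?H = "graph_union (graph_union Kx Ky) (walk_graph [x, y])"
  have "v \<in> verts Kx" if "(adj (verts ?H, edges ?H - {{x, y}}))\<^sup>*\<^sup>* x v" for v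
    using that
  proof (induction rule: rtranclp_induct)
    case (step u v)
    then have "{u, v} \<in> edges Kx \<or> {u, v} \<in> edges Ky" by (auto simp: adj_def)
    then have "{u, v} \<subseteq> verts Kx \<or> {u, v} \<subseteq> verts Ky" using Kx(1) Ky(1) by (metis wf_graph_def)
    then show ?case using step.IH disj by auto
  qed (rule Kx(2))
  then show ?thesis
    using Ky(2) disj unfolding is_bridge_def by auto
qed

section \<open>Prefixes of decompositions, with bridges judged in the final graph\<close>

definition gen_prefix :: "'v graph \<Rightarrow> 'v list list \<Rightarrow> bool" where
  "gen_prefix H Fs \<longleftrightarrow> Fs \<noteq> [] \<and> (is_cycle (Fs ! 0) \<or> is_bridge_walk H (Fs ! 0)) \<and>
     (\<forall>i. 1 \<le> i \<and> i < length Fs \<longrightarrow>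
        is_ear (walks_union (take i Fs)) (Fs ! i) \<or>
        is_bridge_walk H (Fs ! i) \<and> card (set (Fs ! i) \<inter> verts (walks_union (take i Fs))) = 1)"

lemma gen_ear_decomp_prefix: "gen_ear_decomp H Fs \<longleftrightarrow> gen_prefix H Fs \<and> walks_union Fs = H"
  by (auto simp: gen_ear_decomp_def gen_prefix_def)

lemma gen_prefix_single: "gen_prefix H [q] \<longleftrightarrow> is_cycle q \<or> is_bridge_walk H q"
  by (auto simp: gen_prefix_def)

lemma gen_prefix_snoc:
  assumes "gen_prefix H Fs" "is_ear (walks_union Fs) q \<or>
    is_bridge_walk H q \<and> card (set q \<inter> verts (walks_union Fs)) = 1"
  shows "gen_prefix H (Fs @ [q])"
  using assms unfolding gen_prefix_def by (auto simp: nth_append less_Suc_eq)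

lemma walks_union_snoc: "walks_union (Fs @ [q]) = graph_union (walks_union Fs) (walk_graph q)"
  by (induction Fs) (auto simp: walks_union_def intro!: graph_eqI)

lemma num_even_ears_snoc:
  "num_even_ears (Fs @ [q]) = num_even_ears Fs + of_bool (even (num_edges q))"
proof -
  have "{i. i < length (Fs @ [q]) \<and> even (num_edges ((Fs @ [q]) ! i))} =
    {i. i < length Fs \<and> even (num_edges (Fs ! i))} \<union> (if even (num_edges q) then {length Fs} else {})"
    by (auto simp: nth_append less_Suc_eq)
  then show ?thesis by (simp add: num_even_ears_def)
qed

lemma new_ear_is_ear:
  assumes ear: "new_ear H x l z" and wf: "wf_graph H" and "\<not> (x = z \<and> length l = 1)"
    and new: "l = [] \<Longrightarrow> {x, z} \<notin> edges H"
  shows "is_ear H (x # l @ [z])"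
proof -
  have "is_path (x # l @ [z]) \<or> is_cycle (x # l @ [z])"
  proof (cases "x = z")
    case True
    then have "length l \<ge> 2" using ear assms(3) by (cases l rule: wedges.cases) (auto simp: new_ear_def)
    then show ?thesis using True ear by (auto simp: is_cycle_def num_edges_def new_ear_def)
  next
    case False
    then show ?thesis using ear by (auto simp: is_path_def num_edges_def new_ear_def)
  qed
  moreover have "set (x # l @ [z]) \<inter> verts H = {x, z}"
    using ear by (auto simp: new_ear_def)
  moreover have "e \<notin> edges H" if e: "e \<in> wedges (x # l @ [z])" for e
  proof (cases "l = []")
    case True
    then show ?thesis using e new by auto
  next
    case False
    obtain w1 u v w2 where w: "x # l @ [z] = w1 @ u # v # w2" "e = {u, v}"
      using wedges_split[OF e] by blast
    have "u \<in> set l \<or> v \<in> set l"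
    proof (cases w1)
      case Nil
      then show ?thesis using w(1) False by (cases l) auto
    next
      case (Cons a w1')
      then have "l @ [z] = (w1' @ [u]) @ v # w2" using w(1) by simp
      then show ?thesis by (cases w2 rule: rev_cases) (auto simp flip: append_assoc append_Cons)
    qed
    then have "\<not> e \<subseteq> verts H" using ear w(2) by (auto simp: new_ear_def)
    then show ?thesis using wf by (auto simp: wf_graph_def)
  qed
  ultimately show ?thesis by (auto simp: is_ear_def)
qed

text \<open>The last assumption makes the number of pendant edges minimal among all sequences for
  \<open>H\<close> of cost at most \<open>N\<close>. If a pendant edge were no bridge of
  \<open>H\<close>, \<open>gears_pendant\<close> would save one at no extra cost. As bridges refer
  to the final graph, the rest of the sequence from \<open>B\<close> to \<open>H\<close> is carried
  along the induction. The first alternative is there because a decomposition cannot be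
  empty.\<close>

lemma gears_gen_prefix:
  assumes "gears ({r}, {}) B n p" "gears B H n2 p2" "n + n2 \<le> N"
    and "\<And>n' p'. gears ({r}, {}) H n' p' \<Longrightarrow> n' \<le> N \<Longrightarrow> p + p2 \<le> p'"
  shows "B = ({r}, {}) \<and> n = 0 \<and> p = 0 \<or>
    (\<exists>Fs. gen_prefix H Fs \<and> walks_union Fs = B \<and> num_even_ears Fs + p = n)"
  using assms
proof (induction arbitrary: n2 p2)
  case (step B n p x l z)
  let ?B = "graph_union B (walk_graph (x # l @ [z]))"
  let ?c = "of_bool (odd (length l)) :: nat" and ?d = "of_bool (x = z \<and> length l = 1) :: nat"
  have "gears B H (?c + n2) (?d + p2)"
    using gears_trans[OF step.prems(1) gears.step[OF gears.refl step.hyps(2)]] by simp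
  then have IH: "B = ({r}, {}) \<and> n = 0 \<and> p = 0 \<or>
    (\<exists>Fs. gen_prefix H Fs \<and> walks_union Fs = B \<and> num_even_ears Fs + p = n)"
    using step.IH[of "?c + n2" "?d + p2"] step.prems(2,3) by (simp add: add.assoc)
  have wfB: "wf_graph B" using gears_wf[OF step.hyps(1)] by (simp add: wf_graph_def)
  have extend: ?case
    if q: "is_ear B q \<or> is_bridge_walk H q \<and> card (set q \<inter> verts B) = 1"
      and q0: "B = ({r}, {}) \<Longrightarrow> (is_cycle q \<or> is_bridge_walk H q) \<and> r \<in> set q"
      and eq: "?B = graph_union B (walk_graph q)"
      and cost: "of_bool (even (num_edges q)) + ?d = ?c" for q
    using IH
  proof
    assume B: "B = ({r}, {}) \<and> n = 0 \<and> p = 0"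
    have "gen_prefix H [q]" using q0 B by (simp add: gen_prefix_single)
    moreover have "walks_union [q] = ?B"
      unfolding eq using q0 B by (auto simp: walks_union_def intro!: graph_eqI)
    moreover have "num_even_ears [q] = of_bool (even (num_edges q))"
      using num_even_ears_snoc[of "[]" q] by (simp add: num_even_ears_def)
    ultimately show ?case using B cost by (intro disjI2 exI[of _ "[q]"]) simp
  next
    assume "\<exists>Fs. gen_prefix H Fs \<and> walks_union Fs = B \<and> num_even_ears Fs + p = n"
    then obtain Fs where Fs: "gen_prefix H Fs" "walks_union Fs = B" "num_even_ears Fs + p = n" by blast
    have "gen_prefix H (Fs @ [q])" using gen_prefix_snoc[OF Fs(1)] q Fs(2) by simp
    moreover have "walks_union (Fs @ [q]) = ?B" using Fs(2) eq by (simp add: walks_union_snoc)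
    moreover have "num_even_ears (Fs @ [q]) + (p + ?d) = n + ?c"
      using Fs(3) cost by (simp add: num_even_ears_snoc)
    ultimately show ?case by blast
  qed
  consider (trivial) "l = []" "{x, z} \<in> edges B" | (pendant) "x = z" "length l = 1"
    | (ear) "\<not> (x = z \<and> length l = 1)" "l = [] \<Longrightarrow> {x, z} \<notin> edges B" by blast
  then show ?case
  proof cases
    \<comment> \<open>Such a step is free and changes nothing; it is dropped because
      \<open>is_ear\<close> does not admit an edge that is already present.\<close>
    case trivial
    then have "?B = B" using step.hyps(2) by (auto simp: new_ear_def intro!: graph_eqI)
    moreover have "x \<noteq> z" using trivial step.hyps(2) by (auto simp: new_ear_def)
    ultimately show ?thesis using IH trivial by simp
  next
    case pendant
    then obtain y where l: "l = [y]" by (cases l) auto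
    have y: "x \<in> verts B" "y \<notin> verts B" using step.hyps(2) l by (auto simp: new_ear_def)
    have eq: "?B = graph_union B (walk_graph [x, y])"
      using l pendant by (auto intro!: graph_eqI)
    have g: "gears (graph_union B (walk_graph [x, y])) H n2 p2" using step.prems(1) eq by simp
    have "is_bridge H {x, y}"
      using gears_pendant[OF g y]
    proof
      assume "\<exists>Kx Ky n1 n2' p1 p2'. gears B Kx n1 p1 \<and> gears ({y}, {}) Ky n2' p2' \<and>
        verts Kx \<inter> verts Ky = {} \<and> H = graph_union (graph_union Kx Ky) (walk_graph [x, y]) \<and>
        n1 + n2' = n2 \<and> p1 + p2' = p2"
      then obtain Kx Ky n1 n2' p1 p2' where K: "gears B Kx n1 p1" "gears ({y}, {}) Ky n2' p2'"
        "verts Kx \<inter> verts Ky = {}" "H = graph_union (graph_union Kx Ky) (walk_graph [x, y])"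
        by blast
      show ?thesis
        unfolding K(4)
        by (rule gears_split_bridge[OF _ _ _ _ K(3)])
          (use gears_mono(1)[OF K(1)] gears_mono(1)[OF K(2)] gears_wf[OF K(1) wfB] gears_wf[OF K(2)] y
            in \<open>auto simp: wf_graph_def\<close>)
    next
      assume "\<exists>n' p'. gears B H n' p' \<and> n' \<le> n2 + 1 \<and> p' \<le> p2"
      then obtain n' p' where "gears B H n' p'" "n' \<le> n2 + 1" "p' \<le> p2" by blast
      then show ?thesis
        using step.prems(3)[OF gears_trans[OF _ step.hyps(1)], of n' p'] step.prems(2) pendant by auto
    qed
    then have b: "is_bridge_walk H [x, y]" by (auto simp: is_bridge_walk_def)
    moreover have "set [x, y] \<inter> verts B = {x}" using y by auto
    ultimately show ?thesis
      using pendant l y by (intro extend[of "[x, y]"] eq) (auto simp: num_edges_def)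
  next
    case ear
    have e: "is_ear B (x # l @ [z])"
      by (rule new_ear_is_ear[OF step.hyps(2) wfB ear])
    show ?thesis
      by (rule extend[of "x # l @ [z]"])
        (use e ear step.hyps(2) in \<open>auto simp: num_edges_def is_ear_def is_path_def new_ear_def\<close>)
  qed
qed simp

text \<open>Among the sequences of cost at most \<open>n\<close>, one with the fewest pendant edges
  is taken. Its pendant edges become bridge steps, and there are at least as many of them as bridges
  of \<open>H\<close>, so the cost covers even ears and bridges together.\<close>

lemma gears_gen_ear_decomp:
  assumes "gears ({r}, {}) H n p" "edges H \<noteq> {}"
  shows "\<exists>Fs. gen_ear_decomp H Fs \<and> num_even_ears Fs + card {e. is_bridge H e} \<le> n"
proof -
  define P where "P = (\<lambda>p. \<exists>n' \<le> n. gears ({r}, {}) H n' p)"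
  have "P p" using assms(1) by (auto simp: P_def)
  then have "P (LEAST p. P p)" by (rule LeastI)
  then obtain p0 n' where n': "n' \<le> n" "gears ({r}, {}) H n' p0" "p0 = (LEAST p. P p)"
    by (auto simp: P_def)
  have "p0 \<le> p'" if "gears ({r}, {}) H n'' p'" "n'' \<le> n" for n'' p'
    unfolding n'(3) by (rule Least_le) (use that in \<open>auto simp: P_def\<close>)
  with gears_gen_prefix[OF n'(2) gears.refl, of n] n'(1) assms(2)
  obtain Fs where "gen_prefix H Fs" "walks_union Fs = H" "num_even_ears Fs + p0 = n'"
    by auto
  then show ?thesis
    using card_bridges_le[OF n'(2)] n'(1) unfolding gen_ear_decomp_prefix
    by (intro exI[of _ Fs]) auto
qed

subsection \<open>Adding arbitrary walks\<close>

lemma even_floor_add: "2 * (a div 2) + 2 * (b div 2) \<le> 2 * ((a + b) div (2::nat))"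
  by presburger

text \<open>The right side is \<open>length l\<close> rounded up to an even number, which is the
  number of copies that the walk uses up in a duplication. A proper ear attains equality. Otherwise
  the walk meets an old vertex or itself and is cut there into two walks that share its
  \<open>length l + 1\<close> edges; rounding numbers of edges down to even ones is
  superadditive.\<close>

lemma gears_walk:
  assumes "x \<in> verts K" "z \<in> verts K" "\<forall>e \<in> wedges (x # l @ [z]). card e = 2"
  shows "\<exists>n p. gears K (graph_union K (walk_graph (x # l @ [z]))) n p \<and>
    n + card (set l - verts K) \<le> 2 * ((length l + 1) div 2)"
  using assms
proof (induction "length l" arbitrary: l x z K rule: less_induct)
  case less
  show ?case
  proof (cases "set l \<inter> verts K = {}")
    case False
    then obtain t where "t \<in> set l" and tK: "t \<in> verts K" by blast
    then obtain l1 l2 where l: "l = l1 @ t # l2" by (meson split_list)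
    have w: "wedges (x # l @ [z]) = wedges (x # l1 @ [t]) \<union> wedges (t # l2 @ [z])"
      using wedges_append[of "x # l1" t "l2 @ [z]"] l by simp
    define K1 where "K1 = graph_union K (walk_graph (x # l1 @ [t]))"
    obtain n1 p1 where 1: "gears K K1 n1 p1"
      "n1 + card (set l1 - verts K) \<le> 2 * ((length l1 + 1) div 2)"
      unfolding K1_def using less.hyps[of l1 x K t] less.prems tK w l by auto
    obtain n2 p2 where 2: "gears K1 (graph_union K1 (walk_graph (t # l2 @ [z]))) n2 p2"
      "n2 + card (set l2 - verts K1) \<le> 2 * ((length l2 + 1) div 2)"
      using less.hyps[of l2 t K1 z] less.prems tK w l by (auto simp: K1_def)
    have "graph_union K (walk_graph (x # l @ [z])) = graph_union K1 (walk_graph (t # l2 @ [z]))"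
      using w by (intro graph_eqI) (auto simp: K1_def l)
    with gears_trans[OF 2(1) 1(1)]
    have g: "gears K (graph_union K (walk_graph (x # l @ [z]))) (n1 + n2) (p1 + p2)" by simp
    have "set l - verts K \<subseteq> (set l1 - verts K) \<union> (set l2 - verts K1)"
      using tK less.prems by (auto simp: l K1_def)
    then have "card (set l - verts K) \<le> card ((set l1 - verts K) \<union> (set l2 - verts K1))"
      by (intro card_mono) auto
    also have "\<dots> \<le> card (set l1 - verts K) + card (set l2 - verts K1)"
      by (rule card_Un_le)
    finally have "card (set l - verts K) \<le> \<dots>" .
    moreover have "length l = length l1 + length l2 + 1" by (simp add: l)
    ultimately have "n1 + n2 + card (set l - verts K) \<le> 2 * ((length l + 1) div 2)"
      using 1(2) 2(2) even_floor_add[of "length l1 + 1" "length l2 + 1"] by (simp; linarith)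
    with g show ?thesis by blast
  next
    case disj: True
    show ?thesis
    proof (cases "distinct l")
      case True
      have "x = z \<Longrightarrow> l \<noteq> []" using less.prems(3) by auto
      then have "new_ear K x l z" using True disj less.prems by (auto simp: new_ear_def)
      from gears.step[OF gears.refl this]
      have "gears K (graph_union K (walk_graph (x # l @ [z]))) (of_bool (odd (length l)))
        (of_bool (x = z \<and> length l = 1))" by simp
      moreover have "set l - verts K = set l" using disj by auto
      then have "of_bool (odd (length l)) + card (set l - verts K) \<le> 2 * ((length l + 1) div 2)"
        using distinct_card[OF True] by (cases "odd (length l)") auto
      ultimately show ?thesis by blast
    next
      case False
      then obtain l1 t l2 l3 where "l = l1 @ [t] @ l2 @ [t] @ l3"
        by (meson not_distinct_decomp)
      then have l: "l = l1 @ t # l2 @ t # l3" by simp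
      have w: "wedges (x # l @ [z]) =
          wedges (x # (l1 @ t # l3) @ [z]) \<union> wedges (t # l2 @ [t])"
        using wedges_append[of "x # l1" t "l2 @ t # l3 @ [z]"] wedges_append[of "t # l2" t "l3 @ [z]"]
          wedges_append[of "x # l1" t "l3 @ [z]"] l by auto
      define K1 where "K1 = graph_union K (walk_graph (x # (l1 @ t # l3) @ [z]))"
      obtain n1 p1 where 1: "gears K K1 n1 p1"
        "n1 + card (set (l1 @ t # l3) - verts K) \<le> 2 * ((length (l1 @ t # l3) + 1) div 2)"
        unfolding K1_def using less.hyps[of "l1 @ t # l3" x K z] less.prems w l by auto
      obtain n2 p2 where 2: "gears K1 (graph_union K1 (walk_graph (t # l2 @ [t]))) n2 p2"
        "n2 + card (set l2 - verts K1) \<le> 2 * ((length l2 + 1) div 2)"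
        using less.hyps[of l2 t K1 t] less.prems w l by (auto simp: K1_def)
      have "graph_union K (walk_graph (x # l @ [z])) = graph_union K1 (walk_graph (t # l2 @ [t]))"
        using w by (intro graph_eqI) (auto simp: K1_def l)
      with gears_trans[OF 2(1) 1(1)]
      have g: "gears K (graph_union K (walk_graph (x # l @ [z]))) (n1 + n2) (p1 + p2)" by simp
      have "set l - verts K \<subseteq> (set (l1 @ t # l3) - verts K) \<union> (set l2 - verts K1)"
        using less.prems by (auto simp: l K1_def)
      then have "card (set l - verts K) \<le> card ((set (l1 @ t # l3) - verts K) \<union> (set l2 - verts K1))"
        by (intro card_mono) auto
      also have "\<dots> \<le> card (set (l1 @ t # l3) - verts K) + card (set l2 - verts K1)"
        by (rule card_Un_le)
      finally have "card (set l - verts K) \<le> \<dots>" .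
      moreover have "length l = length (l1 @ t # l3) + length l2 + 1" by (simp add: l)
      ultimately have "n1 + n2 + card (set l - verts K) \<le> 2 * ((length l + 1) div 2)"
        using 1(2) 2(2) even_floor_add[of "length (l1 @ t # l3) + 1" "length l2 + 1"] by (simp; linarith)
      with g show ?thesis by blast
    qed
  qed
qed

text \<open>A single edge between old vertices is an odd ear and therefore free.\<close>

lemma gears_add_edges:
  assumes "finite F" "\<forall>e \<in> F. card e = 2 \<and> e \<subseteq> verts K"
  shows "gears K (verts K, edges K \<union> F) 0 0"
  using assms
proof (induction)
  case empty
  then show ?case using gears.refl[of K] by simp
next
  case (insert e F)
  obtain x z where e: "e = {x, z}" "x \<noteq> z" using insert.prems by (meson card_2_iff insertI1)
  have "gears K (verts K, edges K \<union> F) 0 0" using insert by simp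
  then show ?case
    by (rule gears_stepI[where x = x and l = "[]" and z = z])
      (use e insert.prems in \<open>auto simp: new_ear_def intro!: graph_eqI\<close>)
qed

lemma gears_complete:
  assumes "verts K = verts H" "edges K \<subseteq> edges H" "simple_graph H"
  shows "gears K H 0 0"
proof -
  have "finite (edges H)"
    by (rule finite_subset[of _ "Pow (verts H)"]) (use assms(3) in \<open>auto simp: simple_graph_def\<close>)
  then have "gears K (verts K, edges K \<union> edges H) 0 0"
    using assms by (intro gears_add_edges) (auto simp: simple_graph_def)
  moreover have "(verts K, edges K \<union> edges H) = H"
    using assms by (auto intro!: graph_eqI)
  ultimately show ?thesis by simp
qed

lemma crossing_edge:
  assumes "(adj H)\<^sup>*\<^sup>* u v" "u \<in> S" "v \<notin> S"
  shows "\<exists>x y. adj H x y \<and> x \<in> S \<and> y \<notin> S"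
  using assms by (induction rule: rtranclp_induct) auto

text \<open>Vertices are hung on one at a time by pendant edges, and the missing edges are added at
  the end. The cost is irrelevant: only existence is needed, so that the \<open>LEAST\<close> in
  \<open>ear_phi_conn\<close> is attained.\<close>

lemma connected_gears_aux:
  assumes H: "simple_graph H" "connected_graph H"
    and K: "gears ({r}, {}) K n p" "verts K \<subseteq> verts H" "edges K \<subseteq> edges H"
  shows "\<exists>n p. gears ({r}, {}) H n p"
  using K
proof (induction "card (verts H - verts K)" arbitrary: K n p rule: less_induct)
  case less
  have r: "r \<in> verts K" using gears_mono[OF less.prems(1)] by simp
  show ?case
  proof (cases "verts K = verts H")
    case True
    then have "gears K H 0 0" by (rule gears_complete[OF _ less.prems(3) H(1)])
    from gears_trans[OF this less.prems(1)] show ?thesis by blast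
  next
    case False
    then obtain y0 where "y0 \<in> verts H" "y0 \<notin> verts K" using less.prems(2) by blast
    then obtain x y where xy: "adj H x y" "x \<in> verts K" "y \<notin> verts K"
      using crossing_edge[of H r y0 "verts K"] H(2) r less.prems(2)
      unfolding connected_graph_def by blast
    have e: "{x, y} \<in> edges H" "y \<in> verts H" "x \<noteq> y"
      using xy H(1) unfolding adj_def simple_graph_def by blast+
    let ?K = "graph_union K (walk_graph (x # [y] @ [x]))"
    have "gears ({r}, {}) ?K (n + 1) (p + 1)"
      by (rule gears_stepI[OF less.prems(1), where x = x and l = "[y]" and z = x]) (use xy in \<open>auto simp: new_ear_def\<close>)
    moreover have "card (verts H - verts ?K) < card (verts H - verts K)"
      by (rule psubset_card_mono) (use H(1) xy e in \<open>auto simp: simple_graph_def\<close>)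
    moreover have "verts ?K \<subseteq> verts H" "edges ?K \<subseteq> edges H"
      using less.prems xy e by (auto simp: insert_commute)
    ultimately show ?thesis using less.hyps by blast
  qed
qed

lemma connected_gears:
  assumes "simple_graph H" "connected_graph H" "r \<in> verts H"
  shows "\<exists>n p. gears ({r}, {}) H n p"
  using assms by (intro connected_gears_aux[OF assms(1,2) gears.refl]) auto

subsection \<open>Degrees of edge multisets\<close>

definition edge_deg :: "'v set multiset \<Rightarrow> 'v \<Rightarrow> nat" where
  "edge_deg M v = size {#e \<in># M. v \<in> e#}"

lemma edge_deg_empty [simp]: "edge_deg {#} v = 0"
  by (simp add: edge_deg_def)

lemma edge_deg_add_mset [simp]: "edge_deg (add_mset e M) v = of_bool (v \<in> e) + edge_deg M v"
  by (simp add: edge_deg_def)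

lemma edge_deg_plus [simp]: "edge_deg (M + N) v = edge_deg M v + edge_deg N v"
  by (simp add: edge_deg_def)

lemma edge_deg_diff: "N \<subseteq># M \<Longrightarrow> edge_deg (M - N) v + edge_deg N v = edge_deg M v"
  by (metis edge_deg_plus subset_mset.diff_add)

lemma edge_deg_mono: "N \<subseteq># M \<Longrightarrow> edge_deg N v \<le> edge_deg M v"
  using edge_deg_diff[of N M v] by simp

lemma edge_deg_remove: "e \<in># M \<Longrightarrow> edge_deg (M - {#e#}) v + of_bool (v \<in> e) = edge_deg M v"
  using edge_deg_diff[of "{#e#}" M v] by simp

lemma edge_deg_less_ex:
  assumes "edge_deg N v < edge_deg M v"
  shows "\<exists>e. v \<in> e \<and> count N e < count M e"
proof (rule ccontr)
  assume "\<not> ?thesis"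
  then have "{#e \<in># M. v \<in> e#} \<subseteq># {#e \<in># N. v \<in> e#}"
    by (intro mset_subset_eqI) (auto simp: not_less)
  then have "edge_deg M v \<le> edge_deg N v" unfolding edge_deg_def by (rule size_mset_mono)
  then show False using assms by simp
qed

lemma edge_deg_le_size: "edge_deg M v \<le> size M"
  unfolding edge_deg_def by (rule size_mset_mono) simp

lemma sum_edge_deg:
  fixes M :: "'v::finite set multiset"
  assumes "\<forall>e \<in># M. card e = 2"
  shows "sum (edge_deg M) UNIV = 2 * size M"
  using assms
proof (induction M)
  case (add e M)
  have "(\<Sum>v\<in>UNIV. of_bool (v \<in> e)) = card e"
    by (simp add: of_bool_def sum.If_cases)
  then show ?case using add by (simp add: sum.distrib)
qed simp

text \<open>
  The graph with \<open>a v\<close> copies of every vertex \<open>v\<close> is factor-critical. Its matchings are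
  represented by multisets of edges of the original graph with bounded degrees.
\<close>

definition critical :: "'v set set \<Rightarrow> ('v \<Rightarrow> nat) \<Rightarrow> bool" where
  "critical E a \<longleftrightarrow> (\<forall>w. a w > 0 \<longrightarrow>
     (\<exists>M. set_mset M \<subseteq> E \<and> (\<forall>u. edge_deg M u + of_bool (u = w) = a u)))"

lemma other_end:
  assumes "card e = 2" "v \<in> e"
  shows "\<exists>w. w \<noteq> v \<and> e = {v, w}"
  using assms by (auto simp: card_2_iff doubleton_eq_iff)

text \<open>The difference of \<open>M\<close> and \<open>N\<close> is followed from
  \<open>z\<close>, where \<open>M\<close> has one edge more, until \<open>S\<close> is reached;
  \<open>M'\<close> collects the edges of \<open>M\<close> on the way. For even
  \<open>length l\<close> the last edge belongs to \<open>M\<close>, so that \<open>M'\<close>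
  covers a copy of \<open>q\<close>; for odd \<open>length l\<close> it belongs to \<open>N\<close>,
  and this visit of \<open>q\<close> is not counted.\<close>

lemma alternating_walk:
  assumes E: "\<forall>e \<in> E. card e = 2" "set_mset N \<subseteq> E"
    and "set_mset M \<subseteq> E" "z \<notin> S" "\<forall>v. v \<notin> S \<longrightarrow> edge_deg M v = edge_deg N v + of_bool (v = z)"
  shows "\<exists>l q M'. q \<in> S \<and> wedges (z # l @ [q]) \<subseteq> E \<and> M' \<subseteq># M - N \<and>
    (\<forall>v. edge_deg M' v = count_list (if even (length l) then z # l @ [q] else z # l) v)"
  using assms(3-5)
proof (induction "size (M - N)" arbitrary: M z rule: less_induct)
  case less
  obtain e where e: "z \<in> e" "count N e < count M e"
    using edge_deg_less_ex[of N z M] less.prems by auto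
  have eM: "e \<in># M - N" "e \<in># M" using e(2) by (auto simp: in_diff_count intro: count_inI)
  have eE: "e \<in> E" using eM less.prems by auto
  obtain q where q: "q \<noteq> z" "e = {z, q}" using other_end[of e z] e E eE by blast
  show ?case
  proof (cases "q \<in> S")
    case True
    show ?thesis
      by (rule exI[of _ "[]"], rule exI[of _ q], rule exI[of _ "{#e#}"])
        (use True eE q eM in auto)
  next
    case qS: False
    define M1 where "M1 = M - {#e#}"
    have M: "M = add_mset e M1" using eM by (simp add: M1_def)
    have dq: "edge_deg M1 q < edge_deg N q" using less.prems(3) qS q M by auto
    obtain f where f: "q \<in> f" "count M1 f < count N f" using edge_deg_less_ex[OF dq] by blast
    have fE: "f \<in> E" using f E(2) count_inI[of N f] by force
    obtain y where y: "y \<noteq> q" "f = {q, y}" using other_end[of f q] f E fE by blast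
    show ?thesis
    proof (cases "y \<in> S")
      case True
      show ?thesis
        by (rule exI[of _ "[q]"], rule exI[of _ y], rule exI[of _ "{#e#}"])
          (use True eE fE q y eM in auto)
    next
      case False
      \<comment> \<open>Exchanging \<open>e\<close> for \<open>f\<close> moves the surplus from
        \<open>z\<close> to \<open>y\<close>, and the same situation recurs with a smaller
        difference \<open>M2 - N\<close>.\<close>
      define M2 where "M2 = add_mset f M1"
      have d: "M2 - N = (M - N) - {#e#}"
      proof (rule multiset_eqI)
        fix g
        show "count (M2 - N) g = count (M - N - {#e#}) g"
          using f(2) e(2) by (cases "e = g"; cases "f = g") (auto simp: M2_def M1_def)
      qed
      have "size (M2 - N) < size (M - N)" unfolding d using eM(1) by (rule size_Diff1_less)
      moreover have "set_mset M2 \<subseteq> E" using less.prems(1) fE M by (auto simp: M2_def)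
      moreover have "\<forall>v. v \<notin> S \<longrightarrow> edge_deg M2 v = edge_deg N v + of_bool (v = y)"
        using less.prems(3) q y unfolding M2_def M by fastforce
      ultimately obtain l q' M' where IH: "q' \<in> S" "wedges (y # l @ [q']) \<subseteq> E" "M' \<subseteq># M2 - N"
        "\<forall>v. edge_deg M' v = count_list (if even (length l) then y # l @ [q'] else y # l) v"
        using less.hyps[of M2 y] False by blast
      have "add_mset e M' \<subseteq># M - N"
        using IH(3) eM(1) unfolding d by (metis insert_DiffM mset_subset_eq_add_mset_cancel)
      moreover have "wedges (z # (q # y # l) @ [q']) \<subseteq> E"
        using IH(2) eE fE q y by auto
      moreover have "\<forall>v. edge_deg (add_mset e M') v =
          count_list (if even (length (q # y # l)) then z # (q # y # l) @ [q'] else z # (q # y # l)) v"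
        using IH(4) q by auto
      ultimately show ?thesis using IH(1) by blast
    qed
  qed
qed

lemma sum_count_list:
  fixes xs :: "'v::finite list"
  shows "sum (count_list xs) UNIV = length xs"
  by (rule sum_count_set) auto

text \<open>
  Lov\'asz' construction of odd ear decompositions, for the vertex duplication of \<open>H\<close> described by
  \<open>a\<close>: the copies \<open>b\<close> have been used up, and the remaining ones are perfectly matched by \<open>M\<close>.
\<close>

lemma critical_gears_aux:
  fixes H :: "'v::finite graph"
  assumes H: "simple_graph H" "connected_graph H" "critical (edges H) a" "\<forall>v. a v > 0 \<longleftrightarrow> v \<in> verts H"
    and "gears ({r}, {}) K n p" "verts K \<subseteq> verts H" "edges K \<subseteq> edges H"
      "set_mset M \<subseteq> edges H" "\<forall>v. b v + edge_deg M v = a v" "\<forall>v. b v > 0 \<longleftrightarrow> v \<in> verts K"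
      "n + card (verts K) \<le> sum b UNIV"
  shows "\<exists>n p. gears ({r}, {}) H n p \<and> n + card (verts H) \<le> sum a UNIV"
  using assms(5-)
proof (induction "card (verts H - verts K)" arbitrary: K n p b M rule: less_induct)
  case less
  have r: "r \<in> verts K" using gears_mono[OF less.prems(1)] by simp
  have E: "\<forall>e \<in> edges H. card e = 2" using H(1) by (simp add: simple_graph_def)
  show ?case
  proof (cases "verts K = verts H")
    case True
    have "sum b UNIV \<le> sum a UNIV" using less.prems(5) by (metis le_add1 sum_mono)
    then have "n + card (verts H) \<le> sum a UNIV" using less.prems(7) True by simp
    moreover have "gears K H 0 0" by (rule gears_complete[OF True less.prems(3) H(1)])
    from gears_trans[OF this less.prems(1)] have "gears ({r}, {}) H n p" by simp
    ultimately show ?thesis by blast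
  next
    case False
    then obtain y0 where "y0 \<in> verts H" "y0 \<notin> verts K" using less.prems(2) by blast
    then obtain x y where xy: "adj H x y" "x \<in> verts K" "y \<notin> verts K"
      using crossing_edge[of H r y0 "verts K"] H(2) r less.prems(2)
      unfolding connected_graph_def by blast
    have e: "{x, y} \<in> edges H" "y \<in> verts H"
      using xy H(1) unfolding adj_def simple_graph_def by blast+
    then have "a y > 0" using H(4) by blast
    from H(3)[unfolded critical_def, rule_format, OF this]
    obtain N where N: "set_mset N \<subseteq> edges H" "\<forall>u. edge_deg N u + of_bool (u = y) = a u" by blast
    \<comment> \<open>Outside \<open>K\<close> no copy has been used up, so there \<open>M\<close>
      covers all copies and \<open>N\<close> all but one copy of \<open>y\<close>. On
      \<open>K\<close> the two may differ arbitrarily, and this is where the walk stops.\<close>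
    have "\<forall>v. v \<notin> verts K \<longrightarrow> edge_deg M v = edge_deg N v + of_bool (v = y)"
    proof (intro allI impI)
      fix v assume "v \<notin> verts K"
      then have "b v = 0" using less.prems(6) by (metis not_gr_zero)
      then show "edge_deg M v = edge_deg N v + of_bool (v = y)" using less.prems(5) N(2) by (metis add_0)
    qed
    from alternating_walk[OF E N(1) less.prems(4) xy(3) this]
    obtain l q M' where w: "q \<in> verts K" "wedges (y # l @ [q]) \<subseteq> edges H" "M' \<subseteq># M - N"
      "\<forall>v. edge_deg M' v = count_list (if even (length l) then y # l @ [q] else y # l) v"
      by (elim exE conjE) (rule that)
    have M': "M' \<subseteq># M" using w(3) diff_subset_eq_self subset_mset.order_trans by blast
    have w2: "wedges (x # (y # l) @ [q]) \<subseteq> edges H" using w(2) e by simp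
    let ?K = "graph_union K (walk_graph (x # (y # l) @ [q]))"
    obtain n' p' where g: "gears K ?K n' p'"
      "n' + card (set (y # l) - verts K) \<le> 2 * ((length (y # l) + 1) div 2)"
      using gears_walk[OF xy(2) w(1), of "y # l"] w2 E by blast
    have walkH: "set (x # (y # l) @ [q]) \<subseteq> verts H"
    proof
      fix v assume "v \<in> set (x # (y # l) @ [q])"
      then have v: "v \<in> {x, q} \<or> v \<in> set (y # l)" by auto
      show "v \<in> verts H"
      proof (cases "v \<in> {x, q}")
        case False
        then obtain l1 l2 where "y # l = l1 @ v # l2" using v by (meson split_list)
        then obtain u l3 where "(y # l) @ [q] = l1 @ v # u # l3" by (cases l2) auto
        then have "{v, u} \<in> wedges ((y # l) @ [q])" using wedges_adjacent by metis
        then have "{v, u} \<in> edges H" using w(2) by auto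
        then show ?thesis using H(1) unfolding simple_graph_def by blast
      qed (use xy(2) w(1) less.prems(2) in auto)
    qed
    show ?thesis
    proof (rule less.hyps[where K = ?K and b = "\<lambda>v. b v + edge_deg M' v" and M = "M - M'"])
      show "card (verts H - verts ?K) < card (verts H - verts K)"
        by (rule psubset_card_mono) (use xy(3) e(2) in auto)
      show "gears ({r}, {}) ?K (n + n') (p + p')" by (rule gears_trans[OF g(1) less.prems(1)])
      show "verts ?K \<subseteq> verts H" using less.prems(2) walkH by simp
      show "edges ?K \<subseteq> edges H" using less.prems(3) w2 by simp
      show "set_mset (M - M') \<subseteq> edges H" using less.prems(4) by (meson in_diffD subset_iff)
      show "\<forall>v. b v + edge_deg M' v + edge_deg (M - M') v = a v"
        using edge_deg_diff[OF M'] less.prems(5) by (metis add.assoc add.commute)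
      show "\<forall>v. b v + edge_deg M' v > 0 \<longleftrightarrow> v \<in> verts ?K"
        using less.prems(6) w(1,4) xy(2) by (auto simp: count_list_0_iff)
      \<comment> \<open>The number of copies covered by \<open>M'\<close> is
        \<open>length (y # l)\<close> rounded up to an even number, which is exactly the budget of
        \<open>gears_walk\<close>.\<close>
      have "sum (edge_deg M') UNIV = length (if even (length l) then y # l @ [q] else y # l)"
        using w(4) sum_count_list by (metis (no_types, lifting) sum.cong)
      also have "\<dots> = 2 * ((length (y # l) + 1) div 2)"
        by (auto elim!: oddE)
      finally have 1: "n' + card (set (y # l) - verts K) \<le> sum (edge_deg M') UNIV" using g(2) by simp
      have "verts ?K = verts K \<union> (set (y # l) - verts K)" using xy(2) w(1) by auto
      then have "card (verts ?K) = card (verts K) + card (set (y # l) - verts K)"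
        by (metis Diff_disjoint card_Un_disjoint finite)
      then show "n + n' + card (verts ?K) \<le> (\<Sum>v\<in>UNIV. b v + edge_deg M' v)"
        using 1 less.prems(7) by (simp add: sum.distrib)
    qed
  qed
qed

lemma critical_gears:
  fixes H :: "'v::finite graph"
  assumes H: "simple_graph H" "connected_graph H" "critical (edges H) a" "\<forall>v. a v > 0 \<longleftrightarrow> v \<in> verts H"
    and r: "r \<in> verts H"
  shows "\<exists>n p. gears ({r}, {}) H n p \<and> n + card (verts H) \<le> sum a UNIV"
proof -
  have "a r > 0" using H(4) r by blast
  from H(3)[unfolded critical_def, rule_format, OF this]
  obtain M where M: "set_mset M \<subseteq> edges H" "\<forall>u. edge_deg M u + of_bool (u = r) = a u" by blast
  show ?thesis
    by (rule critical_gears_aux[OF H gears.refl _ _ M(1), where b = "\<lambda>v. of_bool (v = r)"])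
      (use r M(2) in \<open>auto simp: add.commute\<close>)
qed

subsection \<open>Constructing critical vertex duplications\<close>

lemma wedges_infix: "wedges l2 \<subseteq> wedges (l1 @ l2 @ l3)"
proof -
  have 1: "wedges l \<subseteq> wedges (k @ l)" for k l :: "'a list"
  proof (induction k)
    case (Cons a k)
    then show ?case by (cases "k @ l") auto
  qed simp
  have "wedges l2 \<subseteq> wedges (l2 @ l3)"
    using 1[of "rev l2" "rev l3"] by (simp flip: rev_append)
  also have "\<dots> \<subseteq> wedges (l1 @ l2 @ l3)" by (rule 1)
  finally show ?thesis .
qed

section \<open>Perfect matchings of duplications after deletion of some copies\<close>

definition perfect :: "'v set set \<Rightarrow> ('v \<Rightarrow> nat) \<Rightarrow> bool" where
  "perfect E c \<longleftrightarrow> (\<exists>M. set_mset M \<subseteq> E \<and> (\<forall>u. edge_deg M u = c u))"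

lemma perfect_cong: "perfect E c \<Longrightarrow> (\<And>u. c u = d u) \<Longrightarrow> perfect E d"
  by (simp add: perfect_def)

lemma perfect_plus: "perfect E c \<Longrightarrow> perfect E d \<Longrightarrow> perfect E (\<lambda>u. c u + d u)"
  unfolding perfect_def by (metis Un_subset_iff edge_deg_plus set_mset_union)

lemma perfect_walk:
  assumes "\<forall>e \<in> E. card e = 2" "wedges l \<subseteq> E" "even (length l)"
  shows "perfect E (count_list l)"
  using assms(2,3)
proof (induction "length l" arbitrary: l rule: less_induct)
  case less
  show ?case
  proof (cases l rule: wedges.cases)
    case 1
    then show ?thesis by (auto simp: perfect_def intro!: exI[of _ "{#}"])
  next
    case (2 a)
    then show ?thesis using less.prems by simp
  next
    case (3 a b l')
    have "wedges l' \<subseteq> wedges (b # l')" by (cases l') auto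
    then have "perfect E (count_list l')" using less 3 by auto
    moreover have e: "{a, b} \<in> E" using less.prems 3 by auto
    then have "a \<noteq> b" using assms(1) by force
    with e have "perfect E (\<lambda>u. of_bool (u = a) + of_bool (u = b))"
      unfolding perfect_def by (intro exI[of _ "{#{a, b}#}"]) auto
    ultimately have "perfect E (\<lambda>u. (of_bool (u = a) + of_bool (u = b)) + count_list l' u)"
      by (intro perfect_plus[of E "\<lambda>u. of_bool (u = a) + of_bool (u = b)"])
    then show ?thesis by (rule perfect_cong) (auto simp: 3)
  qed
qed

lemma perfect_infix:
  assumes "\<forall>e \<in> E. card e = 2" "wedges w \<subseteq> E" "w = l1 @ l2 @ l3" "even (length l2)"
  shows "perfect E (count_list l2)"
  using perfect_walk[OF assms(1) _ assms(4)] wedges_infix[of l2 l1 l3] assms(2,3) by auto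

definition perfect_minus :: "'v set set \<Rightarrow> ('v \<Rightarrow> nat) \<Rightarrow> 'v list \<Rightarrow> bool" where
  "perfect_minus E a r \<longleftrightarrow> (\<exists>M. set_mset M \<subseteq> E \<and> (\<forall>u. edge_deg M u + count_list r u = a u))"

lemma perfect_minus_Nil: "perfect_minus E a [] \<longleftrightarrow> perfect E a"
  by (simp add: perfect_minus_def perfect_def)

lemma perfect_minusI:
  assumes "perfect_minus E a r" "perfect E c" "\<And>u. a u + c u + count_list s u = b u + count_list r u"
  shows "perfect_minus E b s"
proof -
  obtain M N where M: "set_mset M \<subseteq> E" "\<forall>u. edge_deg M u + count_list r u = a u"
    and N: "set_mset N \<subseteq> E" "\<forall>u. edge_deg N u = c u"
    using assms(1,2) unfolding perfect_def perfect_minus_def by blast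
  have "edge_deg (M + N) u + count_list s u = b u" for u
    using M(2)[rule_format, of u] N(2)[rule_format, of u] assms(3)[of u] by simp
  then show ?thesis
    unfolding perfect_minus_def using M(1) N(1) by (intro exI[of _ "M + N"]) auto
qed

lemma critical_alt: "critical E a \<longleftrightarrow> (\<forall>w. a w > 0 \<longrightarrow> perfect_minus E a [w])"
  by (simp add: critical_def perfect_minus_def of_bool_def eq_commute)

text \<open>An odd ear preserves factor-criticality: deleting an inner vertex \<open>w\<close>
  leaves an even and an odd arc, and the odd one is matched together with its end \<open>x\<close>
  or \<open>z\<close>, which an old matching can leave free. The list \<open>l\<close> may contain
  repeated or old vertices, of which further copies are then added; this is used to duplicate an end
  of an even ear.\<close>

lemma critical_walk:
  assumes E: "\<forall>e \<in> E. card e = 2" and a: "critical E a" "a x > 0" "a z > 0"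
    and w: "wedges (x # l @ [z]) \<subseteq> E" "even (length l)"
  shows "critical E (\<lambda>u. a u + count_list l u)"
  unfolding critical_alt
proof (intro allI impI)
  fix w assume pos: "0 < a w + count_list l w"
  note P = perfect_infix[OF E assms(5)]
  have a': "perfect_minus E a [v]" if "a v > 0" for v using a(1) that by (simp add: critical_alt)
  show "perfect_minus E (\<lambda>u. a u + count_list l u) [w]"
  proof (cases "a w > 0")
    case True
    show ?thesis
      by (rule perfect_minusI[OF a'[OF True] P[of "[x]" l "[z]"]]) (use assms(6) in auto)
  next
    case False
    then have "w \<in> set l" using pos by (metis count_notin not_gr_zero add_is_0)
    then obtain l1 l2 where l: "l = l1 @ w # l2" by (meson split_list)
    show ?thesis
    proof (cases "even (length l1)")
      case True
      have "perfect E (\<lambda>u. count_list l1 u + count_list (l2 @ [z]) u)"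
        by (intro perfect_plus P[of "[x]" l1 "w # l2 @ [z]"] P[of "x # l1 @ [w]" "l2 @ [z]" "[]"])
          (use True l assms(6) in auto)
      from perfect_minusI[OF a'[OF a(3)] this] show ?thesis by (auto simp: l)
    next
      case False
      have "perfect E (\<lambda>u. count_list (x # l1) u + count_list l2 u)"
        by (intro perfect_plus P[of "[]" "x # l1" "w # l2 @ [z]"] P[of "x # l1 @ [w]" l2 "[z]"])
          (use False l assms(6) in auto)
      from perfect_minusI[OF a'[OF a(2)] this] show ?thesis by (auto simp: l)
    qed
  qed
qed

lemma critical_single: "critical E (\<lambda>u. of_bool (u = r))"
  unfolding critical_def by (auto intro!: exI[of _ "{#}"])

section \<open>Two-colourings and the bipartite phase\<close>

definition bicolored :: "('v \<Rightarrow> bool) \<Rightarrow> 'v set \<Rightarrow> bool" where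
  "bicolored col e \<longleftrightarrow> (\<exists>u v. e = {u, v} \<and> col u \<noteq> col v)"

lemma bicolored_pair [simp]: "bicolored col {u, v} \<longleftrightarrow> col u \<noteq> col v"
  by (auto simp: bicolored_def doubleton_eq_iff)

lemma bicolored_walk:
  assumes "\<forall>e \<in> wedges (x # l @ [z]). bicolored col e"
  shows "col x = col z \<longleftrightarrow> odd (length l)"
  using assms by (induction l arbitrary: x) auto

lemma bicolored_infix:
  assumes "\<forall>e \<in> wedges w. bicolored col e" "w = l1 @ (x # l @ [z]) @ l3"
  shows "col x = col z \<longleftrightarrow> odd (length l)"
  using assms wedges_infix[of "x # l @ [z]" l1 l3] by (intro bicolored_walk) blast

text \<open>
  The bipartite analogue of \<open>critical\<close>, corresponding to the elementary bipartite graphs.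
\<close>

definition elementary :: "'v set set \<Rightarrow> ('v \<Rightarrow> bool) \<Rightarrow> ('v \<Rightarrow> nat) \<Rightarrow> bool" where
  "elementary E col a \<longleftrightarrow> perfect E a \<and>
     (\<forall>u v. a u > 0 \<longrightarrow> a v > 0 \<longrightarrow> col u \<noteq> col v \<longrightarrow> perfect_minus E a [u, v])"

text \<open>The arcs are matched as in \<open>critical_walk\<close>. Whenever they have to borrow
  \<open>x\<close> or \<open>z\<close>, the alternating colours of the walk ensure that the two
  vertices taken from the old part have different colours, so that the assumption on
  \<open>a\<close> applies to them.\<close>

lemma elementary_walk:
  assumes E: "\<forall>e \<in> E. card e = 2" and a: "elementary E col a" "a x > 0" "a z > 0"
    and w: "wedges (x # l @ [z]) \<subseteq> E" "even (length l)"
    and col: "\<forall>e \<in> wedges (x # l @ [z]). bicolored col e"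
  shows "elementary E col (\<lambda>u. a u + count_list l u)"
proof -
  let ?b = "\<lambda>u. a u + count_list l u"
  note P = perfect_infix[OF E assms(5)]
  note C = bicolored_infix[OF col]
  have a0: "perfect_minus E a []" using a(1) by (simp add: elementary_def perfect_minus_Nil)
  have a': "perfect_minus E a [u, v]" if "a u > 0" "a v > 0" "col u \<noteq> col v" for u v
    using a(1) that by (simp add: elementary_def)
  have sym: "perfect_minus E ?b [u, v]" if "perfect_minus E ?b [v, u]" for u v
  proof -
    have "count_list [v, u] = count_list [u, v]" by auto
    then show ?thesis using that by (simp only: perfect_minus_def)
  qed
  have old_new: "perfect_minus E ?b [u, v]" if u: "a u > 0" and v: "v \<in> set l" and c: "col u \<noteq> col v" for u v
  proof -
    obtain l1 l2 where l: "l = l1 @ v # l2" using v by (meson split_list)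
    show ?thesis
    proof (cases "even (length l1)")
      case True
      have "col v = col z" using C[of "x # l1" v l2 z "[]"] True assms(6) by (auto simp: l)
      then have z: "perfect_minus E a [u, z]" using a'[OF u a(3)] c by simp
      have "perfect E (\<lambda>u. count_list l1 u + count_list (l2 @ [z]) u)"
        by (intro perfect_plus P[of "[x]" l1 "v # l2 @ [z]"] P[of "x # l1 @ [v]" "l2 @ [z]" "[]"])
          (use True l assms(6) in auto)
      from perfect_minusI[OF z this] show ?thesis by (auto simp: l)
    next
      case False
      have "col x = col v" using C[of "[]" x l1 v "l2 @ [z]"] False by (auto simp: l)
      then have x: "perfect_minus E a [u, x]" using a'[OF u a(2)] c by simp
      have "perfect E (\<lambda>u. count_list (x # l1) u + count_list l2 u)"
        by (intro perfect_plus P[of "[]" "x # l1" "v # l2 @ [z]"] P[of "x # l1 @ [v]" l2 "[z]"])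
          (use False l assms(6) in auto)
      from perfect_minusI[OF x this] show ?thesis by (auto simp: l)
    qed
  qed
  have new_new: "perfect_minus E ?b [u, v]"
    if l: "l = l1 @ u # l2 @ v # l3" and c: "col u \<noteq> col v" for u v l1 l2 l3
  proof -
    have 2: "even (length l2)" using C[of "x # l1" u l2 v "l3 @ [z]"] c by (auto simp: l)
    show ?thesis
    proof (cases "even (length l1)")
      case True
      have "perfect E (\<lambda>u. count_list l1 u + count_list l2 u + count_list l3 u)"
        by (intro perfect_plus P[of "[x]" l1 "u # l2 @ v # l3 @ [z]"]
            P[of "x # l1 @ [u]" l2 "v # l3 @ [z]"] P[of "x # l1 @ u # l2 @ [v]" l3 "[z]"])
          (use True 2 l assms(6) in auto)
      from perfect_minusI[OF a0 this] show ?thesis by (auto simp: l)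
    next
      case False
      have "col x \<noteq> col z" using C[of "[]" x l z "[]"] assms(6) by auto
      note xz = a'[OF a(2,3) this]
      have "perfect E (\<lambda>u. count_list (x # l1) u + count_list l2 u + count_list (l3 @ [z]) u)"
        by (intro perfect_plus P[of "[]" "x # l1" "u # l2 @ v # l3 @ [z]"]
            P[of "x # l1 @ [u]" l2 "v # l3 @ [z]"] P[of "x # l1 @ u # l2 @ [v]" "l3 @ [z]" "[]"])
          (use False 2 l assms(6) in auto)
      from perfect_minusI[OF xz this] show ?thesis by (auto simp: l)
    qed
  qed
  have l: "perfect E (count_list l)" by (rule P[of "[x]" l "[z]"]) (use assms(6) in auto)
  have "perfect E ?b" using a0 l by (auto simp: perfect_minus_Nil intro: perfect_plus)
  moreover have "perfect_minus E ?b [u, v]" if pos: "?b u > 0" "?b v > 0" and c: "col u \<noteq> col v" for u v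
  proof -
    have uv: "a u > 0 \<or> u \<in> set l" "a v > 0 \<or> v \<in> set l"
      using pos by (metis count_notin not_gr_zero add_is_0)+
    consider (1) "a u > 0" "a v > 0" | (2) "a u > 0" "v \<in> set l" | (3) "u \<in> set l" "a v > 0"
      | (4) "u \<in> set l" "v \<in> set l"
      using uv by (elim disjE) simp_all
    then show ?thesis
    proof cases
      case 1
      from perfect_minusI[OF a'[OF 1 c] l] show ?thesis by simp
    next
      case 2
      then show ?thesis using old_new c by blast
    next
      case 3
      then show ?thesis using old_new c sym by metis
    next
      case 4
      then obtain l1 l2 where 1: "l = l1 @ u # l2" by (meson split_list)
      have "u \<noteq> v" using c by blast
      then consider "v \<in> set l1" | "v \<in> set l2" using 1 4 by auto
      then show ?thesis
      proof cases
        case 1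
        then obtain k1 k2 where "l1 = k1 @ v # k2" by (meson split_list)
        then show ?thesis using new_new[of k1 v k2 u l2] \<open>l = l1 @ u # l2\<close> c sym by auto
      next
        case 2
        then obtain k1 k2 where "l2 = k1 @ v # k2" by (meson split_list)
        then show ?thesis using new_new[of l1 u k1 v k2] 1 c by auto
      qed
    qed
  qed
  ultimately show ?thesis by (simp add: elementary_def)
qed

lemma elementary_edge:
  assumes "{x, y} \<in> E" "col x \<noteq> col y"
  shows "elementary E col (\<lambda>u. of_bool (u = x) + of_bool (u = y))"
proof -
  have xy: "x \<noteq> y" using assms(2) by blast
  have "perfect E (\<lambda>u. of_bool (u = x) + of_bool (u = y))"
    unfolding perfect_def by (rule exI[of _ "{#{x, y}#}"]) (use assms xy in auto)
  moreover have "perfect_minus E (\<lambda>u. of_bool (u = x) + of_bool (u = y)) [u, v]"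
    if "u \<noteq> v" "u \<in> {x, y}" "v \<in> {x, y}" for u v
    unfolding perfect_minus_def by (rule exI[of _ "{#}"]) (use that in auto)
  moreover have "w \<in> {x, y}" if "of_bool (w = x) + of_bool (w = y) > (0::nat)" for w
    using that by (auto simp: of_bool_def split: if_splits)
  ultimately show ?thesis
    unfolding elementary_def by metis
qed

text \<open>The walk has an odd number of edges between ends of equal colour, so it closes an odd
  cycle. A perfectly matched duplication has an even number of copies and a critical one an odd
  number; the additional copy of \<open>x\<close> corrects this. It is matched either with its
  neighbour \<open>y\<close> or into the walk.\<close>

lemma elementary_critical:
  assumes E: "\<forall>e \<in> E. card e = 2" and a: "elementary E col a" "a x > 0" "a z > 0" "col x = col z"
    and w: "wedges (x # l @ [z]) \<subseteq> E" "even (length l)"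
    and y: "{x, y} \<in> E" "a y > 0" "col y \<noteq> col x"
  shows "critical E (\<lambda>u. a u + of_bool (u = x) + count_list l u)"
  unfolding critical_alt
proof (intro allI impI)
  let ?b = "\<lambda>u. a u + of_bool (u = x) + count_list l u"
  fix w assume pos: "?b w > 0"
  note P = perfect_infix[OF E assms(6)]
  have a0: "perfect_minus E a []" using a(1) by (simp add: elementary_def perfect_minus_Nil)
  have a': "perfect_minus E a [u, v]" if "a u > 0" "a v > 0" "col u \<noteq> col v" for u v
    using a(1) that by (simp add: elementary_def)
  have xy: "perfect E (\<lambda>u. of_bool (u = x) + of_bool (u = y))"
    using elementary_edge[OF y(1), of col] y(3) by (auto simp: elementary_def)
  show "perfect_minus E ?b [w]"
  proof (cases "a w > 0")
    case True
    show ?thesis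
    proof (cases "col w = col x")
      case True
      have p: "perfect E (\<lambda>u. (of_bool (u = x) + of_bool (u = y)) + count_list l u)"
        by (intro perfect_plus[OF xy] P[of "[x]" l "[z]"]) (use assms(7) in auto)
      have "perfect_minus E a [w, y]"
        using a'[OF \<open>a w > 0\<close> y(2)] True y(3) by simp
      from perfect_minusI[OF this p] show ?thesis by auto
    next
      case False
      have p: "perfect E (count_list (x # l @ [z]))"
        by (rule P[of "[]" _ "[]"]) (use assms(7) in auto)
      have "perfect_minus E a [w, z]"
        using a'[OF \<open>a w > 0\<close> a(3)] False a(4) by simp
      from perfect_minusI[OF this p] show ?thesis by auto
    qed
  next
    case False
    then have "w \<in> set l" using pos a(2) by (metis count_notin not_gr_zero add_is_0 of_bool_eq(1))
    then obtain l1 l2 where l: "l = l1 @ w # l2" by (meson split_list)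
    show ?thesis
    proof (cases "even (length l1)")
      case True
      have p: "perfect E (\<lambda>u. (of_bool (u = x) + of_bool (u = y)) + (count_list l1 u + count_list (l2 @ [z]) u))"
        by (intro perfect_plus[OF xy] perfect_plus P[of "[x]" l1 "w # l2 @ [z]"]
            P[of "x # l1 @ [w]" "l2 @ [z]" "[]"])
          (use True l assms(7) in auto)
      have "perfect_minus E a [y, z]" using a'[OF y(2) a(3)] y(3) a(4) by simp
      from perfect_minusI[OF this p] show ?thesis by (auto simp: l)
    next
      case False
      have "perfect E (\<lambda>u. count_list (x # l1) u + count_list l2 u)"
        by (intro perfect_plus P[of "[]" "x # l1" "w # l2 @ [z]"] P[of "x # l1 @ [w]" l2 "[z]"])
          (use False l assms(7) in auto)
      from perfect_minusI[OF a0 this] show ?thesis by (auto simp: l)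
    qed
  qed
qed

subsection \<open>From generalized ear decompositions to critical duplications\<close>

text \<open>The invariant of the construction. As long as \<open>K\<close> is bipartite, the
  \<open>+ 1\<close> keeps one copy in reserve, which later pays for the additional copy of
  \<open>x\<close> in \<open>elementary_critical\<close>. A neighbour inside \<open>K\<close> is
  required so that a walk can be continued through a further copy of its end.\<close>

definition dup_state :: "'v::finite set set \<Rightarrow> 'v graph \<Rightarrow> nat \<Rightarrow> bool" where
  "dup_state E K n \<longleftrightarrow> (\<forall>v \<in> verts K. \<exists>u \<in> verts K. {v, u} \<in> edges K) \<and>
    ((\<exists>a. critical E a \<and> (\<forall>v. a v > 0 \<longleftrightarrow> v \<in> verts K) \<and> sum a UNIV \<le> card (verts K) + n) \<or>
     (\<exists>a col. elementary E col a \<and> (\<forall>v. a v > 0 \<longleftrightarrow> v \<in> verts K) \<and>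
       (\<forall>e \<in> edges K. bicolored col e) \<and> sum a UNIV + 1 \<le> card (verts K) + n))"

lemma elementary_cong:
  assumes "elementary E col a" "\<And>v. a v > 0 \<Longrightarrow> col v = col' v"
  shows "elementary E col' a"
  using assms unfolding elementary_def by metis

lemma alternating_coloring:
  assumes "distinct l" "set l \<inter> V = {}" "x \<in> V"
  shows "\<exists>col'. (\<forall>v \<in> V. col' v = col v) \<and> (\<forall>e \<in> wedges (x # l). bicolored col' e)"
  using assms
proof (induction l rule: rev_induct)
  case (snoc y l)
  then obtain col' where c: "\<forall>v \<in> V. col' v = col v" "\<forall>e \<in> wedges (x # l). bicolored col' e" by auto
  define t where "t = last (x # l)"
  define c' where "c' = col'(y := \<not> col' t)"
  have y: "y \<notin> set (x # l)" using snoc.prems by auto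
  have e: "bicolored c' e" if e: "e \<in> wedges (x # l)" for e
  proof -
    obtain l1 u v l2 where "x # l = l1 @ u # v # l2" "e = {u, v}" using wedges_split[OF e] by blast
    moreover from this have "u \<noteq> y" "v \<noteq> y" using y by auto
    ultimately show ?thesis using c(2) e by (auto simp: c'_def)
  qed
  have xl: "x # l = butlast (x # l) @ [t]" by (simp add: t_def)
  then have "x # l @ [y] = butlast (x # l) @ [t, y]" by (metis append.assoc append_Cons append_Nil)
  then have "wedges (x # l @ [y]) = insert {t, y} (wedges (x # l))"
    using wedges_snoc2[of "butlast (x # l)" t y] xl by metis
  moreover have "t \<noteq> y" using y unfolding t_def by (metis last_in_set list.discI)
  then have "bicolored c' {t, y}" by (simp add: c'_def)
  ultimately have "\<forall>e \<in> wedges (x # l @ [y]). bicolored c' e"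
    using e by auto
  moreover have "\<forall>v \<in> V. c' v = col v" using c(1) snoc.prems by (auto simp: c'_def)
  ultimately show ?case by blast
qed (auto intro!: exI[of _ col])

lemma elementary_neighbour:
  assumes "\<forall>v \<in> verts K. \<exists>u \<in> verts K. {v, u} \<in> edges K" "\<forall>v. a v > 0 \<longleftrightarrow> v \<in> verts K"
    "\<forall>e \<in> edges K. bicolored col e" "edges K \<subseteq> E" "v \<in> verts K"
  shows "\<exists>u. {v, u} \<in> E \<and> a u > 0 \<and> col u \<noteq> col v"
  using assms by (metis bicolored_pair subset_iff)

text \<open>For odd \<open>length l\<close> the walk is continued through a further copy of
  \<open>z\<close> to a neighbour of \<open>z\<close>, so that \<open>l @ [z]\<close> has even
  length; the cost 1 of the step pays for this copy. A pendant edge needs no separate treatment: its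
  new vertex and the further copy of \<open>x = z\<close> form such a list.\<close>

lemma dup_state_step:
  assumes E: "\<forall>e \<in> E. card e = 2" and K: "dup_state E K n" "edges K \<subseteq> E"
    and wf: "wf_graph K" and ear: "new_ear K x l z" and w: "wedges (x # l @ [z]) \<subseteq> E"
  shows "dup_state E (graph_union K (walk_graph (x # l @ [z]))) (n + of_bool (odd (length l)))"
proof -
  let ?K = "graph_union K (walk_graph (x # l @ [z]))"
  have ear': "x \<in> verts K" "z \<in> verts K" "distinct l" "set l \<inter> verts K = {}"
    using ear by (auto simp: new_ear_def)
  have nb: "\<forall>v \<in> verts K. \<exists>u \<in> verts K. {v, u} \<in> edges K" using K(1) by (simp add: dup_state_def)
  have nb': "\<exists>u \<in> verts ?K. {v, u} \<in> edges ?K" if v: "v \<in> verts ?K" for v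
  proof (cases "v \<in> verts K")
    case True
    then show ?thesis using nb by auto
  next
    case False
    then have "v \<in> set l" using v ear' by auto
    then obtain l1 l2 where l: "l = l1 @ v # l2" by (meson split_list)
    define u where "u = last (x # l1)"
    have "x # l @ [z] = butlast (x # l1) @ u # v # (l2 @ [z])"
      unfolding u_def l by (metis append_Cons append.assoc append_Nil append_butlast_last_id list.discI)
    then have "{u, v} \<in> wedges (x # l @ [z])" using wedges_adjacent by metis
    moreover have "u \<in> verts ?K" unfolding u_def l using ear' by (auto split: if_splits)
    ultimately show ?thesis by (intro bexI[of _ u]) (auto simp: insert_commute)
  qed
  have vK: "verts ?K = verts K \<union> set l" using ear' by auto
  have cK: "card (verts ?K) = card (verts K) + length l"
    unfolding vK using ear' by (subst card_Un_disjoint) (auto simp: distinct_card)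
  consider (crit) a where "critical E a" "\<forall>v. a v > 0 \<longleftrightarrow> v \<in> verts K" "sum a UNIV \<le> card (verts K) + n"
    | (elem) a col where "elementary E col a" "\<forall>v. a v > 0 \<longleftrightarrow> v \<in> verts K"
      "\<forall>e \<in> edges K. bicolored col e" "sum a UNIV + 1 \<le> card (verts K) + n"
    using K(1) unfolding dup_state_def by blast
  then show ?thesis
  proof cases
    case crit
    have pos: "a x > 0" "a z > 0" using crit(2) ear' by auto
    show ?thesis
    proof (cases "even (length l)")
      case True
      have "critical E (\<lambda>u. a u + count_list l u)"
        by (rule critical_walk[OF E crit(1) pos w True])
      moreover have "\<forall>v. a v + count_list l v > 0 \<longleftrightarrow> v \<in> verts ?K"
        using crit(2) unfolding vK by (metis Un_iff add_gr_0 count_list_0_iff not_gr_zero)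
      moreover have "(\<Sum>u\<in>UNIV. a u + count_list l u) \<le> card (verts ?K) + (n + of_bool (odd (length l)))"
        using crit(3) cK True by (simp add: sum.distrib sum_count_list)
      ultimately show ?thesis unfolding dup_state_def using nb' by blast
    next
      case False
      obtain y where y: "y \<in> verts K" "{z, y} \<in> edges K" using nb ear' by blast
      have "wedges (x # (l @ [z]) @ [y]) = insert {z, y} (wedges (x # l @ [z]))"
        using wedges_snoc2[of "x # l" z y] by simp
      then have "wedges (x # (l @ [z]) @ [y]) \<subseteq> E" using w y K(2) by auto
      moreover have "a y > 0" using y crit(2) by blast
      ultimately have "critical E (\<lambda>u. a u + count_list (l @ [z]) u)"
        using critical_walk[OF E crit(1) pos(1), of y "l @ [z]"] False by simp
      moreover have "\<forall>v. a v + count_list (l @ [z]) v > 0 \<longleftrightarrow> v \<in> verts ?K"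
        using crit(2) ear' unfolding vK by (auto simp: count_list_0_iff)
      moreover have "(\<Sum>u\<in>UNIV. a u + count_list (l @ [z]) u) \<le> card (verts ?K) + (n + of_bool (odd (length l)))"
        using crit(3) cK False sum_count_list[of "l @ [z]"]
        by (simp only: sum.distrib) simp
      ultimately show ?thesis unfolding dup_state_def using nb' by blast
    qed
  next
    case elem
    have pos: "a x > 0" "a z > 0" using elem(2) ear' by auto
    obtain yx where yx: "{x, yx} \<in> E" "a yx > 0" "col yx \<noteq> col x"
      using elementary_neighbour[OF nb elem(2,3) K(2) ear'(1)] by blast
    obtain yz where yz: "{z, yz} \<in> E" "a yz > 0" "col yz \<noteq> col z"
      using elementary_neighbour[OF nb elem(2,3) K(2) ear'(2)] by blast
    have wz: "wedges (x # (l @ [z]) @ [yz]) = insert {z, yz} (wedges (x # l @ [z]))"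
      using wedges_snoc2[of "x # l" z yz] by simp
    then have wzE: "wedges (x # (l @ [z]) @ [yz]) \<subseteq> E" using w yz by simp
    show ?thesis
    \<comment> \<open>In this case the colouring extends over the ear and the bipartite phase goes
      on; otherwise the ear closes an odd cycle and the duplication becomes critical.\<close>
    proof (cases "col x = col z \<longleftrightarrow> odd (length l)")
      case True
      obtain c where c: "\<forall>v \<in> verts K. c v = col v" "\<forall>e \<in> wedges (x # l). bicolored c e"
        using alternating_coloring[OF ear'(3,4,1)] by blast
      have el: "elementary E c a" using elementary_cong[OF elem(1), of c] c(1) elem(2) by metis
      have cxz: "c x = c z \<longleftrightarrow> odd (length l)" using True c(1) ear' by auto
      have walk: "\<forall>e \<in> wedges (x # l @ [z]). bicolored c e"
      proof (cases l rule: rev_cases)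
        case Nil
        then show ?thesis using cxz by auto
      next
        case (snoc k t)
        have "c x = c t \<longleftrightarrow> odd (length k)"
          by (rule bicolored_walk) (use c(2) snoc in auto)
        then have "c t \<noteq> c z" using cxz snoc by auto
        moreover have "wedges (x # l @ [z]) = insert {t, z} (wedges (x # l))"
          using wedges_snoc2[of "x # k" t z] snoc by simp
        ultimately show ?thesis using c(2) by auto
      qed
      have old: "\<forall>e \<in> edges ?K. bicolored c e"
      proof
        fix e assume e: "e \<in> edges ?K"
        show "bicolored c e"
        proof (cases "e \<in> edges K")
          case True
          then obtain u v where uv: "e = {u, v}" "col u \<noteq> col v"
            using elem(3) unfolding bicolored_def by blast
          moreover have "u \<in> verts K" "v \<in> verts K"
            using True uv(1) wf unfolding wf_graph_def by blast+
          ultimately show ?thesis using c(1) by auto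
        qed (use e walk in auto)
      qed
      show ?thesis
      proof (cases "even (length l)")
        case True
        have "elementary E c (\<lambda>u. a u + count_list l u)"
          by (rule elementary_walk[OF E el pos w True walk])
        moreover have "\<forall>v. a v + count_list l v > 0 \<longleftrightarrow> v \<in> verts ?K"
          using elem(2) unfolding vK by (metis Un_iff add_gr_0 count_list_0_iff not_gr_zero)
        moreover have "(\<Sum>u\<in>UNIV. a u + count_list l u) + 1 \<le> card (verts ?K) + (n + of_bool (odd (length l)))"
          using elem(4) cK True by (simp add: sum.distrib sum_count_list)
        ultimately show ?thesis unfolding dup_state_def using nb' old by blast
      next
        case False
        have "c yz \<noteq> c z" using yz c(1) elem(2) ear' by metis
        then have "\<forall>e \<in> wedges (x # (l @ [z]) @ [yz]). bicolored c e" using walk unfolding wz by auto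
        then have "elementary E c (\<lambda>u. a u + count_list (l @ [z]) u)"
          by (intro elementary_walk[OF E el pos(1) yz(2) wzE]) (use False in auto)
        moreover have "\<forall>v. a v + count_list (l @ [z]) v > 0 \<longleftrightarrow> v \<in> verts ?K"
          using elem(2) ear' unfolding vK by (auto simp: count_list_0_iff)
        moreover have "(\<Sum>u\<in>UNIV. a u + count_list (l @ [z]) u) + 1 \<le> card (verts ?K) + (n + of_bool (odd (length l)))"
          using elem(4) cK False sum_count_list[of "l @ [z]"]
          by (simp only: sum.distrib) simp
        ultimately show ?thesis unfolding dup_state_def using nb' old by blast
      qed
    next
      case bad: False
      have sx: "(\<Sum>u\<in>UNIV. of_bool (u = x)) = (1::nat)" by (simp add: of_bool_def)
      show ?thesis
      proof (cases "even (length l)")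
        case True
        then have "col x = col z" using bad by auto
        then have "critical E (\<lambda>u. a u + of_bool (u = x) + count_list l u)"
          by (rule elementary_critical[OF E elem(1) pos _ w True yx])
        moreover have "\<forall>v. a v + of_bool (v = x) + count_list l v > 0 \<longleftrightarrow> v \<in> verts ?K"
          using elem(2) ear' unfolding vK by (auto simp: count_list_0_iff)
        moreover have "(\<Sum>u\<in>UNIV. a u + of_bool (u = x) + count_list l u)
            \<le> card (verts ?K) + (n + of_bool (odd (length l)))"
          using elem(4) cK True sx by (simp only: sum.distrib sum_count_list)
        ultimately show ?thesis unfolding dup_state_def using nb' by blast
      next
        case False
        then have "col x = col yz" using bad yz(3) by auto
        then have "critical E (\<lambda>u. a u + of_bool (u = x) + count_list (l @ [z]) u)"
          by (rule elementary_critical[OF E elem(1) pos(1) yz(2) _ wzE _ yx]) (use False in simp)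
        moreover have "\<forall>v. a v + of_bool (v = x) + count_list (l @ [z]) v > 0 \<longleftrightarrow> v \<in> verts ?K"
          using elem(2) ear' unfolding vK by (auto simp: count_list_0_iff)
        moreover have "(\<Sum>u\<in>UNIV. a u + of_bool (u = x) + count_list (l @ [z]) u)
            \<le> card (verts ?K) + (n + of_bool (odd (length l)))"
          using elem(4) cK False sx sum_count_list[of "l @ [z]"]
          by (simp only: sum.distrib) simp
        ultimately show ?thesis unfolding dup_state_def using nb' by blast
      qed
    qed
  qed
qed

lemma dup_state_start:
  assumes E: "\<forall>e \<in> E. card e = 2"
    and ear: "new_ear ({r}, {}) x l z" and w: "wedges (x # l @ [z]) \<subseteq> E"
  shows "dup_state E (graph_union ({r}, {}) (walk_graph (x # l @ [z]))) (of_bool (odd (length l)))"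
proof -
  let ?K = "graph_union ({r}, {}) (walk_graph (x # l @ [z]))"
  have xz: "x = r" "z = r" and l: "distinct l" "r \<notin> set l" "l \<noteq> []"
    using ear by (auto simp: new_ear_def)
  have nb: "\<exists>u \<in> verts ?K. {v, u} \<in> edges ?K" if v: "v \<in> verts ?K" for v
  proof -
    have "v \<in> set (x # l)" using v xz by auto
    then obtain l1 l2 where "x # l = l1 @ v # l2" by (meson split_list)
    then have "x # l @ [z] = l1 @ v # (l2 @ [z])" by (metis append_Cons append.assoc append_Nil)
    then obtain u l3 where u: "x # l @ [z] = l1 @ v # u # l3" by (cases "l2 @ [z]") auto
    then have "{v, u} \<in> wedges (x # l @ [z])" using wedges_adjacent by metis
    moreover have "u \<in> set (x # l @ [z])" unfolding u by simp
    ultimately show ?thesis by (intro bexI[of _ u]) auto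
  qed
  have vK: "verts ?K = insert r (set l)" using xz by auto
  have cK: "card (verts ?K) = length l + 1"
    unfolding vK using l by (simp add: distinct_card)
  show ?thesis
  proof (cases "even (length l)")
    case True
    have "critical E (\<lambda>u. of_bool (u = r) + count_list l u)"
      by (rule critical_walk[OF E critical_single _ _ w True]) (use xz in auto)
    moreover have "\<forall>v. of_bool (v = r) + count_list l v > 0 \<longleftrightarrow> v \<in> verts ?K"
      unfolding vK by (auto simp: count_list_0_iff)
    moreover have "(\<Sum>u\<in>UNIV. of_bool (u = r) + count_list l u) \<le> card (verts ?K) + of_bool (odd (length l))"
      using cK by (simp add: sum.distrib sum_count_list of_bool_def)
    ultimately show ?thesis unfolding dup_state_def using nb by blast
  next
    case False
    obtain y l' where y: "l = y # l'" using l(3) by (cases l) auto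
    obtain c where c: "\<forall>e \<in> wedges (r # l). bicolored c e"
      using alternating_coloring[of l "{r}" r] l by auto
    obtain k t where t: "l = k @ [t]" using l(3) by (cases l rule: rev_cases) auto
    have "c r = c t \<longleftrightarrow> odd (length k)"
      by (rule bicolored_walk) (use c t in auto)
    then have "c t \<noteq> c r" using False t by auto
    moreover have "wedges (r # l @ [r]) = insert {t, r} (wedges (r # l))"
      using wedges_snoc2[of "r # k" t r] t by simp
    ultimately have walk: "\<forall>e \<in> wedges (r # l @ [r]). bicolored c e" using c by auto
    have w': "wedges (r # l @ [r]) = insert {r, y} (wedges (y # l' @ [r]))" by (simp add: y)
    have "elementary E c (\<lambda>u. of_bool (u = r) + of_bool (u = y))"
      by (rule elementary_edge) (use w walk w' xz in auto)
    then have "elementary E c (\<lambda>u. of_bool (u = r) + of_bool (u = y) + count_list l' u)"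
      by (rule elementary_walk[OF E, of _ _ y r]) (use w walk w' xz False y in auto)
    moreover have "\<forall>v. of_bool (v = r) + of_bool (v = y) + count_list l' v > 0 \<longleftrightarrow> v \<in> verts ?K"
      unfolding vK unfolding y by (auto simp: count_list_0_iff)
    moreover have "(\<Sum>u\<in>UNIV. of_bool (u = r) + of_bool (u = y) + count_list l' u) + 1
        \<le> card (verts ?K) + of_bool (odd (length l))"
      using cK y False by (simp add: sum.distrib sum_count_list of_bool_def)
    moreover have "\<forall>e \<in> edges ?K. bicolored c e" using walk xz by auto
    ultimately show ?thesis unfolding dup_state_def using nb by blast
  qed
qed

lemma gears_dup_state:
  assumes "gears ({r}, {}) H n p" "\<forall>e \<in> E. card e = 2" "edges H \<subseteq> E"
  shows "H = ({r}, {}) \<and> n = 0 \<or> dup_state E H n"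
  using assms(1,3)
proof (induction)
  case (step H n p x l z)
  have H: "edges H \<subseteq> E" "wedges (x # l @ [z]) \<subseteq> E" using step.prems by auto
  have "wf_graph H" using gears_wf[OF step.hyps(1)] by (simp add: wf_graph_def)
  then show ?case
    using step.IH[OF H(1)] dup_state_step[OF assms(2) _ H(1) _ step.hyps(2) H(2)]
      dup_state_start[OF assms(2) _ H(2)] step.hyps(2) by fastforce
qed simp

lemma odd_cycle_not_bicolored:
  assumes "has_odd_cycle H" "\<forall>e \<in> edges H. bicolored col e"
  shows False
proof -
  obtain p where p: "is_cycle p" "odd (num_edges p)" "wedges p \<subseteq> edges H"
    using assms(1) by (auto simp: has_odd_cycle_def)
  then have len: "length p \<ge> 4" by (auto simp: is_cycle_def num_edges_def)
  then obtain x q where q: "p = x # q" by (cases p) auto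
  moreover have "q \<noteq> []" using len q by auto
  ultimately obtain l z where l: "q = l @ [z]" by (cases q rule: rev_cases) auto
  have "x = z" using p(1) q l by (auto simp: is_cycle_def)
  moreover have "col x = col z \<longleftrightarrow> odd (length l)"
    by (rule bicolored_walk) (use p(3) q l assms(2) in auto)
  ultimately show False using p(2) q l by (auto simp: num_edges_def)
qed

lemma gears_critical:
  fixes H :: "'v::finite graph"
  assumes "gears ({r}, {}) H n p" "simple_graph H" "has_odd_cycle H"
  shows "\<exists>a. critical (edges H) a \<and> (\<forall>v. a v > 0 \<longleftrightarrow> v \<in> verts H) \<and> sum a UNIV \<le> card (verts H) + n"
proof -
  have "H = ({r}, {}) \<and> n = 0 \<or> dup_state (edges H) H n"
    using gears_dup_state[OF assms(1)] assms(2) by (simp add: simple_graph_def)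
  moreover have "H \<noteq> ({r}, {})"
    using odd_cycle_not_bicolored[OF assms(3)] by auto
  ultimately show ?thesis
    using odd_cycle_not_bicolored[OF assms(3)] unfolding dup_state_def by blast
qed

section \<open>Ear sequences obtained from generalized ear decompositions\<close>

lemma is_ear_new_ear:
  assumes "is_ear H q"
  obtains x l z where "q = x # l @ [z]" "new_ear H x l z"
    "of_bool (odd (length l)) = (of_bool (even (num_edges q)) :: nat)"
proof -
  have len: "length q \<ge> 2" using assms by (auto simp: is_ear_def is_path_def is_cycle_def num_edges_def)
  then obtain x q' where q: "q = x # q'" by (cases q) auto
  moreover have "q' \<noteq> []" using len q by auto
  ultimately obtain l z where l: "q' = l @ [z]" by (cases q' rule: rev_cases) auto
  have "new_ear H x l z"
    using assms q l by (auto simp: is_ear_def is_path_def is_cycle_def num_edges_def new_ear_def)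
  moreover have "of_bool (odd (length l)) = (of_bool (even (num_edges q)) :: nat)"
    using q l by (auto simp: num_edges_def)
  ultimately show thesis using that q l by simp
qed

lemma gears_ear:
  assumes "gears A H n p" "is_ear H q"
  shows "\<exists>p. gears A (graph_union H (walk_graph q)) (n + of_bool (even (num_edges q))) p"
  using assms gears.step by (metis is_ear_new_ear)

lemma gears_add_pendant:
  assumes "gears A H n p" "a \<in> verts H" "b \<notin> verts H"
  shows "gears A (graph_union H (walk_graph [a, b])) (n + 1) (p + 1)"
  by (rule gears_stepI[OF assms(1), where x = a and l = "[b]" and z = a])
    (use assms in \<open>auto simp: new_ear_def insert_commute intro!: graph_eqI\<close>)

lemma is_bridge_distinct: "is_bridge H {a, b} \<Longrightarrow> a \<noteq> b"
  by (auto simp: is_bridge_def)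

lemma gen_prefix_snocD:
  assumes "gen_prefix H (Fs @ [q])" "Fs \<noteq> []"
  shows "gen_prefix H Fs \<and> (is_ear (walks_union Fs) q \<or>
    is_bridge_walk H q \<and> card (set q \<inter> verts (walks_union Fs)) = 1)"
proof -
  have *: "is_ear (walks_union (take i (Fs @ [q]))) ((Fs @ [q]) ! i) \<or>
      is_bridge_walk H ((Fs @ [q]) ! i) \<and> card (set ((Fs @ [q]) ! i) \<inter> verts (walks_union (take i (Fs @ [q])))) = 1"
    if "1 \<le> i" "i < length (Fs @ [q])" for i
    using assms(1) that unfolding gen_prefix_def by blast
  have 0: "is_cycle (Fs ! 0) \<or> is_bridge_walk H (Fs ! 0)"
    using assms by (auto simp: gen_prefix_def nth_append)
  have "is_ear (walks_union (take i Fs)) (Fs ! i) \<or>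
      is_bridge_walk H (Fs ! i) \<and> card (set (Fs ! i) \<inter> verts (walks_union (take i Fs))) = 1"
    if "1 \<le> i" "i < length Fs" for i
    using *[of i] that by (simp add: nth_append)
  moreover have "is_ear (walks_union Fs) q \<or>
    is_bridge_walk H q \<and> card (set q \<inter> verts (walks_union Fs)) = 1"
    using *[of "length Fs"] assms(2) by (cases Fs) auto
  ultimately show ?thesis using 0 assms(2) by (simp add: gen_prefix_def)
qed

text \<open>The set \<open>B\<close> consists of the bridges that occur as steps. Such a step leads
  to a new vertex, so its edge is new; hence no bridge is counted twice and \<open>card B\<close> is
  the cost of these steps.\<close>

lemma gen_prefix_gears:
  assumes "gen_prefix H Fs"
  shows "\<exists>r p B. gears ({r}, {}) (walks_union Fs) (num_even_ears Fs + card B) p \<and> finite B \<and>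
    B \<subseteq> edges (walks_union Fs) \<inter> {e. is_bridge H e}"
  using assms
proof (induction Fs rule: rev_induct)
  case Nil
  then show ?case by (simp add: gen_prefix_def)
next
  case (snoc q Fs)
  show ?case
  proof (cases "Fs = []")
    case True
    have n: "num_even_ears [q] = of_bool (even (num_edges q))"
      using num_even_ears_snoc[of "[]" q] by (simp add: num_even_ears_def)
    have q: "is_cycle q \<or> is_bridge_walk H q" using snoc.prems True by (simp add: gen_prefix_single)
    have u: "walks_union [q] = graph_union ({r}, {}) (walk_graph q)" if "r \<in> set q" for r
      using that by (auto simp: walks_union_def intro!: graph_eqI)
    from q show ?thesis
    proof
      assume c: "is_cycle q"
      then have q0: "q \<noteq> []" by (auto simp: is_cycle_def num_edges_def)
      then have "is_ear ({hd q}, {}) q" using c by (auto simp: is_ear_def is_cycle_def)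
      from gears_ear[OF gears.refl this] obtain p where
        "gears ({hd q}, {}) (graph_union ({hd q}, {}) (walk_graph q)) (of_bool (even (num_edges q))) p" by auto
      then show ?thesis using True n u[of "hd q"] q0
        by (intro exI[of _ "hd q"] exI[of _ p] exI[of _ "{}"]) auto
    next
      assume b: "is_bridge_walk H q"
      then obtain x y where xy: "q = [x, y]" "is_bridge H {x, y}" by (auto simp: is_bridge_walk_def)
      from gears_add_pendant[OF gears.refl, of x "({x}, {})" y]
      have "gears ({x}, {}) (graph_union ({x}, {}) (walk_graph q)) 1 1"
        using is_bridge_distinct[OF xy(2)] xy(1) by simp
      then show ?thesis using True n u[of x] xy
        by (intro exI[of _ x] exI[of _ 1] exI[of _ "{{x, y}}"]) (auto simp: num_edges_def)
    qed
  next
    case False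
    note S = gen_prefix_snocD[OF snoc.prems False]
    let ?K = "walks_union Fs"
    obtain r p B where g: "gears ({r}, {}) ?K (num_even_ears Fs + card B) p" "finite B"
      "B \<subseteq> edges ?K \<inter> {e. is_bridge H e}" using snoc.IH S by blast
    have wf: "wf_graph ?K" using gears_wf[OF g(1)] by (simp add: wf_graph_def)
    from S consider "is_ear ?K q" | "is_bridge_walk H q" "card (set q \<inter> verts ?K) = 1" by blast
    then show ?thesis
    proof cases
      case 1
      from gears_ear[OF g(1) this] obtain p' where
        "gears ({r}, {}) (walks_union (Fs @ [q])) (num_even_ears (Fs @ [q]) + card B) p'"
        by (auto simp: walks_union_snoc num_even_ears_snoc ac_simps)
      moreover have "B \<subseteq> edges (walks_union (Fs @ [q])) \<inter> {e. is_bridge H e}"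
        using g(3) by (auto simp: walks_union_snoc)
      ultimately show ?thesis using g(2) by blast
    next
      case 2
      then obtain a b where ab: "q = [a, b]" "is_bridge H {a, b}" by (auto simp: is_bridge_walk_def)
      have ne: "a \<noteq> b" by (rule is_bridge_distinct[OF ab(2)])
      obtain v where v: "{a, b} \<inter> verts ?K = {v}" using 2(2) ab(1) by (metis card_1_singletonE list.set(1) list.simps(15))
      have "c \<in> verts ?K \<longleftrightarrow> c = v" if "c \<in> {a, b}" for c
        using v that by blast
      moreover have "v \<in> {a, b}" using v by blast
      ultimately obtain x y where xy: "{x, y} = {a, b}" "x \<in> verts ?K" "y \<notin> verts ?K"
        using ne by (metis insert_commute insertE insertI1 singletonD insertCI)
      have wq: "walk_graph [x, y] = walk_graph q" using ab(1) xy(1) by (auto simp: walk_graph_eq)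
      have new: "{a, b} \<notin> edges ?K" using wf xy unfolding wf_graph_def by blast
      then have "{a, b} \<notin> B" using g(3) by auto
      then have c: "card (insert {a, b} B) = card B + 1" using g(2) by simp
      have "num_even_ears (Fs @ [q]) = num_even_ears Fs"
        using ab(1) by (simp add: num_even_ears_snoc num_edges_def)
      moreover have "gears ({r}, {}) (walks_union (Fs @ [q])) (num_even_ears Fs + card B + 1) (p + 1)"
        using gears_add_pendant[OF g(1) xy(2,3)] unfolding walks_union_snoc wq .
      ultimately have "gears ({r}, {}) (walks_union (Fs @ [q]))
          (num_even_ears (Fs @ [q]) + card (insert {a, b} B)) (p + 1)"
        using c by simp
      moreover have "insert {a, b} B \<subseteq> edges (walks_union (Fs @ [q])) \<inter> {e. is_bridge H e}"
        using g(3) ab by (auto simp: walks_union_snoc)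
      ultimately show ?thesis using g(2) by (meson finite_insert)
    qed
  qed
qed

lemma gen_ear_decomp_critical:
  fixes H :: "'v::finite graph"
  assumes "simple_graph H" "has_odd_cycle H" "gen_ear_decomp H Fs"
  shows "\<exists>a. critical (edges H) a \<and> (\<forall>v. a v > 0 \<longleftrightarrow> v \<in> verts H) \<and>
    sum a UNIV \<le> card (verts H) + num_even_ears Fs + card {e. is_bridge H e}"
proof -
  obtain r p B where g: "gears ({r}, {}) H (num_even_ears Fs + card B) p" "finite B"
    "B \<subseteq> {e. is_bridge H e}"
    using gen_prefix_gears[of H Fs] assms(3) by (auto simp: gen_ear_decomp_prefix)
  have "card B \<le> card {e. is_bridge H e}" by (rule card_mono[OF _ g(3)]) simp
  then show ?thesis
    using gears_critical[OF g(1) assms(1,2)] by fastforce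
qed

section \<open>The least number of copies for a connected graph\<close>

lemma ear_phi_conn_le:
  "gen_ear_decomp H Fs \<Longrightarrow> edges H \<noteq> {} \<Longrightarrow> ear_phi_conn H \<le> num_even_ears Fs"
  by (auto simp: ear_phi_conn_def intro: Least_le)

lemma ear_phi_conn_attained:
  assumes "simple_graph H" "connected_graph H" "edges H \<noteq> {}"
  shows "\<exists>Fs. gen_ear_decomp H Fs \<and> num_even_ears Fs = ear_phi_conn H"
proof -
  obtain r where "r \<in> verts H" using assms(2) by (auto simp: connected_graph_def)
  then obtain n p where "gears ({r}, {}) H n p" using connected_gears[OF assms(1,2)] by blast
  from gears_gen_ear_decomp[OF this assms(3)]
  have "\<exists>n Fs. gen_ear_decomp H Fs \<and> num_even_ears Fs = n" by blast
  then have "\<exists>Fs. gen_ear_decomp H Fs \<and>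
      num_even_ears Fs = (LEAST n. \<exists>Fs. gen_ear_decomp H Fs \<and> num_even_ears Fs = n)"
    by (rule LeastI_ex)
  then show ?thesis using assms(3) by (simp add: ear_phi_conn_def)
qed

lemma critical_lower_bound:
  fixes H :: "'v::finite graph"
  assumes "simple_graph H" "connected_graph H" "edges H \<noteq> {}"
    and "critical (edges H) a" "\<forall>v. a v > 0 \<longleftrightarrow> v \<in> verts H"
  shows "card (verts H) + ear_phi_conn H + card {e. is_bridge H e} \<le> sum a UNIV"
proof -
  obtain r where "r \<in> verts H" using assms(2) by (auto simp: connected_graph_def)
  then obtain n p where g: "gears ({r}, {}) H n p" "n + card (verts H) \<le> sum a UNIV"
    using critical_gears[OF assms(1,2,4,5)] by blast
  obtain Fs where "gen_ear_decomp H Fs" "num_even_ears Fs + card {e. is_bridge H e} \<le> n"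
    using gears_gen_ear_decomp[OF g(1) assms(3)] by blast
  then show ?thesis using ear_phi_conn_le[of H Fs] assms(3) g(2) by linarith
qed

lemma critical_upper_bound:
  fixes H :: "'v::finite graph"
  assumes "simple_graph H" "connected_graph H" "has_odd_cycle H"
  shows "\<exists>a. critical (edges H) a \<and> (\<forall>v. a v > 0 \<longleftrightarrow> v \<in> verts H) \<and>
    sum a UNIV \<le> card (verts H) + ear_phi_conn H + card {e. is_bridge H e}"
proof -
  have "edges H \<noteq> {}" using odd_cycle_not_bicolored[OF assms(3)] by blast
  then show ?thesis
    using ear_phi_conn_attained[OF assms(1,2)] gen_ear_decomp_critical[OF assms(1,3)] by metis
qed

subsection \<open>Odd cycles\<close>

text \<open>Since the first vertex is listed again at the end, an even \<open>length p\<close> means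
  an odd number of edges. A repeated vertex splits the walk into two shorter closed walks, one of
  which is again odd.\<close>

lemma odd_closed_walk:
  assumes "\<forall>e \<in> edges H. e \<subseteq> verts H \<and> card e = 2" "wedges p \<subseteq> edges H" "hd p = last p" "even (length p)" "p \<noteq> []"
  shows "has_odd_cycle H"
  using assms(2-)
proof (induction "length p" arbitrary: p rule: less_induct)
  case less
  obtain x q where p: "p = x # q" using less.prems by (cases p) auto
  have q: "q \<noteq> []" using less.prems(3) p by auto
  have xq: "last q = x" using less.prems(2) p q by simp
  show ?case
  proof (cases "distinct q")
    case True
    have "length p \<noteq> 2"
    proof
      assume "length p = 2"
      then have "p = [x, x]" using p xq by (cases q rule: wedges.cases) auto
      then show False using less.prems(1) assms(1) by auto
    qed
    then have l: "length p \<ge> 4" using less.prems(3) p q by (cases q rule: wedges.cases; auto) presburger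
    have "set p \<subseteq> verts H"
    proof
      fix v assume v: "v \<in> set p"
      then have "v \<in> set q" using p xq q last_in_set by force
      then obtain l1 l2 where "q = l1 @ v # l2" by (meson split_list)
      then obtain u l3 where "p = l3 @ u # v # l2"
        unfolding p by (cases l1 rule: rev_cases) (metis append_Nil, metis append.assoc append_Cons append_Nil)
      then have "{u, v} \<in> wedges p" using wedges_adjacent by metis
      then have "{u, v} \<in> edges H" using less.prems(1) by blast
      then have "{u, v} \<subseteq> verts H" using assms(1) by blast
      then show "v \<in> verts H" by simp
    qed
    moreover have "is_cycle p" using l True less.prems(2) p by (auto simp: is_cycle_def num_edges_def)
    moreover have "odd (num_edges p)" using less.prems(3) l by (auto simp: num_edges_def)
    ultimately show ?thesis using less.prems(1) by (auto simp: has_odd_cycle_def)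
  next
    case False
    then obtain q1 t q2 q3 where "q = q1 @ [t] @ q2 @ [t] @ q3" by (meson not_distinct_decomp)
    then have q': "q = q1 @ t # q2 @ t # q3" by simp
    define c1 where "c1 = t # q2 @ [t]"
    define c2 where "c2 = x # q1 @ t # q3"
    have "wedges p = wedges c1 \<union> wedges c2"
      using wedges_append[of "x # q1" t "q2 @ t # q3"] wedges_append[of "t # q2" t q3]
        wedges_append[of "x # q1" t q3] by (auto simp: p q' c1_def c2_def)
    then have w: "wedges c1 \<subseteq> edges H" "wedges c2 \<subseteq> edges H" using less.prems(1) by auto
    have "length c1 + length c2 = length p + 1" by (simp add: p q' c1_def c2_def)
    then have par: "even (length c1) \<or> even (length c2)" using less.prems(3) by presburger
    have short: "length c1 < length p" "length c2 < length p" by (simp_all add: p q' c1_def c2_def)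
    have "hd c1 = last c1" "hd c2 = last c2" using xq by (auto simp: c1_def c2_def q')
    then show ?thesis
      using par less.hyps[OF short(1) w(1)] less.hyps[OF short(2) w(2)] by (auto simp: c1_def c2_def)
  qed
qed

text \<open>The predicate \<open>P v b\<close> records the parity of a walk from \<open>r\<close> to
  \<open>v\<close>. A vertex reached with both parities yields an odd closed walk; if there is none,
  the parity is a colouring.\<close>

lemma has_odd_cycle_or_bicolored:
  assumes "simple_graph H" "connected_graph H"
  shows "has_odd_cycle H \<or> (\<exists>col. \<forall>e \<in> edges H. bicolored col e)"
proof (rule disjCI)
  assume no_col: "\<nexists>col. \<forall>e \<in> edges H. bicolored col e"
  have E: "\<forall>e \<in> edges H. e \<subseteq> verts H \<and> card e = 2" using assms(1) by (simp add: simple_graph_def)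
  obtain r where r: "r \<in> verts H" using assms(2) by (auto simp: connected_graph_def)
  define P where "P = (\<lambda>v b. \<exists>p. p \<noteq> [] \<and> hd p = r \<and> last p = v \<and> wedges p \<subseteq> edges H \<and> odd (length p) = b)"
  have step: "P v (\<not> b)" if uv: "P u b" "{u, v} \<in> edges H" for u v b
  proof -
    obtain p where p: "p \<noteq> []" "hd p = r" "last p = u" "wedges p \<subseteq> edges H" "odd (length p) = b"
      using uv(1) unfolding P_def by blast
    have "p = butlast p @ [u]" using p(1,3) by (metis append_butlast_last_id)
    then have "wedges (p @ [v]) = insert {u, v} (wedges p)"
      using wedges_snoc2[of "butlast p" u v] by (metis append.assoc append_Cons append_Nil)
    then show ?thesis
      unfolding P_def using p uv(2) by (intro exI[of _ "p @ [v]"]) auto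
  qed
  have ex: "\<exists>b. P v b" if "v \<in> verts H" for v
  proof -
    have "(adj H)\<^sup>*\<^sup>* r v" using assms(2) r that by (simp add: connected_graph_def)
    then show ?thesis
    proof (induction rule: rtranclp_induct)
      case base
      show ?case unfolding P_def by (rule exI[of _ True], rule exI[of _ "[r]"]) simp
    next
      case (step u v)
      then show ?case using \<open>\<And>v u b. P u b \<Longrightarrow> {u, v} \<in> edges H \<Longrightarrow> P v (\<not> b)\<close>
        unfolding adj_def by metis
    qed
  qed
  have "\<exists>v. P v True \<and> P v False"
  proof (rule ccontr)
    assume no: "\<not> ?thesis"
    have "bicolored (\<lambda>v. P v True) e" if e: "e \<in> edges H" for e
    proof -
      obtain u v where uv: "e = {u, v}" using e E by (meson card_2_iff)
      have "u \<in> verts H" using e E uv by auto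
      then consider "P u True" | "P u False" using ex by (metis (full_types))
      then have "P u True \<noteq> P v True"
        using step[of u _ v] e uv no by (cases; metis (full_types))
      then show ?thesis using uv by auto
    qed
    then show False using no_col by blast
  qed
  then obtain v p q where p: "p \<noteq> []" "hd p = r" "last p = v" "wedges p \<subseteq> edges H" "odd (length p)"
    and q: "q \<noteq> []" "hd q = r" "last q = v" "wedges q \<subseteq> edges H" "even (length q)"
    unfolding P_def by auto
  have pv: "p = butlast p @ [v]" using p by (metis append_butlast_last_id)
  have qv: "rev q = v # tl (rev q)" using q by (metis hd_rev list.collapse rev_is_Nil_conv)
  define c where "c = p @ tl (rev q)"
  have cv: "c = butlast p @ v # tl (rev q)" unfolding c_def by (subst pv) simp
  have "wedges c = wedges (butlast p @ [v]) \<union> wedges (v # tl (rev q))"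
    unfolding cv by (rule wedges_append)
  then have "wedges c = wedges p \<union> wedges q"
    by (simp only: pv[symmetric] qv[symmetric] wedges_rev)
  moreover have "hd c = r" using p by (simp add: c_def)
  moreover have "last c = r"
  proof -
    have "last (v # tl (rev q)) = r" using q qv by (metis last_rev)
    then show ?thesis unfolding cv by simp
  qed
  moreover have "even (length c)"
    using p(5) q(1,5) by (simp add: c_def)
  ultimately show "has_odd_cycle H"
    using odd_closed_walk[OF E, of c] p q by (auto simp: c_def)
qed

lemma bicolored_degree_sum:
  fixes M :: "'v::finite set multiset"
  assumes "\<forall>e \<in># M. bicolored col e"
  shows "(\<Sum>x | col x. edge_deg M x) = (\<Sum>x | \<not> col x. edge_deg M x)"
  using assms
proof (induction M)
  case (add e M)
  obtain u v where uv: "e = {u, v}" "col u" "\<not> col v"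
    using add.prems unfolding bicolored_def by (auto simp: insert_commute)
  have "(\<Sum>x | col x. of_bool (x \<in> e)) = (1::nat)"
  proof -
    have "(\<Sum>x | col x. of_bool (x \<in> e)) = (\<Sum>x | col x. if x = u then 1 else (0::nat))"
      using uv by (intro sum.cong) auto
    then show ?thesis using uv by simp
  qed
  moreover have "(\<Sum>x | \<not> col x. of_bool (x \<in> e)) = (1::nat)"
  proof -
    have "(\<Sum>x | \<not> col x. of_bool (x \<in> e)) = (\<Sum>x | \<not> col x. if x = v then 1 else (0::nat))"
      using uv by (intro sum.cong) auto
    then show ?thesis using uv by simp
  qed
  ultimately show ?case using add by (simp add: sum.distrib)
qed simp

text \<open>Deleting any one copy must leave equally many copies of both colours, so every vertex
  with copies would have the same colour. An edge with copies of both ends contradicts this.\<close>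

lemma critical_not_bicolored:
  fixes a :: "'v::finite \<Rightarrow> nat"
  assumes "critical E a" "{u, v} \<in> E" "a u > 0" "a v > 0" "\<forall>e \<in> E. bicolored col e"
  shows False
proof -
  have sum: "(\<Sum>x | col x. a x) + of_bool (\<not> col w) = (\<Sum>x | \<not> col x. a x) + of_bool (col w)"
    if w: "a w > 0" for w
  proof -
    obtain M where M: "set_mset M \<subseteq> E" "\<forall>x. edge_deg M x + of_bool (x = w) = a x"
      using assms(1) w unfolding critical_def by blast
    have a: "a = (\<lambda>x. edge_deg M x + of_bool (x = w))" using M(2) by auto
    have "(\<Sum>x | col x. of_bool (x = w)) = (of_bool (col w) :: nat)"
      "(\<Sum>x | \<not> col x. of_bool (x = w)) = (of_bool (\<not> col w) :: nat)"
      by (simp_all add: of_bool_def)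
    then show ?thesis
      unfolding a sum.distrib using bicolored_degree_sum[of M col] M(1) assms(5) by auto
  qed
  have "col u \<noteq> col v" using assms(2,5) by auto
  then show False using sum[OF assms(3)] sum[OF assms(4)] by (cases "col u") auto
qed

subsection \<open>Maximum matchings of vertex duplications\<close>

definition matching :: "'v set set \<Rightarrow> ('v \<Rightarrow> nat) \<Rightarrow> 'v set multiset \<Rightarrow> bool" where
  "matching E a M \<longleftrightarrow> set_mset M \<subseteq> E \<and> (\<forall>u. edge_deg M u \<le> a u)"

definition max_size :: "'v set set \<Rightarrow> ('v \<Rightarrow> nat) \<Rightarrow> nat \<Rightarrow> bool" where
  "max_size E a b \<longleftrightarrow> (\<exists>M. matching E a M \<and> size M = b) \<and> (\<forall>M. matching E a M \<longrightarrow> size M \<le> b)"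

text \<open>For the maximum size \<open>b\<close> this is the set D of the Gallai-Edmonds
  decomposition. Copies of one vertex are interchangeable, so it can be described by
  vertices.\<close>

definition missed :: "'v set set \<Rightarrow> ('v \<Rightarrow> nat) \<Rightarrow> nat \<Rightarrow> 'v \<Rightarrow> bool" where
  "missed E a b w \<longleftrightarrow> (\<exists>M. matching E a M \<and> size M = b \<and> edge_deg M w < a w)"

text \<open>For \<open>u = v\<close> two different copies of the same vertex are meant, hence the
  two separate indicators.\<close>

definition both_missed :: "'v set set \<Rightarrow> ('v \<Rightarrow> nat) \<Rightarrow> nat \<Rightarrow> 'v \<Rightarrow> 'v \<Rightarrow> bool" where
  "both_missed E a b u v \<longleftrightarrow> (\<exists>M. matching E a M \<and> size M = b \<and>
     (\<forall>x. edge_deg M x + of_bool (x = u) + of_bool (x = v) \<le> a x))"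

lemma both_missed_sym: "both_missed E a b u v \<Longrightarrow> both_missed E a b v u"
  unfolding both_missed_def by (simp add: ac_simps)

lemma both_missedI:
  assumes "matching E a M" "size M = b" "edge_deg M w < a w" "edge_deg M u + of_bool (u = w) < a u"
  shows "both_missed E a b u w"
  unfolding both_missed_def
  by (rule exI[of _ M]) (use assms in \<open>auto simp: matching_def of_bool_def\<close>)

lemma not_both_missed_adjacent:
  assumes "max_size E a b" "{u, v} \<in> E" "u \<noteq> v"
  shows "\<not> both_missed E a b u v"
proof
  assume "both_missed E a b u v"
  then obtain M where M: "matching E a M" "size M = b"
    "\<forall>x. edge_deg M x + of_bool (x = u) + of_bool (x = v) \<le> a x"
    unfolding both_missed_def by blast
  have "edge_deg (add_mset {u, v} M) x \<le> a x" for x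
    using M(3)[rule_format, of x] assms(3) by (cases "x = u"; cases "x = v") auto
  then have "matching E a (add_mset {u, v} M)"
    using M(1) assms(2) by (auto simp: matching_def)
  then show False using assms(1) M(2) unfolding max_size_def by fastforce
qed

text \<open>
  The copies that a maximum matching can miss form the matroid dual to the matching matroid; the
  next lemma is the exchange property showing that parallelism in it is transitive.
\<close>

lemma both_missed_exchange:
  fixes a :: "'v::finite \<Rightarrow> nat"
  assumes E: "\<forall>e \<in> E. card e = 2" and max: "max_size E a b"
    and M: "matching E a M" "size M = b" "\<forall>x. edge_deg M x + of_bool (x = u) + of_bool (x = v) \<le> a x"
    and "matching E a N" "size N = b" "edge_deg N w < a w"
  shows "both_missed E a b u w \<or> both_missed E a b v w"
  using assms(6-)
proof (induction "size (M - N)" arbitrary: N rule: less_induct)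
  case less
  have ME: "set_mset M \<subseteq> E" and NE: "set_mset N \<subseteq> E" using M(1) less.prems(1) by (auto simp: matching_def)
  show ?case
  proof (rule ccontr)
    assume no: "\<not> ?thesis"
    have full: "a t \<le> edge_deg N t + of_bool (t = w)" if "t = u \<or> t = v" for t
    proof (rule leI, rule notI)
      assume "edge_deg N t + of_bool (t = w) < a t"
      then show False using both_missedI[OF less.prems] that no by blast
    qed
    \<comment> \<open>Otherwise summing the degrees gives \<open>2 * b + 2 \<le> 2 * b + 1\<close>:
      the copies at \<open>u\<close> and \<open>v\<close> that \<open>M\<close> leaves free are
      covered by \<open>N\<close>, up to the single copy at \<open>w\<close>.\<close>
    have "\<exists>x. edge_deg N x < edge_deg M x \<and> edge_deg N x + of_bool (x = w) < a x"
    proof (rule ccontr)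
      assume "\<not> ?thesis"
      then have imp: "edge_deg N x < edge_deg M x \<Longrightarrow> a x \<le> edge_deg N x + of_bool (x = w)" for x
        by (meson not_less)
      have "edge_deg M x + of_bool (x = u) + of_bool (x = v) \<le> edge_deg N x + of_bool (x = w)" for x
      proof (cases "x = u \<or> x = v")
        case True
        then show ?thesis using full[of x] M(3)[rule_format, of x] by linarith
      next
        case False
        moreover have "edge_deg M x \<le> a x" using M(1) by (simp add: matching_def)
        ultimately show ?thesis using imp[of x] by (cases "edge_deg N x < edge_deg M x") auto
      qed
      then have "(\<Sum>x\<in>UNIV. edge_deg M x + of_bool (x = u) + of_bool (x = v))
        \<le> (\<Sum>x\<in>UNIV. edge_deg N x + of_bool (x = w))" by (intro sum_mono) auto
      moreover have "(\<Sum>x\<in>UNIV. of_bool (x = t)) = (1::nat)" for t :: 'v by (simp add: of_bool_def)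
      moreover have "\<forall>e \<in># M. card e = 2" "\<forall>e \<in># N. card e = 2" using E ME NE by blast+
      then have "sum (edge_deg M) UNIV = 2 * b" "sum (edge_deg N) UNIV = 2 * b"
        using sum_edge_deg[of M] sum_edge_deg[of N] M(2) less.prems(2) by simp_all
      ultimately show False by (simp only: sum.distrib)
    qed
    then obtain x where x: "edge_deg N x < edge_deg M x" "edge_deg N x + of_bool (x = w) < a x" by blast
    obtain e where e: "x \<in> e" "count N e < count M e" using edge_deg_less_ex[OF x(1)] by blast
    have eM: "e \<in># M" using e(2) by (metis count_inI gr_implies_not0)
    have eE: "e \<in> E" using eM ME by blast
    obtain y where y: "y \<noteq> x" "e = {x, y}" using other_end[of e x] e E eE by blast
    have dN: "edge_deg N t \<le> a t" for t using less.prems(1) by (simp add: matching_def)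
    have "a y \<le> edge_deg N y"
    proof (rule ccontr)
      assume lt: "\<not> ?thesis"
      have "edge_deg (add_mset e N) t \<le> a t" for t
        using dN[of t] lt x(2) y by (cases "t = x"; cases "t = y") auto
      then have "matching E a (add_mset e N)" using NE eE by (auto simp: matching_def)
      then show False using max less.prems(2) unfolding max_size_def by fastforce
    qed
    then have ya: "edge_deg N y = a y" "y \<noteq> w" using dN[of y] less.prems(3) by auto
    have "edge_deg (M - {#e#}) y < edge_deg N y"
      using edge_deg_remove[OF eM, of y] y(2) ya(1) M(1) by (auto simp: matching_def dest: spec[of _ y])
    from edge_deg_less_ex[OF this] obtain f where f: "y \<in> f" "count (M - {#e#}) f < count N f" by blast
    have fe: "f \<noteq> e" using f(2) e(2) by auto
    have fN: "f \<in># N" using f(2) by (metis count_inI gr_implies_not0)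
    have xf: "x \<notin> f"
    proof
      assume "x \<in> f"
      moreover have "card f = 2" using fN NE E by blast
      ultimately have "f = {x, y}" using other_end[of f x] f(1) y(1) by auto
      then show False using fe y(2) by simp
    qed
    \<comment> \<open>By maximality \<open>y\<close> is saturated in \<open>N\<close>, so
      \<open>e\<close> can only enter in exchange for an edge \<open>f\<close> at \<open>y\<close>.
      The new matching still misses \<open>w\<close> and is closer to \<open>M\<close>.\<close>
    define N' where "N' = add_mset e (N - {#f#})"
    have dN': "edge_deg N' t + of_bool (t \<in> f) = edge_deg N t + of_bool (t \<in> e)" for t
      using edge_deg_remove[OF fN, of t] by (simp add: N'_def)
    have dN'': "edge_deg N' t \<le> edge_deg N t + of_bool (t = x)" for t
      using dN'[of t] f(1) y by (cases "t = x"; cases "t = y") auto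
    have "edge_deg N' t \<le> a t" for t
      using dN''[of t] dN[of t] x(2) by (cases "t = x") auto
    moreover have "set_mset N' \<subseteq> E" using NE eE by (auto simp: N'_def dest: in_diffD)
    ultimately have "matching E a N'" by (simp add: matching_def)
    moreover have "size N' = b" using less.prems(2) size_Suc_Diff1[OF fN] by (simp add: N'_def)
    moreover have "edge_deg N' w < a w"
      using dN''[of w] less.prems(3) x(2) by (cases "w = x") auto
    moreover have "M - N' = M - N - {#e#}"
    proof (rule multiset_eqI)
      fix g
      show "count (M - N') g = count (M - N - {#e#}) g"
        using f(2) e(2) fe by (cases "g = e"; cases "g = f") (auto simp: N'_def)
    qed
    moreover have "e \<in># M - N" using e(2) by (simp add: in_diff_count)
    ultimately show False using less.hyps[of N'] no size_Diff1_less[of e "M - N"] by auto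
  qed
qed

text \<open>Gallai's lemma for duplications. Adjacent copies are never missed together, and the
  exchange property transports this along the path. The neighbour \<open>u'\<close> is needed at the
  start, to exclude two missed copies of \<open>u\<close> itself.\<close>

lemma not_both_missed_connected:
  fixes a :: "'v::finite \<Rightarrow> nat"
  assumes E: "\<forall>e \<in> E. card e = 2" and max: "max_size E a b"
    and path: "(\<lambda>x y. {x, y} \<in> E \<and> missed E a b y)\<^sup>*\<^sup>* u v"
    and u: "missed E a b u" and u': "{u, u'} \<in> E" "missed E a b u'"
  shows "\<not> both_missed E a b u v"
proof -
  have exch: "both_missed E a b x w \<or> both_missed E a b y w"
    if "both_missed E a b x y" "missed E a b w" for x y w
    using that both_missed_exchange[OF E max] unfolding both_missed_def[of E a b x y] missed_def by metis
  have ne: "x \<noteq> y" if "{x, y} \<in> E" for x y using E that by force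
  have "missed E a b v \<and> \<not> both_missed E a b u v"
    using path
  proof (induction rule: rtranclp_induct)
    case base
    show ?case using exch[OF _ u'(2), of u u] not_both_missed_adjacent[OF max u'(1) ne[OF u'(1)]] u by blast
  next
    case (step v v')
    then show ?case
      using exch[of u v' v] not_both_missed_adjacent[OF max, of v v'] ne[of v v'] both_missed_sym[of E a b v' v]
      by blast
  qed
  then show ?thesis by blast
qed

subsection \<open>Components\<close>

lemma component_cases:
  assumes "C \<in> components H"
  obtains u where "u \<in> verts H" "verts C = {v \<in> verts H. (adj H)\<^sup>*\<^sup>* u v}"
    "edges C = {e \<in> edges H. e \<subseteq> verts C}"
  using assms by (fastforce simp: components_def induced_def)

lemma component_subgraph:
  assumes "simple_graph H" "C \<in> components H"
  shows "simple_graph C" "verts C \<subseteq> verts H" "edges C \<subseteq> edges H"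
  using assms by (auto elim!: component_cases simp: simple_graph_def intro: finite_subset)

lemma component_closed:
  assumes "simple_graph H" "C \<in> components H" "e \<in> edges H" "v \<in> e" "v \<in> verts C"
  shows "e \<in> edges C"
proof -
  obtain u where u: "verts C = {v \<in> verts H. (adj H)\<^sup>*\<^sup>* u v}" "edges C = {e \<in> edges H. e \<subseteq> verts C}"
    using assms(2) by (elim component_cases)
  have e: "card e = 2" "e \<subseteq> verts H" using assms(1,3) by (auto simp: simple_graph_def)
  obtain w where w: "e = {v, w}" using other_end[OF e(1) assms(4)] by blast
  have "(adj H)\<^sup>*\<^sup>* u v" using assms(5) u(1) by blast
  moreover have "adj H v w" using w assms(3) by (simp add: adj_def)
  ultimately have "w \<in> verts C" using u(1) e(2) w by auto
  then show ?thesis using u(2) assms(3,5) w by simp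
qed

lemma component_connected:
  assumes "simple_graph H" "C \<in> components H"
  shows "connected_graph C"
proof -
  obtain u where u: "u \<in> verts H" "verts C = {v \<in> verts H. (adj H)\<^sup>*\<^sup>* u v}"
    using assms(2) by (elim component_cases)
  have uC: "u \<in> verts C" using u by simp
  have "v \<in> verts C \<and> (adj C)\<^sup>*\<^sup>* u v" if "(adj H)\<^sup>*\<^sup>* u v" for v
    using that
  proof (induction rule: rtranclp_induct)
    case (step x y)
    then have "{x, y} \<in> edges H" by (simp add: adj_def)
    then have e: "{x, y} \<in> edges C" using component_closed[OF assms] step.IH by blast
    then have "adj C x y" by (simp add: adj_def)
    moreover have "y \<in> verts C" using e component_subgraph(1)[OF assms] by (auto simp: simple_graph_def)
    ultimately show ?case using step.IH by auto
  qed (use uC in auto)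
  then have r: "(adj C)\<^sup>*\<^sup>* u v" if "v \<in> verts C" for v using that u(2) by blast
  have "(adj C)\<^sup>*\<^sup>* v w" if "v \<in> verts C" "w \<in> verts C" for v w
    using adj_rtranclp_sym[OF r[OF that(1)]] r[OF that(2)] by (rule rtranclp_trans)
  then show ?thesis using uC unfolding connected_graph_def by blast
qed

lemma components_disjoint:
  assumes "C \<in> components H" "C' \<in> components H" "C \<noteq> C'"
  shows "verts C \<inter> verts C' = {}"
proof (rule ccontr)
  assume "\<not> ?thesis"
  then obtain v where v: "v \<in> verts C" "v \<in> verts C'" by blast
  obtain u where u: "verts C = {v \<in> verts H. (adj H)\<^sup>*\<^sup>* u v}" "edges C = {e \<in> edges H. e \<subseteq> verts C}"
    using assms(1) by (elim component_cases)
  obtain u' where u': "verts C' = {v \<in> verts H. (adj H)\<^sup>*\<^sup>* u' v}" "edges C' = {e \<in> edges H. e \<subseteq> verts C'}"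
    using assms(2) by (elim component_cases)
  have r: "(adj H)\<^sup>*\<^sup>* u v" "(adj H)\<^sup>*\<^sup>* u' v" using v u(1) u'(1) by blast+
  have "(adj H)\<^sup>*\<^sup>* u w \<longleftrightarrow> (adj H)\<^sup>*\<^sup>* u' w" for w
    using r adj_rtranclp_sym rtranclp_trans[of "adj H"] by metis
  then have "verts C = verts C'" using u(1) u'(1) by simp
  then have "C = C'" using u(2) u'(2) by (simp add: graph_eqI)
  then show False using assms(3) by simp
qed

lemma Union_components: "(\<Union>C \<in> components H. verts C) = verts H"
proof
  show "(\<Union>C \<in> components H. verts C) \<subseteq> verts H"
    by (auto elim!: component_cases)
  show "verts H \<subseteq> (\<Union>C \<in> components H. verts C)"
  proof
    fix u assume "u \<in> verts H"
    then show "u \<in> (\<Union>C \<in> components H. verts C)"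
      by (intro UN_I[of "induced H {v \<in> verts H. (adj H)\<^sup>*\<^sup>* u v}"])
        (auto simp: components_def induced_def)
  qed
qed

lemma finite_components: "finite (verts H) \<Longrightarrow> finite (components H)"
  unfolding components_def by simp

lemma sum_components:
  fixes f :: "'v \<Rightarrow> nat"
  assumes "simple_graph H"
  shows "(\<Sum>C \<in> components H. sum f (verts C)) = sum f (verts H)"
proof -
  have fin: "finite (verts H)" using assms by (simp add: simple_graph_def)
  have "sum f (\<Union>C \<in> components H. verts C) = (\<Sum>C \<in> components H. sum f (verts C))"
  proof (rule sum.UNION_disjoint)
    show "finite (components H)" by (rule finite_components[OF fin])
    show "\<forall>C \<in> components H. finite (verts C)"
      using component_subgraph(2)[OF assms] fin by (meson finite_subset)
    show "\<forall>C \<in> components H. \<forall>C' \<in> components H. C \<noteq> C' \<longrightarrow> verts C \<inter> verts C' = {}"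
      using components_disjoint by (intro ballI impI)
  qed
  then show ?thesis by (simp add: Union_components)
qed

lemma induced_simple: "simple_graph G \<Longrightarrow> simple_graph (induced G W)"
  by (auto simp: simple_graph_def induced_def)

text \<open>The number of components is distributed as one unit per summand, so that each component
  can be treated alone. The value 0 for the empty graph agrees with the empty sum.\<close>

lemma nu_star_components:
  assumes "simple_graph H"
  shows "nu_star H = (\<Sum>C \<in> components H.
    real (card (verts C) + ear_phi_conn C + card {e. is_bridge C e}) - 1) / 2"
proof (cases "verts H = {}")
  case True
  then have "components H = {}" by (auto simp: components_def)
  then show ?thesis using True by (simp add: nu_star_def)
next
  case False
  have "(\<Sum>C \<in> components H. card (verts C)) = card (verts H)"
    using sum_components[OF assms, of "\<lambda>_. 1"] by simp
  then have "real (card (verts H)) = (\<Sum>C \<in> components H. real (card (verts C)))"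
    by (metis of_nat_sum)
  then show ?thesis using False
    by (simp add: nu_star_def ear_phi_def num_bridges_def sum.distrib sum_subtractf)
qed

subsection \<open>From matchings to dominant sets\<close>

lemma max_size_exists:
  fixes a :: "'v::finite \<Rightarrow> nat"
  assumes "\<forall>e \<in> E. card e = 2"
  shows "\<exists>b. max_size E a b"
proof -
  define P where "P = (\<lambda>n. \<exists>M. matching E a M \<and> size M = n)"
  have bd: "n \<le> sum a UNIV" if Pn: "P n" for n
  proof -
    obtain M where M: "matching E a M" "size M = n" using Pn by (auto simp: P_def)
    have "2 * size M = sum (edge_deg M) UNIV"
      by (rule sum_edge_deg[symmetric]) (use M(1) assms in \<open>auto simp: matching_def\<close>)
    also have "\<dots> \<le> sum a UNIV" using M(1) by (intro sum_mono) (simp add: matching_def)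
    finally show ?thesis using M(2) by simp
  qed
  have "P 0" unfolding P_def by (intro exI[of _ "{#}"]) (simp add: matching_def)
  then have "P (Greatest P)" using bd by (rule GreatestI_nat)
  moreover have "n \<le> Greatest P" if "P n" for n using that bd by (rule Greatest_le_nat)
  ultimately show ?thesis unfolding max_size_def P_def by metis
qed

text \<open>Every maximum matching uses all copies of such a \<open>v\<close>. Without one of these
  copies it loses exactly one edge, stays maximum, and still misses what it missed before.\<close>

lemma max_size_reduce:
  assumes max: "max_size E a b" and v: "a v > 0" "\<not> missed E a b v"
  shows "b > 0 \<and> max_size E (a(v := a v - 1)) (b - 1) \<and>
    (\<forall>w. missed E a b w \<longrightarrow> missed E (a(v := a v - 1)) (b - 1) w)"
proof -
  let ?a = "a(v := a v - 1)"
  have red: "\<exists>M'. matching E ?a M' \<and> size M' = b - 1 \<and> b > 0 \<and> (\<forall>w. edge_deg M' w \<le> edge_deg M w)"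
    if M: "matching E a M" "size M = b" for M
  proof -
    have "\<not> edge_deg M v < a v" using v(2) M unfolding missed_def by blast
    moreover have "edge_deg M v \<le> a v" using M(1) by (simp add: matching_def)
    ultimately have full: "edge_deg M v = a v" by simp
    then have "edge_deg {#} v < edge_deg M v" using v(1) by simp
    from edge_deg_less_ex[OF this] obtain e where e: "v \<in> e" "e \<in># M" by auto
    have d: "edge_deg (M - {#e#}) w + of_bool (w \<in> e) = edge_deg M w" for w
      by (rule edge_deg_remove[OF e(2)])
    have "edge_deg (M - {#e#}) w \<le> ?a w" for w
    proof (cases "w = v")
      case True
      then show ?thesis using d[of v] e(1) full by simp
    next
      case False
      have "edge_deg M w \<le> a w" using M(1) by (simp add: matching_def)
      then show ?thesis using d[of w] False by simp
    qed
    moreover have "set_mset (M - {#e#}) \<subseteq> E" using M(1) by (auto simp: matching_def dest: in_diffD)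
    ultimately have "matching E ?a (M - {#e#})" by (simp add: matching_def)
    moreover have "Suc (size (M - {#e#})) = b" using size_Suc_Diff1[OF e(2)] M(2) by simp
    ultimately show ?thesis using d by (intro exI[of _ "M - {#e#}"]) (auto intro: le_add1[THEN order_trans] simp flip: d)
  qed
  obtain M where M: "matching E a M" "size M = b" using max by (auto simp: max_size_def)
  have "size M' \<le> b - 1" if M': "matching E ?a M'" for M'
  proof -
    have d: "edge_deg M' w \<le> ?a w" for w using M' by (simp add: matching_def)
    have "edge_deg M' w \<le> a w" for w using d[of w] by (cases "w = v") auto
    then have m: "matching E a M'" using M' by (simp add: matching_def)
    moreover have "edge_deg M' v < a v" using d[of v] v(1) by simp
    ultimately have "size M' \<noteq> b" using v(2) unfolding missed_def by blast
    then show ?thesis using max m unfolding max_size_def by fastforce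
  qed
  moreover have "missed E ?a (b - 1) w" if mw: "missed E a b w" for w
  proof -
    obtain N where N: "matching E a N" "size N = b" "edge_deg N w < a w"
      using mw unfolding missed_def by blast
    have "w \<noteq> v" using mw v(2) by blast
    then show ?thesis using red[OF N(1,2)] N(3) unfolding missed_def by (metis fun_upd_other le_less_trans)
  qed
  ultimately show ?thesis using red[OF M] unfolding max_size_def by blast
qed

text \<open>A duplication with the fewest copies is taken among those with these properties; a
  vertex with copies but never missed could be reduced further. Vertices outside \<open>U\<close>
  are not affected: they have at least \<open>k\<close> copies, which a matching of size
  \<open>b < k\<close> cannot saturate, so they are always missed.\<close>

lemma reduced_dup:
  fixes a0 :: "'v::finite \<Rightarrow> nat"
  assumes "max_size E a0 b0" "b0 < k" "\<forall>i \<in> U. \<exists>w. {i, w} \<in> E \<and> missed E a0 b0 w" "\<forall>z. z \<notin> U \<longrightarrow> k \<le> a0 z"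
  shows "\<exists>a b. max_size E a b \<and> b < k \<and> (\<forall>i \<in> U. \<exists>w. {i, w} \<in> E \<and> missed E a b w) \<and>
    (\<forall>z. z \<notin> U \<longrightarrow> k \<le> a z) \<and> (\<forall>w. a w > 0 \<longrightarrow> missed E a b w)"
proof -
  define P where "P = (\<lambda>a. \<exists>b. max_size E a b \<and> b < k \<and> (\<forall>i \<in> U. \<exists>w. {i, w} \<in> E \<and> missed E a b w) \<and>
    (\<forall>z. z \<notin> U \<longrightarrow> k \<le> a z))"
  have "P a0" using assms unfolding P_def by blast
  then obtain a where a: "P a" "\<forall>a'. P a' \<longrightarrow> sum a UNIV \<le> sum a' UNIV"
    using ex_has_least_nat[of P a0 "\<lambda>a. sum a UNIV"] by blast
  obtain b where b: "max_size E a b" "b < k" "\<forall>i \<in> U. \<exists>w. {i, w} \<in> E \<and> missed E a b w"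
    "\<forall>z. z \<notin> U \<longrightarrow> k \<le> a z"
    using a(1) unfolding P_def by blast
  have "missed E a b v" if v: "a v > 0" for v
  proof (rule ccontr)
    assume no: "\<not> ?thesis"
    let ?a = "a(v := a v - 1)"
    note r = max_size_reduce[OF b(1) v no]
    have "v \<in> U"
    proof (rule ccontr)
      assume "v \<notin> U"
      then have k: "k \<le> a v" using b(4) by blast
      obtain M where M: "matching E a M" "size M = b" using b(1) by (auto simp: max_size_def)
      have "edge_deg M v < a v" using edge_deg_le_size[of M v] M(2) b(2) k by simp
      then show False using no M unfolding missed_def by blast
    qed
    then have "\<forall>z. z \<notin> U \<longrightarrow> k \<le> ?a z" using b(4) by auto
    moreover have "b - 1 < k" using b(2) by simp
    moreover have "\<forall>i \<in> U. \<exists>w. {i, w} \<in> E \<and> missed E ?a (b - 1) w" using r b(3) by blast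
    ultimately have "P ?a" using r unfolding P_def by blast
    then have "sum a UNIV \<le> sum ?a UNIV" using a(2) by blast
    moreover have "sum ?a UNIV < sum a UNIV"
      by (rule sum_strict_mono_ex1) (use v in auto)
    ultimately show False by simp
  qed
  then show ?thesis using b by blast
qed

text \<open>By Gallai's lemma a maximum matching misses at most one copy in \<open>C\<close>. One
  that misses \<open>w\<close> in \<open>C\<close> covers all other copies there, and its edges at
  \<open>C\<close> stay inside \<open>C\<close>, since \<open>W\<close> contains every neighbour
  that has copies. The last claim compares copies with covered copies.\<close>

lemma component_critical:
  fixes G :: "'v::finite graph"
  assumes G: "simple_graph G" and max: "max_size (edges G) a b"
    and W: "\<forall>w \<in> W. a w > 0 \<and> missed (edges G) a b w"
      "\<forall>x \<in> W. \<forall>y. {x, y} \<in> edges G \<longrightarrow> a y > 0 \<longrightarrow> y \<in> W"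
      "\<forall>x \<in> W. \<exists>y \<in> W. {x, y} \<in> edges G"
    and C: "C \<in> components (induced G W)" and V: "verts G = UNIV"
  defines "aC \<equiv> \<lambda>v. if v \<in> verts C then a v else 0"
  shows "critical (edges C) aC" "edges C \<noteq> {}"
    "matching (edges G) a M \<Longrightarrow> size M = b \<Longrightarrow> sum aC UNIV \<le> sum (edge_deg M) (verts C) + 1"
proof -
  let ?H = "induced G W"
  have H: "simple_graph ?H" by (rule induced_simple[OF G])
  have vH: "verts ?H = W" and eH: "edges ?H = {e \<in> edges G. e \<subseteq> W}" using V by (auto simp: induced_def)
  note sub = component_subgraph[OF H C]
  have CW: "verts C \<subseteq> W" using sub(2) vH by simp
  have E: "\<forall>e \<in> edges G. card e = 2" using G by (simp add: simple_graph_def)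
  have nb: "\<exists>y \<in> verts C. {x, y} \<in> edges C" if x: "x \<in> verts C" for x
  proof -
    obtain y where y: "y \<in> W" "{x, y} \<in> edges G" using W(3) x CW by blast
    then have "{x, y} \<in> edges ?H" using eH x CW by auto
    then have e: "{x, y} \<in> edges C" using component_closed[OF H C] x by blast
    then have "y \<in> verts C" using sub(1) by (auto simp: simple_graph_def)
    then show ?thesis using e by blast
  qed
  have nbm: "\<not> both_missed (edges G) a b u v" if u: "u \<in> verts C" and v: "v \<in> verts C" for u v
  proof -
    have st: "{x, y} \<in> edges G \<and> missed (edges G) a b y" if "adj C x y" for x y
    proof -
      have e: "{x, y} \<in> edges C" using that by (simp add: adj_def)
      then have "y \<in> verts C" using sub(1) by (auto simp: simple_graph_def)
      then show "{x, y} \<in> edges G \<and> missed (edges G) a b y" using e sub(3) eH CW W(1) by auto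
    qed
    have "(adj C)\<^sup>*\<^sup>* u v" using component_connected[OF H C] u v by (simp add: connected_graph_def)
    then have path: "(\<lambda>x y. {x, y} \<in> edges G \<and> missed (edges G) a b y)\<^sup>*\<^sup>* u v"
    proof (induction rule: rtranclp_induct)
      case (step x y)
      show ?case by (rule rtranclp.rtrancl_into_rtrancl[OF step.IH st[OF step.hyps(2)]])
    qed simp
    obtain u' where "u' \<in> verts C" "{u, u'} \<in> edges C" using nb[OF u] by blast
    then have "{u, u'} \<in> edges G" "missed (edges G) a b u'" "missed (edges G) a b u"
      using sub(3) eH CW W(1) u by auto
    then show ?thesis using not_both_missed_connected[OF E max path] by blast
  qed
  show "edges C \<noteq> {}"
    using nb component_connected[OF H C] by (auto simp: connected_graph_def)
  show "critical (edges C) aC"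
    unfolding critical_def
  proof (intro allI impI)
    fix w assume "aC w > 0"
    then have w: "w \<in> verts C" by (auto simp: aC_def split: if_splits)
    then obtain M where M: "matching (edges G) a M" "size M = b" "edge_deg M w < a w"
      using W(1) CW unfolding missed_def by blast
    have dM: "edge_deg M u \<le> a u" for u using M(1) by (simp add: matching_def)
    have full: "edge_deg M u + of_bool (u = w) = a u" if u: "u \<in> verts C" for u
    proof (rule ccontr)
      assume ne: "\<not> ?thesis"
      have "edge_deg M u + of_bool (u = w) \<le> a u" using dM[of u] M(3) by (cases "u = w") auto
      then have "edge_deg M u + of_bool (u = w) < a u" using ne by simp
      then show False using both_missedI[OF M(1,2,3)] nbm[OF u w] by blast
    qed
    define N where "N = {#e \<in># M. e \<in> edges C#}"
    have inC: "e \<in> edges C" if e: "e \<in># M" "u \<in> e" and u: "u \<in> verts C" for e u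
    proof -
      have eG: "e \<in> edges G" using e(1) M(1) by (auto simp: matching_def)
      then obtain y where y: "e = {u, y}" using other_end[of e u] e(2) E by blast
      have "y \<in> e" using y by simp
      then have "edge_deg M y > 0" using edge_deg_remove[OF e(1), of y] by simp
      then have "a y > 0" using dM[of y] by simp
      then have "y \<in> W" using W(2) u CW eG y by blast
      then have "e \<in> edges ?H" using eG y u CW eH by auto
      then show ?thesis using component_closed[OF H C] e(2) u by blast
    qed
    have "edge_deg N u + of_bool (u = w) = aC u" for u
    proof (cases "u \<in> verts C")
      case True
      have "{#e \<in># N. u \<in> e#} = {#e \<in># M. u \<in> e#}"
        unfolding N_def filter_filter_mset using inC[OF _ _ True] by (intro filter_mset_cong) auto
      then have "edge_deg N u = edge_deg M u" by (simp add: edge_deg_def)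
      then show ?thesis using full[OF True] True by (simp add: aC_def)
    next
      case False
      have "u \<notin> e" if "e \<in> edges C" for e using that False sub(1) by (auto simp: simple_graph_def)
      then have "{#e \<in># N. u \<in> e#} = {#}" by (simp add: N_def filter_filter_mset)
      then have "edge_deg N u = 0" by (simp add: edge_deg_def)
      moreover have "u \<noteq> w" using False w by blast
      ultimately show ?thesis using False by (simp add: aC_def)
    qed
    moreover have "set_mset N \<subseteq> edges C" by (auto simp: N_def)
    ultimately show "\<exists>N. set_mset N \<subseteq> edges C \<and> (\<forall>u. edge_deg N u + of_bool (u = w) = aC u)"
      by blast
  qed
  assume M: "matching (edges G) a M" "size M = b"
  have dM: "edge_deg M u \<le> a u" for u using M(1) by (simp add: matching_def)
  have "sum aC UNIV = sum a (verts C)" unfolding aC_def by (simp add: sum.If_cases)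
  also have "\<dots> \<le> sum (edge_deg M) (verts C) + 1"
  proof (cases "\<exists>u \<in> verts C. edge_deg M u < a u")
    case False
    then have "sum a (verts C) \<le> sum (edge_deg M) (verts C)" by (intro sum_mono) (simp add: not_less)
    then show ?thesis by simp
  next
    case True
    then obtain u where u: "u \<in> verts C" "edge_deg M u < a u" by blast
    have "a v \<le> edge_deg M v + of_bool (v = u)" if v: "v \<in> verts C" for v
    proof (rule leI, rule notI)
      assume "edge_deg M v + of_bool (v = u) < a v"
      then show False using both_missedI[OF M u(2)] nbm[OF v u(1)] by blast
    qed
    then have "sum a (verts C) \<le> (\<Sum>v\<in>verts C. edge_deg M v + of_bool (v = u))" by (intro sum_mono)
    also have "\<dots> = sum (edge_deg M) (verts C) + 1" using u(1) by (simp add: sum.distrib of_bool_def)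
    finally show ?thesis .
  qed
  finally show "sum aC UNIV \<le> sum (edge_deg M) (verts C) + 1" .
qed

text \<open>The \<open>k\<close> copies of each vertex outside \<open>U\<close> act as an unlimited
  supply, because fewer than \<open>k\<close> edges cannot exhaust them. Dominance holds since every
  vertex of \<open>U\<close> has a missed neighbour, which lies in \<open>W\<close> or outside
  \<open>U\<close>; the odd cycles are forced by criticality of the components.\<close>

lemma dominant_star_of_matching:
  fixes G :: "'v::finite graph"
  assumes G: "simple_graph G" "verts G = UNIV"
    and small: "\<forall>M. matching (edges G) (\<lambda>v. c v + (if v \<in> U then 0 else k)) M \<longrightarrow> size M < k"
    and large: "\<forall>i \<in> U. \<exists>M. matching (edges G) (\<lambda>v. c v + (if v \<in> U then 0 else k) + of_bool (v = i)) M \<and> size M = k"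
  shows "\<exists>W \<in> dominant_star_sets G U. nu_star (induced G W) \<le> real k - 1"
proof -
  let ?E = "edges G" and ?a0 = "\<lambda>v. c v + (if v \<in> U then 0 else k)"
  have E: "\<forall>e \<in> ?E. card e = 2" using G by (simp add: simple_graph_def)
  have ne: "x \<noteq> y" if "{x, y} \<in> ?E" for x y using E that by force
  obtain b0 where b0: "max_size ?E ?a0 b0" using max_size_exists[OF E] by blast
  have "b0 < k" using b0 small unfolding max_size_def by blast
  \<comment> \<open>A matching of size \<open>k\<close> must use the additional copy of
    \<open>i\<close>. Without one edge \<open>{i, w}\<close> it is a maximum matching of the
    original duplication in which a copy of \<open>w\<close> is free.\<close>
  have nbr: "\<exists>w. {i, w} \<in> ?E \<and> missed ?E ?a0 b0 w" if i: "i \<in> U" for i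
  proof -
    obtain M where M: "matching ?E (\<lambda>v. ?a0 v + of_bool (v = i)) M" "size M = k" using large i by blast
    have dM: "edge_deg M v \<le> ?a0 v + of_bool (v = i)" for v using M(1) by (simp add: matching_def)
    have "\<not> matching ?E ?a0 M" using small M(2) by blast
    then obtain v where "\<not> edge_deg M v \<le> ?a0 v" using M(1) unfolding matching_def by blast
    then have full: "?a0 i < edge_deg M i" using dM[of v] by (cases "v = i") auto
    then obtain e where e: "i \<in> e" "e \<in># M" using edge_deg_less_ex[of "{#}" i M] by auto
    have eE: "e \<in> ?E" using e(2) M(1) by (auto simp: matching_def)
    then obtain w where w: "w \<noteq> i" "e = {i, w}" using other_end[of e i] e(1) E by blast
    have d: "edge_deg (M - {#e#}) v + of_bool (v \<in> e) = edge_deg M v" for v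
      by (rule edge_deg_remove[OF e(2)])
    have "edge_deg (M - {#e#}) v \<le> ?a0 v" for v
      using d[of v] dM[of v] e(1) by (cases "v = i") auto
    moreover have "set_mset (M - {#e#}) \<subseteq> ?E" using M(1) by (auto simp: matching_def dest: in_diffD)
    ultimately have m: "matching ?E ?a0 (M - {#e#})" by (simp add: matching_def)
    have s: "Suc (size (M - {#e#})) = k" using size_Suc_Diff1[OF e(2)] M(2) by simp
    then have "size (M - {#e#}) = b0"
      using m b0 \<open>b0 < k\<close> unfolding max_size_def by fastforce
    moreover have "edge_deg (M - {#e#}) w < ?a0 w" using d[of w] dM[of w] w by auto
    ultimately show ?thesis using m eE w(2) unfolding missed_def by blast
  qed
  obtain a b where a: "max_size ?E a b" "b < k" "\<forall>i \<in> U. \<exists>w. {i, w} \<in> ?E \<and> missed ?E a b w"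
    "\<forall>z. z \<notin> U \<longrightarrow> k \<le> a z" "\<forall>w. a w > 0 \<longrightarrow> missed ?E a b w"
    using reduced_dup[OF b0 \<open>b0 < k\<close>, of U] nbr by auto
  \<comment> \<open>Every maximum matching leaves a copy of \<open>z\<close> free, so one that
    misses \<open>x\<close> could be enlarged by \<open>{x, z}\<close>.\<close>
  have no_edge: "{x, z} \<notin> ?E" if z: "z \<notin> U" and x: "a x > 0" for x z
  proof
    assume e: "{x, z} \<in> ?E"
    obtain M where M: "matching ?E a M" "size M = b" "edge_deg M x < a x"
      using a(5) x unfolding missed_def by blast
    have "edge_deg M z + of_bool (z = x) < a z"
      using edge_deg_le_size[of M z] M(2) a(2,4) z ne[OF e] by fastforce
    then have "both_missed ?E a b z x" by (rule both_missedI[OF M])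
    then show False using not_both_missed_adjacent[OF a(1) e ne[OF e]] both_missed_sym by metis
  qed
  have no_edge': "{z, x} \<notin> ?E" if "z \<notin> U" "a x > 0" for x z
    using no_edge[OF that] by (simp add: insert_commute)
  have az: "a z > 0" if "z \<notin> U" for z using a(2,4) that by fastforce
  define W where "W = {w \<in> U. a w > 0}"
  have ma: "a w > 0" if "missed ?E a b w" for w using that unfolding missed_def by auto
  have W1: "\<forall>w \<in> W. a w > 0 \<and> missed ?E a b w" using a(5) by (auto simp: W_def)
  have W2: "\<forall>x \<in> W. \<forall>y. {x, y} \<in> ?E \<longrightarrow> a y > 0 \<longrightarrow> y \<in> W"
    using no_edge by (auto simp: W_def)
  \<comment> \<open>Hence no component of \<open>induced G W\<close> is a single vertex, for which
    criticality would not imply an odd cycle.\<close>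
  have W3: "\<forall>x \<in> W. \<exists>y \<in> W. {x, y} \<in> ?E"
  proof
    fix x assume x: "x \<in> W"
    then obtain w where w: "{x, w} \<in> ?E" "missed ?E a b w" using a(3) by (auto simp: W_def)
    then show "\<exists>y \<in> W. {x, y} \<in> ?E" using W2 x ma by blast
  qed
  note cc = component_critical[OF G(1) a(1) W1 W2 W3 _ G(2)]
  let ?H = "induced G W"
  have H: "simple_graph ?H" by (rule induced_simple[OF G(1)])
  define aC where "aC = (\<lambda>C v. if v \<in> verts C then a v else 0)"
  have supp: "\<forall>v. aC C v > 0 \<longleftrightarrow> v \<in> verts C" if C: "C \<in> components ?H" for C
    using component_subgraph(2)[OF H C] by (auto simp: aC_def W_def induced_def)
  have odd: "has_odd_cycle C" if C: "C \<in> components ?H" for C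
  proof -
    obtain e where e: "e \<in> edges C" using cc(2)[OF C] by blast
    have sC: "simple_graph C" by (rule component_subgraph(1)[OF H C])
    obtain x y where xy: "e = {x, y}" using e sC by (metis card_2_iff simple_graph_def)
    have "x \<in> verts C" "y \<in> verts C" using e xy sC by (auto simp: simple_graph_def)
    then have "aC C x > 0" "aC C y > 0" using supp[OF C] by blast+
    then have "\<not> (\<forall>e \<in> edges C. bicolored col e)" for col
      using critical_not_bicolored[OF cc(1)[OF C], of x y col] e xy unfolding aC_def by blast
    then show ?thesis using has_odd_cycle_or_bicolored[OF sC component_connected[OF H C]] by blast
  qed
  have "indep_set G (UNIV - U)"
    unfolding indep_set_def adj_def using no_edge az by auto
  moreover have "W \<subseteq> U" by (auto simp: W_def)
  moreover have "dominant G U W"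
  proof -
    have "W \<subseteq> UNIV - (UNIV - U \<union> nbhd G (UNIV - U))"
      using no_edge' by (auto simp: W_def nbhd_def adj_def)
    moreover have "v \<in> nbhd G W \<union> nbhd G (UNIV - U) \<union> (UNIV - U)" for v
    proof (cases "v \<in> U")
      case True
      then obtain w where w: "{v, w} \<in> ?E" "missed ?E a b w" using a(3) by blast
      have "adj G w v" using w(1) by (simp add: adj_def insert_commute)
      then show ?thesis using ma[OF w(2)] by (cases "w \<in> U") (auto simp: nbhd_def W_def G(2))
    qed simp
    ultimately show ?thesis unfolding dominant_def Let_def G(2) by blast
  qed
  ultimately have D: "W \<in> dominant_star_sets G U"
    using odd by (simp add: dominant_star_sets_def dominant_star_def G(2))
  obtain M where M: "matching ?E a M" "size M = b" using a(1) by (auto simp: max_size_def)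
  \<comment> \<open>The 1 per component cancels against the number of components subtracted in
    \<open>nu_star\<close>.\<close>
  have bound: "card (verts C) + ear_phi_conn C + card {e. is_bridge C e} \<le> sum (edge_deg M) (verts C) + 1"
    if C: "C \<in> components ?H" for C
  proof -
    have "card (verts C) + ear_phi_conn C + card {e. is_bridge C e} \<le> sum (aC C) UNIV"
      by (rule critical_lower_bound[OF component_subgraph(1)[OF H C] component_connected[OF H C] cc(2)[OF C] _ supp[OF C]])
        (use cc(1)[OF C] in \<open>simp add: aC_def\<close>)
    also have "\<dots> \<le> sum (edge_deg M) (verts C) + 1"
      using cc(3)[OF C M] by (simp add: aC_def)
    finally show ?thesis .
  qed
  have "2 * nu_star ?H = (\<Sum>C \<in> components ?H.
    real (card (verts C) + ear_phi_conn C + card {e. is_bridge C e}) - 1)"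
    by (simp add: nu_star_components[OF H])
  also have "\<dots> \<le> (\<Sum>C \<in> components ?H. real (sum (edge_deg M) (verts C)))"
  proof (rule sum_mono)
    fix C assume "C \<in> components ?H"
    then show "real (card (verts C) + ear_phi_conn C + card {e. is_bridge C e}) - 1
      \<le> real (sum (edge_deg M) (verts C))" using bound[of C] by linarith
  qed
  also have "\<dots> = real (sum (edge_deg M) (verts ?H))"
    using sum_components[OF H, of "edge_deg M"] by (metis of_nat_sum)
  also have "\<dots> \<le> real (sum (edge_deg M) UNIV)"
    by (intro of_nat_mono sum_mono2) auto
  also have "sum (edge_deg M) UNIV = 2 * b"
    using sum_edge_deg[of M] M E by (auto simp: matching_def)
  finally have "nu_star ?H \<le> real b" by simp
  also have "\<dots> \<le> real k - 1" using a(2) by linarith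
  finally show ?thesis using D by blast
qed

subsection \<open>From dominant sets to matchings\<close>

text \<open>Each pair is added as the odd ear \<open>u, v, u, v\<close>. This raises the size of a
  maximum matching by one, so that any larger value can be reached exactly.\<close>

lemma critical_add_edges:
  assumes E: "\<forall>e \<in> E. card e = 2" and a: "critical E a" "{u, v} \<in> E" "a u > 0" "a v > 0"
  shows "critical E (\<lambda>x. a x + j * (of_bool (x = u) + of_bool (x = v)))"
proof (induction j)
  case (Suc j)
  let ?a = "\<lambda>x. a x + j * (of_bool (x = u) + of_bool (x = v))"
  have "critical E (\<lambda>x. ?a x + count_list [v, u] x)"
    by (rule critical_walk[OF E Suc, of u v]) (use a in \<open>auto simp: insert_commute\<close>)
  moreover have "(\<lambda>x. ?a x + count_list [v, u] x) = (\<lambda>x. a x + Suc j * (of_bool (x = u) + of_bool (x = v)))"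
    by (auto simp: fun_eq_iff)
  ultimately show ?case by metis
qed (use a in simp)

lemma edge_deg_sum: "finite I \<Longrightarrow> edge_deg (\<Sum>i\<in>I. f i) v = (\<Sum>i\<in>I. edge_deg (f i) v)"
  by (induction I rule: finite_induct) auto

lemma size_sum_mset_set: "finite I \<Longrightarrow> size (\<Sum>i\<in>I. f i :: 'a multiset) = (\<Sum>i\<in>I. size (f i))"
  by (induction I rule: finite_induct) auto

lemma set_mset_sum_subset: "finite I \<Longrightarrow> (\<And>i. i \<in> I \<Longrightarrow> set_mset (f i) \<subseteq> E) \<Longrightarrow> set_mset (\<Sum>i\<in>I. f i) \<subseteq> E"
  by (induction I rule: finite_induct) auto

lemma edge_deg_replicate: "edge_deg (replicate_mset n e) v = n * of_bool (v \<in> e)"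
  by (induction n) auto

lemma critical_sum_odd:
  fixes a :: "'v::finite \<Rightarrow> nat"
  assumes "\<forall>e \<in> E. card e = 2" "set_mset M \<subseteq> E" "\<forall>u. edge_deg M u + of_bool (u = w) = a u"
  shows "sum a UNIV = 2 * size M + 1"
proof -
  have a: "a = (\<lambda>u. edge_deg M u + of_bool (u = w))" using assms(3) by auto
  have "sum (edge_deg M) UNIV = 2 * size M" using assms by (intro sum_edge_deg) auto
  moreover have "(\<Sum>u\<in>UNIV. of_bool (u = w)) = (1::nat)" by (simp add: of_bool_def)
  ultimately show ?thesis unfolding a by (simp only: sum.distrib)
qed

lemma critical_odd:
  fixes a :: "'v::finite \<Rightarrow> nat"
  assumes "\<forall>e \<in> E. card e = 2" "critical E a" "a w > 0"
  shows "\<exists>s. sum a UNIV = 2 * s + 1"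
proof -
  obtain M where "set_mset M \<subseteq> E" "\<forall>u. edge_deg M u + of_bool (u = w) = a u"
    using assms(2)[unfolded critical_def, rule_format, OF assms(3)] by blast
  from critical_sum_odd[OF assms(1) this] show ?thesis by blast
qed

text \<open>The bound on \<open>nu_star\<close> only gives a total of at most \<open>m\<close>, but
  later the largest matching has to have size exactly \<open>m\<close>. The difference
  \<open>j\<close> is made up at an edge of one component \<open>C1\<close>.\<close>

lemma component_duplications:
  fixes H :: "'v::finite graph"
  assumes H: "simple_graph H" "verts H \<noteq> {}" "\<forall>C \<in> components H. has_odd_cycle C"
    and nu: "nu_star H \<le> real m"
  shows "\<exists>f s. (\<forall>C \<in> components H. critical (edges C) (f C) \<and> (\<forall>v. f C v > 0 \<longleftrightarrow> v \<in> verts C) \<and>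
    sum (f C) UNIV = 2 * s C + 1) \<and> (\<Sum>C \<in> components H. s C) = m"
proof -
  let ?K = "components H"
  have fin: "finite ?K" by (rule finite_components) (use H(1) in \<open>simp add: simple_graph_def\<close>)
  have E: "\<forall>e \<in> edges C. card e = 2" if "C \<in> ?K" for C
    using component_subgraph(1)[OF H(1) that] by (simp add: simple_graph_def)
  have ne: "verts C \<noteq> {}" if "C \<in> ?K" for C
    using component_connected[OF H(1) that] by (simp add: connected_graph_def)
  have "\<forall>C \<in> ?K. \<exists>a. critical (edges C) a \<and> (\<forall>v. a v > 0 \<longleftrightarrow> v \<in> verts C) \<and>
    sum a UNIV \<le> card (verts C) + ear_phi_conn C + card {e. is_bridge C e}"
    using critical_upper_bound component_subgraph(1)[OF H(1)] component_connected[OF H(1)] H(3) by blast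
  from bchoice[OF this] obtain g where g: "\<forall>C \<in> ?K. critical (edges C) (g C) \<and> (\<forall>v. g C v > 0 \<longleftrightarrow> v \<in> verts C) \<and>
    sum (g C) UNIV \<le> card (verts C) + ear_phi_conn C + card {e. is_bridge C e}" by blast
  have "\<exists>s. sum (g C) UNIV = 2 * s + 1" if C: "C \<in> ?K" for C
  proof -
    obtain w where "w \<in> verts C" using ne[OF C] by blast
    then have "g C w > 0" using g C by blast
    then show ?thesis using critical_odd[OF E[OF C]] g C by blast
  qed
  then have "\<forall>C \<in> ?K. \<exists>s. sum (g C) UNIV = 2 * s + 1" by blast
  from bchoice[OF this] obtain s where s: "\<forall>C \<in> ?K. sum (g C) UNIV = 2 * s C + 1" by blast
  have "real (2 * (\<Sum>C\<in>?K. s C)) = (\<Sum>C\<in>?K. real (2 * s C))"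
    by (simp add: sum_distrib_left)
  also have "\<dots> \<le> (\<Sum>C\<in>?K. real (card (verts C) + ear_phi_conn C + card {e. is_bridge C e}) - 1)"
  proof (rule sum_mono)
    fix C assume C: "C \<in> ?K"
    then have "2 * s C + 1 \<le> card (verts C) + ear_phi_conn C + card {e. is_bridge C e}"
      using g s by (metis (no_types, lifting))
    then show "real (2 * s C) \<le> real (card (verts C) + ear_phi_conn C + card {e. is_bridge C e}) - 1"
      by linarith
  qed
  also have "\<dots> = 2 * nu_star H" by (simp add: nu_star_components[OF H(1)])
  finally have le: "(\<Sum>C\<in>?K. s C) \<le> m" using nu by linarith
  define j where "j = m - (\<Sum>C\<in>?K. s C)"
  obtain C1 where C1: "C1 \<in> ?K" using H(2) Union_components[of H] by blast
  obtain e where e: "e \<in> edges C1"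
    using odd_cycle_not_bicolored[of C1] H(3) C1 by blast
  then obtain u v where uv: "e = {u, v}" "u \<noteq> v" using E[OF C1] by (meson card_2_iff)
  have uvC: "u \<in> verts C1" "v \<in> verts C1"
    using e uv component_subgraph(1)[OF H(1) C1] by (auto simp: simple_graph_def)
  then have pos: "g C1 u > 0" "g C1 v > 0" using g C1 by blast+
  define a where "a = (\<lambda>x. g C1 x + j * (of_bool (x = u) + of_bool (x = v)))"
  have "critical (edges C1) a"
    unfolding a_def by (rule critical_add_edges[OF E[OF C1]]) (use g C1 e uv pos in auto)
  moreover have "\<forall>x. a x > 0 \<longleftrightarrow> x \<in> verts C1"
  proof
    fix x
    have "g C1 x > 0 \<longleftrightarrow> x \<in> verts C1" using g C1 by blast
    then show "a x > 0 \<longleftrightarrow> x \<in> verts C1" using uvC by (auto simp: a_def)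
  qed
  moreover have "sum a UNIV = 2 * (s C1 + j) + 1"
  proof -
    have "(\<Sum>x\<in>UNIV. of_bool (x = t)) = (1::nat)" for t :: 'v by (simp add: of_bool_def)
    then have "sum a UNIV = sum (g C1) UNIV + j * 2"
      unfolding a_def by (simp only: sum.distrib sum_distrib_left[symmetric] one_add_one)
    then show ?thesis using s C1 by simp
  qed
  moreover have "(\<Sum>C\<in>?K. (s(C1 := s C1 + j)) C) = m"
  proof -
    have "(\<Sum>C\<in>?K. (s(C1 := s C1 + j)) C) = (s C1 + j) + (\<Sum>C\<in>?K - {C1}. s C)"
      using fin C1 by (subst sum.remove[of _ C1]) (auto intro: sum.cong)
    also have "\<dots> = (\<Sum>C\<in>?K. s C) + j" using fin C1 by (subst (2) sum.remove[of _ C1]) auto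
    finally show ?thesis using le by (simp add: j_def)
  qed
  ultimately show ?thesis
    using g s by (intro exI[of _ "g(C1 := a)"] exI[of _ "s(C1 := s C1 + j)"]) auto
qed

text \<open>Any number \<open>d\<close> of copies may be added outside \<open>U\<close>: there the variables become invertible.\<close>

lemma matching_of_dominant_star_nonempty:
  fixes G :: "'v::finite graph"
  assumes G: "simple_graph G" "verts G = UNIV"
    and W: "W \<in> dominant_star_sets G U" "nu_star (induced G W) \<le> real m" "W \<noteq> {}"
  shows "\<exists>c. (\<forall>d M. (\<forall>v \<in> U. d v = 0) \<longrightarrow> matching (edges G) (\<lambda>v. c v + d v) M \<longrightarrow> size M \<le> m) \<and>
    (\<forall>i \<in> U. \<exists>M. matching (edges G) (\<lambda>v. c v + of_bool (v = i)) M \<and> size M = m + 1)"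
proof -
  let ?E = "edges G" and ?H = "induced G W" and ?K = "components (induced G W)"
  have D: "W \<subseteq> U" "indep_set G (UNIV - U)" "W \<inter> nbhd G (UNIV - U) = {}"
    "UNIV = nbhd G W \<union> nbhd G (UNIV - U) \<union> (UNIV - U)" "\<forall>C \<in> ?K. has_odd_cycle C"
    using W(1) G(2)
    by (auto simp: dominant_star_sets_def dominant_star_def dominant_def Let_def split: if_splits)
  have E: "\<forall>e \<in> ?E. card e = 2" using G by (simp add: simple_graph_def)
  have H: "simple_graph ?H" by (rule induced_simple[OF G(1)])
  have vH: "verts ?H = W" and eH: "edges ?H = {e \<in> ?E. e \<subseteq> W}" using G(2) by (auto simp: induced_def)
  have fin: "finite ?K" by (rule finite_components) simp
  note sub = component_subgraph[OF H]
  obtain f s where f: "\<forall>C \<in> ?K. critical (edges C) (f C) \<and> (\<forall>v. f C v > 0 \<longleftrightarrow> v \<in> verts C) \<and>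
    sum (f C) UNIV = 2 * s C + 1" and sm: "(\<Sum>C \<in> ?K. s C) = m"
    using component_duplications[OF H _ D(5) W(2)] vH W(3) by blast
  define a where "a = (\<lambda>v. \<Sum>C\<in>?K. f C v)"
  have f0: "f C v = 0" if "C \<in> ?K" "v \<notin> verts C" for C v using f that by blast
  have aC: "a v = f C v" if C: "C \<in> ?K" "v \<in> verts C" for C v
  proof -
    have "f C' v = 0" if "C' \<in> ?K - {C}" for C'
      using components_disjoint[of C ?H C'] that C f0[of C' v] by blast
    then show ?thesis unfolding a_def using fin C(1) by (subst sum.remove[of _ C]) auto
  qed
  have aW: "a v = 0" if "v \<notin> W" for v
  proof -
    have "f C v = 0" if "C \<in> ?K" for C using f0[OF that] sub(2)[OF that] vH \<open>v \<notin> W\<close> by blast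
    then show ?thesis by (simp add: a_def)
  qed
  \<comment> \<open>In the component of \<open>w\<close> the copy deleted is one of
    \<open>w\<close>, in the others any copy; the matchings of the components are then
    united.\<close>
  have miss: "\<exists>M. matching ?E a M \<and> size M = m \<and> edge_deg M w < a w" if w: "w \<in> W" for w
  proof -
    have "\<forall>C \<in> ?K. \<exists>M. set_mset M \<subseteq> ?E \<and> size M = s C \<and> (\<forall>v. edge_deg M v \<le> f C v) \<and>
      (w \<in> verts C \<longrightarrow> edge_deg M w < f C w)"
    proof
      fix C assume C: "C \<in> ?K"
      obtain w' where w': "w' \<in> verts C" "w \<in> verts C \<longrightarrow> w' = w"
        using component_connected[OF H C] by (cases "w \<in> verts C") (auto simp: connected_graph_def)
      then have "f C w' > 0" using f C by blast
      then obtain M where M: "set_mset M \<subseteq> edges C" "\<forall>u. edge_deg M u + of_bool (u = w') = f C u"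
        using f C unfolding critical_def by blast
      have EC: "\<forall>e \<in> edges C. card e = 2" using sub(1)[OF C] by (simp add: simple_graph_def)
      have "2 * size M + 1 = 2 * s C + 1" using critical_sum_odd[OF EC M] f C by simp
      moreover have "edge_deg M v \<le> f C v" for v using M(2)[rule_format, of v] by simp
      moreover have "w \<in> verts C \<longrightarrow> edge_deg M w < f C w" using M(2)[rule_format, of w] w'(2) by auto
      moreover have "set_mset M \<subseteq> ?E" using M(1) sub(3)[OF C] eH by auto
      ultimately show "\<exists>M. set_mset M \<subseteq> ?E \<and> size M = s C \<and> (\<forall>v. edge_deg M v \<le> f C v) \<and>
        (w \<in> verts C \<longrightarrow> edge_deg M w < f C w)" by auto
    qed
    from bchoice[OF this] obtain N where N: "\<forall>C \<in> ?K. set_mset (N C) \<subseteq> ?E \<and> size (N C) = s C \<and>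
      (\<forall>v. edge_deg (N C) v \<le> f C v) \<and> (w \<in> verts C \<longrightarrow> edge_deg (N C) w < f C w)" by blast
    define M where "M = (\<Sum>C\<in>?K. N C)"
    have "set_mset M \<subseteq> ?E" unfolding M_def by (rule set_mset_sum_subset[OF fin]) (use N in blast)
    moreover have "edge_deg M v \<le> a v" for v
      unfolding M_def edge_deg_sum[OF fin] a_def by (rule sum_mono) (use N in blast)
    moreover have "size M = m"
      unfolding M_def size_sum_mset_set[OF fin] sm[symmetric] by (rule sum.cong) (use N in auto)
    moreover have "edge_deg M w < a w"
    proof -
      obtain C where C: "C \<in> ?K" "w \<in> verts C" using Union_components[of ?H] vH w by blast
      show ?thesis unfolding M_def edge_deg_sum[OF fin] a_def
        by (rule sum_strict_mono_ex1[OF fin]) (use N C in blast)+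
    qed
    ultimately show ?thesis by (auto simp: matching_def)
  qed
  have small: "size M \<le> m" if d: "\<forall>v \<in> U. d v = 0" and M: "matching ?E (\<lambda>v. a v + d v) M" for d M
  proof -
    have dM: "edge_deg M v \<le> a v + d v" for v using M by (simp add: matching_def)
    \<comment> \<open>Both ends of a used edge have copies, so each lies in \<open>W\<close> or
      outside \<open>U\<close>. The complement of \<open>U\<close> is independent and has no
      neighbour in \<open>W\<close>, so both ends lie in \<open>W\<close>.\<close>
    have inW: "e \<in> edges ?H" if e: "e \<in># M" for e
    proof -
      have eE: "e \<in> ?E" using e M by (auto simp: matching_def)
      have pos: "v \<in> W \<or> v \<notin> U" if v: "v \<in> e" for v
      proof (rule ccontr)
        assume "\<not> ?thesis"
        then have "edge_deg M v = 0" using dM[of v] aW[of v] d by auto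
        moreover have "edge_deg (M - {#e#}) v + of_bool (v \<in> e) = edge_deg M v" by (rule edge_deg_remove[OF e])
        ultimately show False using v by simp
      qed
      obtain x y where xy: "e = {x, y}" using eE E by (meson card_2_iff)
      have adj: "adj G x y" "adj G y x" using eE xy by (auto simp: adj_def insert_commute)
      have nz: "\<not> (x \<notin> U \<and> y \<notin> U)" using D(2) adj by (auto simp: indep_set_def)
      have "\<not> (x \<in> W \<and> y \<notin> U)" "\<not> (y \<in> W \<and> x \<notin> U)"
        using D(3) adj G(2) by (auto simp: nbhd_def)
      then have "x \<in> W" "y \<in> W" using pos[of x] pos[of y] nz xy by auto
      then show ?thesis using eH eE xy by simp
    qed
    have EM: "\<forall>e \<in># M. card e = 2" using M E by (auto simp: matching_def)
    \<comment> \<open>Parity decides: of the \<open>2 * s C + 1\<close> copies in \<open>C\<close> a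
      matching covers an even number.\<close>
    have even: "\<exists>t. sum (edge_deg M) (verts C) = 2 * t \<and> t \<le> s C" if C: "C \<in> ?K" for C
    proof -
      define N where "N = {#e \<in># M. e \<in> edges C#}"
      have sC: "simple_graph C" by (rule sub(1)[OF C])
      have dN: "edge_deg N v = (if v \<in> verts C then edge_deg M v else 0)" for v
      proof (cases "v \<in> verts C")
        case True
        have "e \<in> edges C" if "e \<in># M" "v \<in> e" for e
          using component_closed[OF H C inW[OF that(1)] that(2) True] .
        then have "{#e \<in># N. v \<in> e#} = {#e \<in># M. v \<in> e#}"
          unfolding N_def filter_filter_mset by (intro filter_mset_cong) auto
        then show ?thesis using True by (simp add: edge_deg_def)
      next
        case False
        have "v \<notin> e" if "e \<in> edges C" for e using that False sC by (auto simp: simple_graph_def)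
        then have "{#e \<in># N. v \<in> e#} = {#}" by (simp add: N_def filter_filter_mset)
        then show ?thesis using False by (simp add: edge_deg_def)
      qed
      have "2 * size N = sum (edge_deg N) UNIV"
        by (rule sum_edge_deg[symmetric]) (use EM in \<open>auto simp: N_def\<close>)
      also have "\<dots> = sum (edge_deg M) (verts C)" unfolding dN by (simp add: sum.If_cases)
      finally have 1: "sum (edge_deg M) (verts C) = 2 * size N" by simp
      have "sum (edge_deg M) (verts C) \<le> sum (f C) (verts C)"
      proof (rule sum_mono)
        fix v assume v: "v \<in> verts C"
        then have "v \<in> U" using sub(2)[OF C] vH D(1) by blast
        then show "edge_deg M v \<le> f C v" using dM[of v] d aC[OF C v] by simp
      qed
      also have "\<dots> \<le> sum (f C) UNIV" by (rule sum_mono2) auto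
      also have "\<dots> = 2 * s C + 1" using f C by blast
      finally show ?thesis using 1 by (intro exI[of _ "size N"]) simp
    qed
    have "2 * size M = sum (edge_deg M) UNIV" by (rule sum_edge_deg[OF EM, symmetric])
    also have "\<dots> = sum (edge_deg M) W"
    proof (rule sum.mono_neutral_right)
      show "\<forall>v \<in> UNIV - W. edge_deg M v = 0"
      proof
        fix v assume v: "v \<in> UNIV - W"
        have "{#e \<in># M. v \<in> e#} = {#}" using inW eH v by (auto simp: filter_mset_eq_conv)
        then show "edge_deg M v = 0" by (simp add: edge_deg_def)
      qed
    qed auto
    also have "\<dots> = (\<Sum>C\<in>?K. sum (edge_deg M) (verts C))" using sum_components[OF H, of "edge_deg M"] vH by simp
    also have "\<dots> \<le> (\<Sum>C\<in>?K. 2 * s C)" by (rule sum_mono) (use even in fastforce)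
    also have "\<dots> = 2 * m" by (simp add: sm flip: sum_distrib_left)
    finally show ?thesis by simp
  qed
  \<comment> \<open>One copy of each vertex outside \<open>U\<close> serves as partner for those
    \<open>i\<close> that have no neighbour in \<open>W\<close>. In the upper bound it is absorbed
    into \<open>d\<close>.\<close>
  define c where "c = (\<lambda>v. a v + of_bool (v \<notin> U))"
  have "size M \<le> m" if "\<forall>v \<in> U. d v = 0" "matching ?E (\<lambda>v. c v + d v) M" for d M
    using small[of "\<lambda>v. of_bool (v \<notin> U) + d v" M] that by (simp add: c_def add.assoc)
  moreover have "\<exists>M. matching ?E (\<lambda>v. c v + of_bool (v = i)) M \<and> size M = m + 1" if i: "i \<in> U" for i
  proof -
    have "\<exists>y M. {i, y} \<in> ?E \<and> matching ?E a M \<and> size M = m \<and> edge_deg M y < c y"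
    proof (cases "i \<in> nbhd G W")
      case True
      then obtain w where w: "w \<in> W" "{i, w} \<in> ?E" by (auto simp: nbhd_def adj_def insert_commute)
      obtain M where M: "matching ?E a M" "size M = m" "edge_deg M w < a w" using miss[OF w(1)] by blast
      then have "edge_deg M w < c w" by (simp add: c_def)
      then show ?thesis using M w by blast
    next
      case False
      then have "i \<in> nbhd G (UNIV - U)" using D(4) i by blast
      then obtain z where z: "z \<notin> U" "{i, z} \<in> ?E" by (auto simp: nbhd_def adj_def insert_commute)
      obtain w where "w \<in> W" using W(3) by blast
      then obtain M where M: "matching ?E a M" "size M = m" using miss by blast
      have "edge_deg M z \<le> a z" using M(1) by (simp add: matching_def)
      then have "edge_deg M z < c z" using z by (simp add: c_def)
      then show ?thesis using M z by blast
    qed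
    then obtain y M where y: "{i, y} \<in> ?E" "matching ?E a M" "size M = m" "edge_deg M y < c y" by blast
    have "i \<noteq> y" using E y(1) by force
    have "edge_deg (add_mset {i, y} M) v \<le> c v + of_bool (v = i)" for v
    proof -
      have "edge_deg M v \<le> c v" using y(2) by (simp add: matching_def c_def trans_le_add1)
      then show ?thesis using y(4) \<open>i \<noteq> y\<close> by (cases "v = i"; cases "v = y") auto
    qed
    then have "matching ?E (\<lambda>v. c v + of_bool (v = i)) (add_mset {i, y} M)"
      using y by (simp add: matching_def)
    then show ?thesis using y(3) by (intro exI[of _ "add_mset {i, y} M"]) simp
  qed
  ultimately show ?thesis by blast
qed

text \<open>There is no component to provide \<open>m\<close> edges, so \<open>m\<close> copies of
  an arbitrary \<open>x\<close> in \<open>U\<close> do: every usable edge contains \<open>x\<close>.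
  Outside \<open>U\<close> there are \<open>m + 1\<close> copies, because \<open>x\<close> and the
  added \<open>i\<close> may have to share a neighbour. If \<open>U\<close> is empty, the whole
  vertex set is independent and there are no edges.\<close>

lemma matching_of_dominant_star_empty:
  fixes G :: "'v::finite graph"
  assumes G: "simple_graph G" "verts G = UNIV" and W: "{} \<in> dominant_star_sets G U"
  shows "\<exists>c. (\<forall>d M. (\<forall>v \<in> U. d v = 0) \<longrightarrow> matching (edges G) (\<lambda>v. c v + d v) M \<longrightarrow> size M \<le> m) \<and>
    (\<forall>i \<in> U. \<exists>M. matching (edges G) (\<lambda>v. c v + of_bool (v = i)) M \<and> size M = m + 1)"
proof -
  let ?E = "edges G"
  have E: "\<forall>e \<in> ?E. card e = 2" using G by (simp add: simple_graph_def)
  have D: "indep_set G (UNIV - U)" "UNIV = nbhd G (UNIV - U) \<union> (UNIV - U)"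
    using W G(2)
    by (auto simp: dominant_star_sets_def dominant_star_def dominant_def Let_def nbhd_def split: if_splits)
  have nz: "\<exists>z. z \<notin> U \<and> {i, z} \<in> ?E" if "i \<in> U" for i
    using D(2) that by (fastforce simp: nbhd_def adj_def insert_commute)
  show ?thesis
  proof (cases "U = {}")
    case True
    then have "?E = {}" using D(1) E by (auto simp: indep_set_def adj_def card_2_iff)
    then have "size M \<le> m" if "matching ?E a M" for a M using that by (simp add: matching_def)
    then show ?thesis using True by blast
  next
    case False
    then obtain x where x: "x \<in> U" by blast
    define c where "c = (\<lambda>v. if v \<in> U then m * of_bool (v = x) else m + 1)"
    have "size M \<le> m" if d: "\<forall>v \<in> U. d v = 0" and M: "matching ?E (\<lambda>v. c v + d v) M" for d M
    proof -
      have dM: "edge_deg M v \<le> c v + d v" for v using M by (simp add: matching_def)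
      have "x \<in> e" if e: "e \<in># M" for e
      proof -
        have eE: "e \<in> ?E" using e M by (auto simp: matching_def)
        obtain u v where uv: "e = {u, v}" using eE E by (meson card_2_iff)
        have "adj G u v" using eE uv by (simp add: adj_def)
        then obtain t where t: "t \<in> e" "t \<in> U" using D(1) uv by (auto simp: indep_set_def)
        have "edge_deg M t > 0" using edge_deg_remove[OF e, of t] t(1) by simp
        then have "t = x" using dM[of t] d t(2) by (cases "t = x") (auto simp: c_def)
        then show ?thesis using t by simp
      qed
      then have "{#e \<in># M. x \<in> e#} = M" by (simp add: filter_mset_eq_conv)
      then have "size M = edge_deg M x" by (simp add: edge_deg_def)
      then show ?thesis using dM[of x] d x by (simp add: c_def)
    qed
    moreover have "\<exists>M. matching ?E (\<lambda>v. c v + of_bool (v = i)) M \<and> size M = m + 1" if i: "i \<in> U" for i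
    proof -
      obtain zx where zx: "zx \<notin> U" "{x, zx} \<in> ?E" using nz[OF x] by blast
      obtain zi where zi: "zi \<notin> U" "{i, zi} \<in> ?E" using nz[OF i] by blast
      define M where "M = add_mset {i, zi} (replicate_mset m {x, zx})"
      have "edge_deg M v \<le> c v + of_bool (v = i)" for v
        unfolding M_def edge_deg_add_mset edge_deg_replicate
        using zx zi x i by (cases "v \<in> U") (auto simp: c_def)
      moreover have "set_mset M \<subseteq> ?E" using zi zx by (auto simp: M_def in_replicate_mset)
      ultimately have "matching ?E (\<lambda>v. c v + of_bool (v = i)) M" by (simp add: matching_def)
      then show ?thesis by (intro exI[of _ M]) (simp add: M_def)
    qed
    ultimately show ?thesis by blast
  qed
qed

lemma matching_of_dominant_star:
  fixes G :: "'v::finite graph"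
  assumes "simple_graph G" "verts G = UNIV"
    and "W \<in> dominant_star_sets G U" "nu_star (induced G W) \<le> real m"
  shows "\<exists>c. (\<forall>d M. (\<forall>v \<in> U. d v = 0) \<longrightarrow> matching (edges G) (\<lambda>v. c v + d v) M \<longrightarrow> size M \<le> m) \<and>
    (\<forall>i \<in> U. \<exists>M. matching (edges G) (\<lambda>v. c v + of_bool (v = i)) M \<and> size M = m + 1)"
  using matching_of_dominant_star_nonempty[OF assms] matching_of_dominant_star_empty[OF assms(1,2)]
    assms(3) by (cases "W = {}") auto

subsection \<open>Monomial ideals\<close>

abbreviation lookup :: "('a, 'b::zero) poly_mapping \<Rightarrow> 'a \<Rightarrow> 'b" where
  "lookup \<equiv> Poly_Mapping.lookup"

abbreviation keys :: "('a, 'b::zero) poly_mapping \<Rightarrow> 'a set" where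
  "keys \<equiv> Poly_Mapping.keys"

lemma mvpoly_ring_simps [simp]:
  "carrier mvpoly_ring = UNIV" "f \<otimes>\<^bsub>mvpoly_ring\<^esub> g = f * g" "f \<oplus>\<^bsub>mvpoly_ring\<^esub> g = f + g"
  "\<zero>\<^bsub>mvpoly_ring\<^esub> = 0" "\<one>\<^bsub>mvpoly_ring\<^esub> = 1"
  by (simp_all add: mvpoly_ring_def ring_of_type_algebra_def)

lemma cring_mvpoly: "cring mvpoly_ring"
  unfolding mvpoly_ring_def by (rule cring_from_type_algebra)

lemma ring_mvpoly: "ring mvpoly_ring"
  using cring_mvpoly by (rule cring.axioms)

lemma mvpoly_a_inv [simp]: "\<ominus>\<^bsub>mvpoly_ring\<^esub> f = - f"
proof -
  interpret ring "mvpoly_ring :: ('a, 'b) mvpoly ring" by (rule ring_mvpoly)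
  show ?thesis by (rule minus_equality) auto
qed

lemma ideal_mvpolyD:
  assumes "ideal I mvpoly_ring"
  shows "0 \<in> I" "f \<in> I \<Longrightarrow> g \<in> I \<Longrightarrow> f + g \<in> I" "f \<in> I \<Longrightarrow> h * f \<in> I"
proof -
  interpret ideal I mvpoly_ring by (rule assms)
  show "0 \<in> I" using additive_subgroup.zero_closed[OF additive_subgroup_axioms] by simp
  show "f \<in> I \<Longrightarrow> g \<in> I \<Longrightarrow> f + g \<in> I" using additive_subgroup.a_closed[OF additive_subgroup_axioms, of f g] by simp
  show "f \<in> I \<Longrightarrow> h * f \<in> I" using I_l_closed[of f h] by simp
qed

text \<open>An ideal when \<open>\<Lambda>\<close> is closed upwards, namely the monomial ideal
  whose monomials have exponents in \<open>\<Lambda>\<close>.\<close>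

definition mon_ideal :: "('v, nat) poly_mapping set \<Rightarrow> ('v, 'k::field) mvpoly set" where
  "mon_ideal \<Lambda> = {f. keys f \<subseteq> \<Lambda>}"

definition up_closed :: "('v, nat) poly_mapping set \<Rightarrow> bool" where
  "up_closed \<Lambda> \<longleftrightarrow> (\<forall>c \<in> \<Lambda>. \<forall>d. c + d \<in> \<Lambda>)"

lemma up_closedD: "up_closed \<Lambda> \<Longrightarrow> c \<in> \<Lambda> \<Longrightarrow> c + d \<in> \<Lambda> \<and> d + c \<in> \<Lambda>"
  by (simp add: up_closed_def add.commute)

lemma ideal_mon_ideal:
  assumes "up_closed \<Lambda>"
  shows "ideal (mon_ideal \<Lambda> :: ('v, 'k::field) mvpoly set) mvpoly_ring"
proof (rule idealI[OF ring_mvpoly])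
  have mult: "f * g \<in> mon_ideal \<Lambda>" if "f \<in> mon_ideal \<Lambda>" for f g :: "('v, 'k) mvpoly"
    using keys_mult[of f g] that up_closedD[OF assms] by (fastforce simp: mon_ideal_def)
  then show "f \<otimes>\<^bsub>mvpoly_ring\<^esub> g \<in> mon_ideal \<Lambda>" "g \<otimes>\<^bsub>mvpoly_ring\<^esub> f \<in> mon_ideal \<Lambda>"
    if "f \<in> mon_ideal \<Lambda>" for f g :: "('v, 'k) mvpoly"
    using that by (simp_all add: mult.commute)
  show "subgroup (mon_ideal \<Lambda> :: ('v, 'k) mvpoly set) (add_monoid mvpoly_ring)"
  proof
    show "x \<otimes>\<^bsub>add_monoid mvpoly_ring\<^esub> y \<in> mon_ideal \<Lambda>"
      if "x \<in> mon_ideal \<Lambda>" "y \<in> mon_ideal \<Lambda>" for x y :: "('v, 'k) mvpoly"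
      using that Poly_Mapping.keys_add[of x y] by (auto simp: mon_ideal_def)
    show "inv\<^bsub>add_monoid mvpoly_ring\<^esub> x \<in> mon_ideal \<Lambda>"
      if "x \<in> mon_ideal \<Lambda>" for x :: "('v, 'k) mvpoly"
      using that mvpoly_a_inv[of x] unfolding a_inv_def by (simp add: mon_ideal_def)
  qed (auto simp: mon_ideal_def)
qed

lemma keys_remove_term:
  fixes f :: "('a, 'b::ab_group_add) poly_mapping"
  shows "keys (f - Poly_Mapping.single k (lookup f k)) = keys f - {k}"
  by (auto simp: in_keys_iff lookup_minus lookup_single when_def split: if_splits)

lemma poly_mapping_terms_induct:
  fixes f :: "('a, 'b::ab_group_add) poly_mapping"
  assumes "P 0" "\<And>f g. P f \<Longrightarrow> P g \<Longrightarrow> P (f + g)"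
    and "\<And>k a. k \<in> keys f \<Longrightarrow> P (Poly_Mapping.single k a)"
  shows "P f"
  using assms(3)
proof (induction "card (keys f)" arbitrary: f rule: less_induct)
  case less
  show ?case
  proof (cases "f = 0")
    case False
    then obtain k where k: "k \<in> keys f" by (meson keys_eq_empty equals0I)
    let ?t = "Poly_Mapping.single k (lookup f k)"
    have "card (keys (f - ?t)) < card (keys f)"
      unfolding keys_remove_term using k by (intro card_Diff1_less) auto
    then have "P (f - ?t)"
      by (rule less.hyps) (use less.prems in \<open>auto simp: keys_remove_term\<close>)
    then have "P (f - ?t + ?t)" using assms(2) less.prems[OF k] by blast
    then show ?thesis by simp
  qed (use assms(1) in simp)
qed

lemma monomials_in_ideal:
  fixes f :: "('v, 'k::field) mvpoly"
  assumes "ideal I mvpoly_ring" "\<forall>k \<in> keys f. Poly_Mapping.single k 1 \<in> I"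
  shows "f \<in> I"
proof (rule poly_mapping_terms_induct)
  fix k a assume "k \<in> keys f"
  then have "Poly_Mapping.single 0 a * Poly_Mapping.single k 1 \<in> I"
    using ideal_mvpolyD(3)[OF assms(1)] assms(2) by blast
  then show "Poly_Mapping.single k a \<in> I" by (simp add: mult_single)
qed (use ideal_mvpolyD[OF assms(1)] in auto)

lemma genideal_monomials:
  "genideal mvpoly_ring ((\<lambda>c. Poly_Mapping.single c 1) ` S) =
    (mon_ideal {c + d |c d. c \<in> S} :: ('v, 'k::field) mvpoly set)" (is "?L = ?R")
proof
  interpret ring "mvpoly_ring :: ('v, 'k) mvpoly ring" by (rule ring_mvpoly)
  have "up_closed {c + d |c d. c \<in> S}"
    unfolding up_closed_def by (auto simp: add.assoc) blast
  then have "ideal ?R mvpoly_ring" by (rule ideal_mon_ideal)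
  moreover have "(\<lambda>c. Poly_Mapping.single c 1) ` S \<subseteq> ?R"
  proof
    fix f :: "('v, 'k) mvpoly" assume "f \<in> (\<lambda>c. Poly_Mapping.single c 1) ` S"
    then obtain c where c: "c \<in> S" "f = Poly_Mapping.single c 1" by blast
    have "\<exists>c' d. c = c' + d \<and> c' \<in> S" using c(1) by (metis add.right_neutral)
    then show "f \<in> ?R" using c(2) by (auto simp: mon_ideal_def)
  qed
  ultimately show "?L \<subseteq> ?R" by (rule genideal_minimal)
  have L: "ideal ?L mvpoly_ring" by (rule genideal_ideal) simp
  show "?R \<subseteq> ?L"
  proof
    fix f :: "('v, 'k) mvpoly" assume f: "f \<in> ?R"
    show "f \<in> ?L"
    proof (rule monomials_in_ideal[OF L], rule ballI)
      fix k assume "k \<in> keys f"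
      then obtain c d where k: "k = c + d" "c \<in> S" using f by (auto simp: mon_ideal_def)
      have "Poly_Mapping.single c 1 \<in> ?L" using k genideal_self[of "(\<lambda>c. Poly_Mapping.single c 1) ` S"] by auto
      from ideal_mvpolyD(3)[OF L this, of "Poly_Mapping.single d 1"]
      show "Poly_Mapping.single k 1 \<in> ?L" by (simp add: mult_single k add.commute)
    qed
  qed
qed

lemma ideal_prod_mon_ideal:
  assumes "up_closed A" "up_closed B"
  shows "ideal_prod mvpoly_ring (mon_ideal A) (mon_ideal B) =
    (mon_ideal {a + b |a b. a \<in> A \<and> b \<in> B} :: ('v, 'k::field) mvpoly set)" (is "?L = ?R")
proof
  interpret ring "mvpoly_ring :: ('v, 'k) mvpoly ring" by (rule ring_mvpoly)
  show "?L \<subseteq> ?R"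
  proof
    fix f :: "('v, 'k) mvpoly" assume "f \<in> ?L"
    then show "f \<in> ?R"
    proof (induction rule: ideal_prod.induct)
      case (prod i j)
      then show ?case using keys_mult[of i j] by (fastforce simp: mon_ideal_def)
    next
      case (sum s1 s2)
      then show ?case using Poly_Mapping.keys_add[of s1 s2] by (auto simp: mon_ideal_def)
    qed
  qed
  have L: "ideal ?L mvpoly_ring"
    by (rule ideal_prod_is_ideal) (use assms in \<open>auto intro: ideal_mon_ideal\<close>)
  show "?R \<subseteq> ?L"
  proof
    fix f :: "('v, 'k) mvpoly" assume f: "f \<in> ?R"
    show "f \<in> ?L"
    proof (rule monomials_in_ideal[OF L], rule ballI)
      fix k assume "k \<in> keys f"
      then obtain a b where k: "k = a + b" "a \<in> A" "b \<in> B" using f by (auto simp: mon_ideal_def)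
      have "Poly_Mapping.single a 1 \<in> (mon_ideal A :: ('v, 'k) mvpoly set)"
        "Poly_Mapping.single b 1 \<in> (mon_ideal B :: ('v, 'k) mvpoly set)"
        using k by (auto simp: mon_ideal_def)
      from ideal_prod.prod[OF this, of mvpoly_ring]
      show "Poly_Mapping.single k 1 \<in> ?L" by (simp add: mult_single k)
    qed
  qed
qed

subsection \<open>Associated primes of monomial ideals\<close>

text \<open>A substitute for leading terms that needs no monomial order. If the exponent of some
  variable varies on \<open>A\<close> or on \<open>B\<close>, both sets are restricted to its
  maximal value: one of them shrinks, and a sum of two maximal elements arises only from maximal
  elements. If none varies, both sets are singletons.\<close>

lemma exists_unique_sum:
  fixes A B :: "('v, nat) poly_mapping set"
  assumes "finite A" "finite B" "A \<noteq> {}" "B \<noteq> {}"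
  shows "\<exists>s \<in> A. \<exists>t \<in> B. \<forall>s' \<in> A. \<forall>t' \<in> B. s' + t' = s + t \<longrightarrow> s' = s \<and> t' = t"
  using assms
proof (induction "card A + card B" arbitrary: A B rule: less_induct)
  case less
  show ?case
  proof (cases "\<exists>v. \<exists>x \<in> A \<union> B. \<exists>y. lookup x v \<noteq> lookup y v \<and> (x \<in> A \<and> y \<in> A \<or> x \<in> B \<and> y \<in> B)")
    case True
    then obtain v x y where v: "lookup x v \<noteq> lookup y v" "x \<in> A \<and> y \<in> A \<or> x \<in> B \<and> y \<in> B" by blast
    define top where "top = (\<lambda>S :: ('v, nat) poly_mapping set. {s \<in> S. \<forall>s' \<in> S. lookup s' v \<le> lookup s v})"
    have top: "top S \<noteq> {}" "finite (top S)" "card (top S) \<le> card S" if "finite S" "S \<noteq> {}" for S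
    proof -
      have m: "Max ((\<lambda>s. lookup s v) ` S) \<in> (\<lambda>s. lookup s v) ` S" using that by (intro Max_in) auto
      then obtain s where s: "s \<in> S" "lookup s v = Max ((\<lambda>s. lookup s v) ` S)" by (metis imageE)
      then have "s \<in> top S" using that by (auto simp: top_def)
      then show "top S \<noteq> {}" by blast
      show "finite (top S)" "card (top S) \<le> card S" using that by (auto simp: top_def intro: card_mono)
    qed
    have less_top: "card (top S) < card S" if "finite S" "x \<in> S" "y \<in> S" for S
    proof (rule psubset_card_mono[OF that(1)])
      have "\<not> (x \<in> top S \<and> y \<in> top S)" using v(1) by (auto simp: top_def dest: order.antisym)
      then show "top S \<subset> S" using that by (auto simp: top_def)
    qed
    have "card (top A) + card (top B) < card A + card B"
      using v(2) less_top[OF less.prems(1)] less_top[OF less.prems(2)]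
        top(3)[OF less.prems(1,3)] top(3)[OF less.prems(2,4)] by fastforce
    from less.hyps[OF this top(2)[OF less.prems(1,3)] top(2)[OF less.prems(2,4)]
        top(1)[OF less.prems(1,3)] top(1)[OF less.prems(2,4)]]
    obtain s t where st: "s \<in> top A" "t \<in> top B"
      "\<forall>s' \<in> top A. \<forall>t' \<in> top B. s' + t' = s + t \<longrightarrow> s' = s \<and> t' = t" by blast
    have "s' = s \<and> t' = t" if s': "s' \<in> A" "t' \<in> B" "s' + t' = s + t" for s' t'
    proof -
      have "lookup s' v + lookup t' v = lookup s v + lookup t v"
        using s'(3) by (metis lookup_add)
      moreover have "lookup s' v \<le> lookup s v" "lookup t' v \<le> lookup t v"
        using st(1,2) s' by (auto simp: top_def)
      ultimately have "lookup s' v = lookup s v" "lookup t' v = lookup t v" by linarith+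
      then have "s' \<in> top A" "t' \<in> top B" using st(1,2) s' by (auto simp: top_def)
      then show ?thesis using st(3) s'(3) by blast
    qed
    then show ?thesis using st(1,2) by (auto simp: top_def)
  next
    case False
    then have "x = y" if "x \<in> A \<and> y \<in> A \<or> x \<in> B \<and> y \<in> B" for x y
      using that by (intro poly_mapping_eqI) blast
    then show ?thesis using less.prems(3,4) by blast
  qed
qed

text \<open>The coefficient at \<open>s + t\<close> is a single product of nonzero coefficients, so
  nothing can cancel.\<close>

lemma keys_mult_unique:
  fixes f g :: "('v, 'k::field) mvpoly"
  assumes st: "s \<in> keys f" "t \<in> keys g"
    and uniq: "\<forall>s' \<in> keys f. \<forall>t' \<in> keys g. s' + t' = s + t \<longrightarrow> s' = s \<and> t' = t"
  shows "s + t \<in> keys (f * g)"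
proof -
  define f0 g0 where "f0 = Poly_Mapping.single s (lookup f s)" and "g0 = Poly_Mapping.single t (lookup g t)"
  have "f * g = f0 * g0 + (f0 * (g - g0) + (f - f0) * g)" by (simp add: algebra_simps)
  moreover have "s + t \<notin> keys (f0 * (g - g0))"
  proof
    assume "s + t \<in> keys (f0 * (g - g0))"
    then obtain s' t' where "s' \<in> keys f0" "t' \<in> keys (g - g0)" "s' + t' = s + t"
      using keys_mult[of f0 "g - g0"] by force
    then show False using uniq st unfolding f0_def g0_def keys_remove_term by (auto split: if_splits)
  qed
  moreover have "s + t \<notin> keys ((f - f0) * g)"
  proof
    assume "s + t \<in> keys ((f - f0) * g)"
    then obtain s' t' where "s' \<in> keys (f - f0)" "t' \<in> keys g" "s' + t' = s + t"
      using keys_mult[of "f - f0" g] by force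
    then show False using uniq st unfolding f0_def keys_remove_term by auto
  qed
  moreover have "lookup (f0 * g0) (s + t) = lookup f s * lookup g t"
    by (simp add: f0_def g0_def mult_single)
  ultimately show ?thesis
    using st by (simp add: in_keys_iff lookup_add)
qed

section \<open>Primes generated by variables and annihilators\<close>

definition var_exponents :: "'v set \<Rightarrow> ('v, nat) poly_mapping set" where
  "var_exponents U = {c. \<exists>v \<in> U. lookup c v > 0}"

lemma up_closed_var_exponents: "up_closed (var_exponents U)"
  by (auto simp: up_closed_def var_exponents_def lookup_add)

lemma exponent_split:
  fixes c :: "('v, nat) poly_mapping"
  assumes "lookup c v > 0"
  shows "c = Poly_Mapping.single v 1 + (c - Poly_Mapping.single v 1)"
  using assms by (intro poly_mapping_eqI) (auto simp: lookup_add lookup_minus lookup_single when_def)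

lemma var_prime_eq: "(var_prime U :: ('v, 'k::field) mvpoly set) = mon_ideal (var_exponents U)"
proof -
  have "mvvar ` U = (\<lambda>c. Poly_Mapping.single c (1::'k)) ` ((\<lambda>v. Poly_Mapping.single v 1) ` U)"
    unfolding mvvar_def by (simp add: image_image)
  moreover have "{c + d |c d. c \<in> (\<lambda>v. Poly_Mapping.single v (1::nat)) ` U} = var_exponents U"
  proof
    show "{c + d |c d. c \<in> (\<lambda>v. Poly_Mapping.single v (1::nat)) ` U} \<subseteq> var_exponents U"
      by (auto simp: var_exponents_def lookup_add lookup_single when_def)
    show "var_exponents U \<subseteq> {c + d |c d. c \<in> (\<lambda>v. Poly_Mapping.single v (1::nat)) ` U}"
    proof
      fix c assume "c \<in> var_exponents U"
      then obtain v where v: "v \<in> U" "lookup c v > 0" by (auto simp: var_exponents_def)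
      from v(1) exponent_split[OF v(2)]
      show "c \<in> {c + d |c d. c \<in> (\<lambda>v. Poly_Mapping.single v (1::nat)) ` U}" by blast
    qed
  qed
  ultimately show ?thesis unfolding var_prime_def by (simp only: genideal_monomials)
qed

lemma primeideal_var_prime: "primeideal (var_prime U :: ('v, 'k::field) mvpoly set) mvpoly_ring"
proof (rule primeidealI)
  let ?\<Lambda> = "var_exponents U"
  show "ideal (var_prime U :: ('v, 'k) mvpoly set) mvpoly_ring"
    unfolding var_prime_eq by (rule ideal_mon_ideal[OF up_closed_var_exponents])
  show "cring mvpoly_ring" by (rule cring_mvpoly)
  have "(1 :: ('v, 'k) mvpoly) \<notin> var_prime U"
    by (simp add: var_prime_eq mon_ideal_def var_exponents_def)
  then show "carrier mvpoly_ring \<noteq> (var_prime U :: ('v, 'k) mvpoly set)" by auto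
  fix f g :: "('v, 'k) mvpoly"
  assume fg: "f \<otimes>\<^bsub>mvpoly_ring\<^esub> g \<in> var_prime U"
  show "f \<in> var_prime U \<or> g \<in> var_prime U"
  proof (rule ccontr)
    assume "\<not> ?thesis"
    then have ne: "keys f - ?\<Lambda> \<noteq> {}" "keys g - ?\<Lambda> \<noteq> {}"
      by (auto simp: var_prime_eq mon_ideal_def)
    obtain s t where st: "s \<in> keys f - ?\<Lambda>" "t \<in> keys g - ?\<Lambda>"
      "\<forall>s' \<in> keys f - ?\<Lambda>. \<forall>t' \<in> keys g - ?\<Lambda>. s' + t' = s + t \<longrightarrow> s' = s \<and> t' = t"
      using exists_unique_sum[OF _ _ ne] by auto
    have nst: "s + t \<notin> ?\<Lambda>" using st(1,2) by (auto simp: var_exponents_def lookup_add)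
    \<comment> \<open>Uniqueness extends from the terms outside \<open>var_exponents U\<close> to
      all terms: if \<open>s'\<close> or \<open>t'\<close> lay in this up-closed set, so would
      \<open>s + t\<close>.\<close>
    have "s' = s \<and> t' = t"
      if "s' \<in> keys f" "t' \<in> keys g" "s' + t' = s + t" for s' t'
      using st(3) that up_closedD[OF up_closed_var_exponents] nst by (metis DiffI)
    then have "s + t \<in> keys (f * g)"
      using st(1,2) by (intro keys_mult_unique) auto
    then show False using fg nst by (auto simp: var_prime_eq mon_ideal_def)
  qed
qed

lemma associated_primes_alt:
  fixes J :: "('v, 'k::field) mvpoly set"
  assumes J: "ideal J mvpoly_ring"
  shows "associated_primes mvpoly_ring J =
    {P. primeideal P mvpoly_ring \<and> (\<exists>g. P = {r. r * g \<in> J})}"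
proof -
  interpret ideal J "mvpoly_ring :: ('v, 'k) mvpoly ring" by (rule J)
  have coset: "J +>\<^bsub>mvpoly_ring\<^esub> x = J \<longleftrightarrow> x \<in> J" for x
    using a_coset_join1[of J x] a_coset_join2[of x J] a_subgroup by auto
  have carr: "carrier (mvpoly_ring Quot J) = range (\<lambda>g. J +>\<^bsub>mvpoly_ring\<^esub> g)"
    by (auto simp: FactRing_simps a_r_coset_def)
  have mult: "(J +>\<^bsub>mvpoly_ring\<^esub> r) \<otimes>\<^bsub>mvpoly_ring Quot J\<^esub> (J +>\<^bsub>mvpoly_ring\<^esub> g) =
      J +>\<^bsub>mvpoly_ring\<^esub> (r * g)" for r g
    using rcoset_mult_add[of r g] by (simp add: FactRing_def)
  have zero: "\<zero>\<^bsub>mvpoly_ring Quot J\<^esub> = J" by (simp add: FactRing_def)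
  show ?thesis
    unfolding associated_primes_def carr by (simp add: mult zero coset)
qed

lemma primeideal_mvpolyD:
  assumes "primeideal P mvpoly_ring"
  shows "ideal P mvpoly_ring" "f * g \<in> P \<Longrightarrow> f \<in> P \<or> g \<in> P" "1 \<notin> P"
proof -
  interpret primeideal P mvpoly_ring by (rule assms)
  show i: "ideal P mvpoly_ring" by (rule is_ideal)
  show "f * g \<in> P \<Longrightarrow> f \<in> P \<or> g \<in> P" using I_prime[of f g] by simp
  show "1 \<notin> P"
  proof
    assume "1 \<in> P"
    then have "f \<in> P" for f using ideal_mvpolyD(3)[OF i, of 1 f] by simp
    then show False using I_notcarr by auto
  qed
qed

lemma monomial_in_prime:
  fixes P :: "('v, 'k::field) mvpoly set"
  assumes P: "primeideal P mvpoly_ring"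
  shows "Poly_Mapping.single k 1 \<in> P \<longleftrightarrow> k \<in> var_exponents {v. mvvar v \<in> P}"
proof
  show "Poly_Mapping.single k 1 \<in> P" if k: "k \<in> var_exponents {v. mvvar v \<in> P}"
  proof -
    obtain v where v: "mvvar v \<in> P" "lookup k v > 0" using k by (auto simp: var_exponents_def)
    have "Poly_Mapping.single (k - Poly_Mapping.single v 1) 1 * mvvar v \<in> P"
      by (rule ideal_mvpolyD(3)[OF primeideal_mvpolyD(1)[OF P] v(1)])
    then show ?thesis using exponent_split[OF v(2)] by (simp add: mvvar_def mult_single add.commute)
  qed
  show "Poly_Mapping.single k 1 \<in> P \<Longrightarrow> k \<in> var_exponents {v. mvvar v \<in> P}"
  proof (induction "sum (lookup k) (keys k)" arbitrary: k rule: less_induct)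
    case less
    have "k \<noteq> 0" using less.prems primeideal_mvpolyD(3)[OF P] by auto
    then obtain v where v: "v \<in> keys k" by (meson keys_eq_empty equals0I)
    then have kv: "lookup k v > 0" by (simp add: in_keys_iff)
    let ?k = "k - Poly_Mapping.single v 1"
    have "mvvar v * Poly_Mapping.single ?k 1 \<in> P"
      using less.prems exponent_split[OF kv] by (simp add: mvvar_def mult_single)
    then consider "mvvar v \<in> P" | "Poly_Mapping.single ?k 1 \<in> P" using primeideal_mvpolyD(2)[OF P] by blast
    then show ?case
    proof cases
      case 1
      then show ?thesis using kv by (auto simp: var_exponents_def)
    next
      case 2
      have sub: "keys ?k \<subseteq> keys k"
        by (auto simp: in_keys_iff lookup_minus)
      have "sum (lookup ?k) (keys ?k) \<le> sum (lookup ?k) (keys k)"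
        by (rule sum_mono2) (use sub in auto)
      also have "\<dots> < sum (lookup k) (keys k)"
        by (rule sum_strict_mono_ex1)
          (use v kv in \<open>auto simp: lookup_minus lookup_single when_def intro!: bexI[of _ v]\<close>)
      finally have "?k \<in> var_exponents {v. mvvar v \<in> P}" using less.hyps 2 by blast
      then show ?thesis
        using up_closedD[OF up_closed_var_exponents] exponent_split[OF kv] by metis
    qed
  qed
qed

lemma keys_single_mult:
  "keys (Poly_Mapping.single c 1 * f) = (+) c ` keys (f :: ('v, 'k::field) mvpoly)"
proof
  show "keys (Poly_Mapping.single c 1 * f) \<subseteq> (+) c ` keys f"
    using keys_mult[of "Poly_Mapping.single c 1" f] by (auto split: if_splits)
  show "(+) c ` keys f \<subseteq> keys (Poly_Mapping.single c 1 * f)"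
    by (auto intro!: keys_mult_unique split: if_splits)
qed

text \<open>
  An associated prime is the annihilator of some \<open>g\<close> with the least number of terms outside the
  monomial ideal. Each of these terms then has the same annihilator.
\<close>

lemma associated_primes_mon_ideal_aux:
  fixes P :: "('v, 'k::field) mvpoly set"
  assumes up: "up_closed \<Lambda>" and P: "primeideal P mvpoly_ring" and g0: "P = {r. r * g0 \<in> mon_ideal \<Lambda>}"
  shows "\<exists>c U. P = var_prime U \<and> (\<forall>v \<in> U. c + Poly_Mapping.single v 1 \<in> \<Lambda>) \<and>
    (\<forall>d. (\<forall>v \<in> U. lookup d v = 0) \<longrightarrow> c + d \<notin> \<Lambda>)"
proof -
  let ?J = "mon_ideal \<Lambda> :: ('v, 'k) mvpoly set" and ?U = "{v. mvvar v \<in> P}"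
  let ?T = "\<lambda>g :: ('v, 'k) mvpoly. keys g - \<Lambda>"
  obtain g where g: "P = {r. r * g \<in> ?J}"
    and least: "\<And>g'. P = {r. r * g' \<in> ?J} \<Longrightarrow> card (?T g) \<le> card (?T g')"
    using ex_has_least_nat[of "\<lambda>g. P = {r. r * g \<in> ?J}" g0 "\<lambda>g. card (?T g)"] g0 by blast
  have mono: "Poly_Mapping.single k 1 \<in> P \<longleftrightarrow> k \<in> var_exponents ?U" for k
    by (rule monomial_in_prime[OF P])
  have in_P: "k + t \<in> \<Lambda>" if "k \<in> var_exponents ?U" "t \<in> keys g" for k t
  proof -
    have "Poly_Mapping.single k 1 * g \<in> ?J" using mono[of k] that(1) g by blast
    then show ?thesis using that(2) by (auto simp: mon_ideal_def keys_single_mult)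
  qed
  have notin_P: "k + t \<notin> \<Lambda>" if k: "k \<notin> var_exponents ?U" and t: "t \<in> ?T g" for k t
  proof
    assume kt: "k + t \<in> \<Lambda>"
    \<comment> \<open>Multiplication by a monomial outside the prime \<open>P\<close> does not
      change the annihilator, but it moves the term \<open>t\<close> into \<open>\<Lambda>\<close>.
      This contradicts the choice of \<open>g\<close>.\<close>
    define g' where "g' = Poly_Mapping.single k 1 * g"
    have "r * g' \<in> ?J \<longleftrightarrow> r \<in> P" for r
    proof -
      have "r * g' = (r * Poly_Mapping.single k 1) * g" by (simp add: g'_def mult.assoc)
      then have "r * g' \<in> ?J \<longleftrightarrow> r * Poly_Mapping.single k 1 \<in> P" using g by auto
      also have "\<dots> \<longleftrightarrow> r \<in> P"
        using primeideal_mvpolyD(2)[OF P] ideal_mvpolyD(3)[OF primeideal_mvpolyD(1)[OF P]] mono k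
        by (metis mult.commute)
      finally show ?thesis .
    qed
    then have "card (?T g) \<le> card (?T g')" by (intro least) auto
    also have "card (?T g') \<le> card ((+) k ` (?T g - {t}))"
    proof (rule card_mono)
      show "?T g' \<subseteq> (+) k ` (?T g - {t})"
        unfolding g'_def keys_single_mult using kt up_closedD[OF up] by auto
    qed simp
    also have "\<dots> \<le> card (?T g - {t})" by (rule card_image_le) simp
    also have "\<dots> < card (?T g)" using t by (intro psubset_card_mono) auto
    finally show False by simp
  qed
  have "g \<notin> ?J" using g primeideal_mvpolyD(3)[OF P] by auto
  then obtain c where c: "c \<in> ?T g" by (auto simp: mon_ideal_def)
  have "P = var_prime ?U"
  proof
    show "var_prime ?U \<subseteq> P"
      using monomials_in_ideal[OF primeideal_mvpolyD(1)[OF P]] mono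
      by (auto simp: var_prime_eq mon_ideal_def)
    show "P \<subseteq> var_prime ?U"
    proof
      fix r assume r: "r \<in> P"
      show "r \<in> var_prime ?U"
      proof (rule ccontr)
        assume "r \<notin> var_prime ?U"
        then have ne: "keys r - var_exponents ?U \<noteq> {}" by (auto simp: var_prime_eq mon_ideal_def)
        obtain s t where st: "s \<in> keys r - var_exponents ?U" "t \<in> ?T g"
          "\<forall>s' \<in> keys r - var_exponents ?U. \<forall>t' \<in> ?T g. s' + t' = s + t \<longrightarrow> s' = s \<and> t' = t"
          using exists_unique_sum[OF _ _ ne, of "?T g"] c by auto
        have nst: "s + t \<notin> \<Lambda>" using notin_P st by blast
        have "s' = s \<and> t' = t"
          if "s' \<in> keys r" "t' \<in> keys g" "s' + t' = s + t" for s' t'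
          using st(3) that up_closedD[OF up] nst in_P by (metis DiffI)
        then have "s + t \<in> keys (r * g)"
          using st(1,2) by (intro keys_mult_unique) auto
        moreover have "r * g \<in> ?J" using r g by blast
        ultimately show False using nst by (auto simp: mon_ideal_def)
      qed
    qed
  qed
  moreover have "c + Poly_Mapping.single v 1 \<in> \<Lambda>" if "v \<in> ?U" for v
    using in_P[of "Poly_Mapping.single v 1" c] c that by (auto simp: var_exponents_def lookup_single when_def add.commute)
  moreover have "c + d \<notin> \<Lambda>" if "\<forall>v \<in> ?U. lookup d v = 0" for d
    using notin_P[of d c] c that by (auto simp: var_exponents_def add.commute)
  ultimately show ?thesis by blast
qed

text \<open>The two conditions on \<open>c\<close> say that \<open>c + k\<close> lies in
  \<open>\<Lambda>\<close> exactly for \<open>k\<close> in \<open>var_exponents U\<close>, that is,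
  the monomial with exponent \<open>c\<close> has the annihilator
  \<open>var_prime U\<close>.\<close>

lemma associated_primes_mon_ideal:
  assumes up: "up_closed \<Lambda>"
  shows "associated_primes mvpoly_ring (mon_ideal \<Lambda> :: ('v, 'k::field) mvpoly set) =
    {var_prime U |U. \<exists>c. (\<forall>v \<in> U. c + Poly_Mapping.single v 1 \<in> \<Lambda>) \<and>
      (\<forall>d. (\<forall>v \<in> U. lookup d v = 0) \<longrightarrow> c + d \<notin> \<Lambda>)}" (is "?L = ?R")
proof
  let ?J = "mon_ideal \<Lambda> :: ('v, 'k) mvpoly set"
  note alt = associated_primes_alt[OF ideal_mon_ideal[OF up]]
  show "?L \<subseteq> ?R"
    unfolding alt using associated_primes_mon_ideal_aux[OF up] by fast
  show "?R \<subseteq> ?L"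
  proof
    fix P :: "('v, 'k) mvpoly set" assume "P \<in> ?R"
    then obtain U c where P: "P = var_prime U" and c: "\<forall>v \<in> U. c + Poly_Mapping.single v 1 \<in> \<Lambda>"
      "\<forall>d. (\<forall>v \<in> U. lookup d v = 0) \<longrightarrow> c + d \<notin> \<Lambda>" by blast
    have key: "c + k \<in> \<Lambda> \<longleftrightarrow> k \<in> var_exponents U" for k
    proof
      assume "c + k \<in> \<Lambda>"
      then show "k \<in> var_exponents U" using c(2) by (auto simp: var_exponents_def)
    next
      assume "k \<in> var_exponents U"
      then obtain v where v: "v \<in> U" "lookup k v > 0" by (auto simp: var_exponents_def)
      have "(c + Poly_Mapping.single v 1) + (k - Poly_Mapping.single v 1) \<in> \<Lambda>"
        using up_closedD[OF up] c(1) v(1) by blast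
      then show "c + k \<in> \<Lambda>" using exponent_split[OF v(2)] by (simp add: add.assoc)
    qed
    have "r * Poly_Mapping.single c 1 \<in> ?J \<longleftrightarrow> r \<in> var_prime U" for r :: "('v, 'k) mvpoly"
      using key by (auto simp: mult.commute[of r] mon_ideal_def keys_single_mult var_prime_eq)
    then have "P = {r. r * Poly_Mapping.single c 1 \<in> ?J}" using P by auto
    moreover have "primeideal P mvpoly_ring" unfolding P by (rule primeideal_var_prime)
    ultimately show "P \<in> ?L" unfolding alt by blast
  qed
qed

subsection \<open>Powers of edge ideals\<close>

definition matching_exponents :: "'v set set \<Rightarrow> nat \<Rightarrow> ('v, nat) poly_mapping set" where
  "matching_exponents E k = {c. \<exists>M. matching E (lookup c) M \<and> size M = k}"

lemma up_closed_matching_exponents: "up_closed (matching_exponents E k)"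
  unfolding up_closed_def matching_exponents_def matching_def
  by (auto simp: lookup_add) (metis trans_le_add1)

lemma edge_ideal_eq:
  fixes G :: "'v::finite graph"
  assumes "\<forall>e \<in> edges G. card e = 2"
  shows "edge_ideal G = (mon_ideal (matching_exponents (edges G) 1) :: ('v, 'k::field) mvpoly set)"
proof -
  let ?S = "{Poly_Mapping.single i 1 + Poly_Mapping.single j 1 |i j. {i, j} \<in> edges G} :: ('v, nat) poly_mapping set"
  have gens: "{mvvar i * mvvar j |i j. {i, j} \<in> edges G} = (\<lambda>c. Poly_Mapping.single c (1::'k)) ` ?S"
    unfolding mvvar_def by (auto simp: mult_single image_iff)
  have "{c + d |c d. c \<in> ?S} = matching_exponents (edges G) 1"
  proof
    show "{c + d |c d. c \<in> ?S} \<subseteq> matching_exponents (edges G) 1"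
    proof
      fix c assume "c \<in> {c + d |c d. c \<in> ?S}"
      then obtain i j d where c: "c = Poly_Mapping.single i 1 + Poly_Mapping.single j 1 + d" "{i, j} \<in> edges G" by blast
      have "matching (edges G) (lookup c) {#{i, j}#}"
        using c by (auto simp: matching_def lookup_add lookup_single when_def)
      then show "c \<in> matching_exponents (edges G) 1"
        unfolding matching_exponents_def by (intro CollectI exI[of _ "{#{i, j}#}"]) simp
    qed
    show "matching_exponents (edges G) 1 \<subseteq> {c + d |c d. c \<in> ?S}"
    proof
      fix c assume "c \<in> matching_exponents (edges G) 1"
      then obtain M where M: "matching (edges G) (lookup c) M" "size M = 1" by (auto simp: matching_exponents_def)
      then obtain e where e: "M = {#e#}" by (metis size_1_singleton_mset)
      then have eE: "e \<in> edges G" using M(1) by (auto simp: matching_def)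
      then obtain i j where ij: "e = {i, j}" "i \<noteq> j" using assms by (meson card_2_iff)
      have "of_bool (v \<in> e) \<le> lookup c v" for v
        using M(1) e by (auto simp: matching_def dest: spec[of _ v])
      then have pos: "lookup c i \<ge> 1" "lookup c j \<ge> 1" using ij by (metis insertI1 of_bool_eq(2), metis insertCI of_bool_eq(2))
      let ?s = "Poly_Mapping.single i 1 + Poly_Mapping.single j 1 :: ('v, nat) poly_mapping"
      have "c = ?s + (c - ?s)"
        using pos ij(2) by (intro poly_mapping_eqI) (auto simp: lookup_add lookup_minus lookup_single when_def)
      moreover have "?s \<in> ?S" using eE ij(1) by blast
      ultimately show "c \<in> {c + d |c d. c \<in> ?S}" by blast
    qed
  qed
  then show ?thesis unfolding edge_ideal_def gens genideal_monomials by simp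
qed

text \<open>Splitting off one edge of the matching corresponds to splitting off one generator of the
  edge ideal.\<close>

lemma matching_exponents_Suc:
  fixes E :: "'v::finite set set"
  shows "{a + b |a b. a \<in> matching_exponents E k \<and> b \<in> matching_exponents E 1} = matching_exponents E (Suc k)"
    (is "?L = ?R")
proof
  show "?L \<subseteq> ?R"
  proof
    fix c assume "c \<in> ?L"
    then obtain a b M N where c: "c = a + b" "matching E (lookup a) M" "size M = k"
      "matching E (lookup b) N" "size N = 1" by (auto simp: matching_exponents_def)
    then have "matching E (lookup c) (M + N)" by (auto simp: matching_def lookup_add add_mono)
    then show "c \<in> ?R" unfolding matching_exponents_def using c by (intro CollectI exI[of _ "M + N"]) simp
  qed
  show "?R \<subseteq> ?L"
  proof
    fix c assume "c \<in> ?R"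
    then obtain M where M: "matching E (lookup c) M" "size M = Suc k" by (auto simp: matching_exponents_def)
    then obtain e N where N: "M = add_mset e N" by (metis size_eq_Suc_imp_eq_union)
    define b where "b = Abs_poly_mapping (\<lambda>v. of_bool (v \<in> e) :: nat)"
    have b: "lookup b v = of_bool (v \<in> e)" for v unfolding b_def by simp
    have le: "of_bool (v \<in> e) + edge_deg N v \<le> lookup c v" for v
      using M(1) N by (simp add: matching_def)
    have "c = (c - b) + b"
    proof (rule poly_mapping_eqI)
      fix v show "lookup c v = lookup (c - b + b) v" using le[of v] by (simp add: lookup_add lookup_minus b)
    qed
    moreover have "matching E (lookup (c - b)) N" using M(1) N le by (auto simp: matching_def lookup_minus b add_le_imp_le_diff add.commute)
    moreover have "matching E (lookup b) {#e#}" using M(1) N by (auto simp: matching_def b)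
    moreover have "size N = k" using M(2) N by simp
    ultimately show "c \<in> ?L" unfolding matching_exponents_def
      by (intro CollectI exI[of _ "c - b"] exI[of _ b]) auto
  qed
qed

lemma edge_ideal_pow:
  fixes G :: "'v::finite graph"
  assumes "\<forall>e \<in> edges G. card e = 2"
  shows "ideal_pow mvpoly_ring (edge_ideal G) k = (mon_ideal (matching_exponents (edges G) k) :: ('v, 'k::field) mvpoly set)"
proof (induction k)
  case 0
  have "matching_exponents (edges G) 0 = UNIV"
    by (auto simp: matching_exponents_def matching_def intro!: exI[of _ "{#}"])
  then show ?case by (simp add: ideal_pow_def ideals_set_def mon_ideal_def nat_pow_def)
next
  case (Suc k)
  have "ideal_pow mvpoly_ring (edge_ideal G :: ('v, 'k) mvpoly set) (Suc k) =
      ideal_prod mvpoly_ring (ideal_pow mvpoly_ring (edge_ideal G) k) (edge_ideal G)"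
    by (simp add: ideal_pow_def ideals_set_def nat_pow_def)
  also have "\<dots> = mon_ideal (matching_exponents (edges G) (Suc k))"
    unfolding Suc unfolding edge_ideal_eq[OF assms]
    by (simp only: ideal_prod_mon_ideal[OF up_closed_matching_exponents up_closed_matching_exponents]
        matching_exponents_Suc)
  finally show ?case .
qed

lemma exponent_function:
  fixes c :: "'v::finite \<Rightarrow> nat"
  obtains p where "lookup p = c"
  by (rule that[of "Abs_poly_mapping c"]) simp

lemma dominant_star_exponents:
  fixes G :: "'v::finite graph"
  assumes G: "simple_graph G" "verts G = UNIV" and k: "k \<ge> 1"
  shows "(\<exists>c. (\<forall>v \<in> U. c + Poly_Mapping.single v 1 \<in> matching_exponents (edges G) k) \<and>
      (\<forall>d. (\<forall>v \<in> U. lookup d v = 0) \<longrightarrow> c + d \<notin> matching_exponents (edges G) k)) \<longleftrightarrow>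
    (\<exists>W \<in> dominant_star_sets G U. nu_star (induced G W) \<le> real k - 1)" (is "?L \<longleftrightarrow> ?R")
proof
  let ?E = "edges G"
  \<comment> \<open>Exponents are described by matchings of exactly \<open>k\<close> edges, whereas
    the bound needed below excludes all matchings with at least \<open>k\<close> edges.\<close>
  have sub: "\<exists>M'. matching E a M' \<and> size M' = k" if "matching E a M" "size M \<ge> k" for E a and M :: "'v set multiset"
  proof -
    obtain M' where M': "M' \<subseteq># M" "size M' = k" using \<open>size M \<ge> k\<close>
      by (metis ex_mset mset_subset_eq_exists_conv size_mset take_append append_take_drop_id mset_append length_take min.absorb2)
    have "edge_deg M' u \<le> a u" for u
      using that(1) edge_deg_mono[OF M'(1), of u] by (meson matching_def order_trans)
    moreover have "set_mset M' \<subseteq> E" using that(1) set_mset_mono[OF M'(1)] by (auto simp: matching_def)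
    ultimately show ?thesis using M'(2) by (auto simp: matching_def)
  qed
  assume ?L
  then obtain c where c: "\<forall>v \<in> U. c + Poly_Mapping.single v 1 \<in> matching_exponents ?E k"
    "\<forall>d. (\<forall>v \<in> U. lookup d v = 0) \<longrightarrow> c + d \<notin> matching_exponents ?E k" by blast
  \<comment> \<open>Among all exponents supported outside \<open>U\<close>, this one already
    provides more copies than fewer than \<open>k\<close> edges can use.\<close>
  obtain d where d: "lookup d = (\<lambda>v. if v \<in> U then 0 else k)" by (rule exponent_function)
  show ?R
  proof (rule dominant_star_of_matching[OF G])
    show "\<forall>M. matching ?E (\<lambda>v. lookup c v + (if v \<in> U then 0 else k)) M \<longrightarrow> size M < k"
    proof (intro allI impI, rule ccontr)
      fix M assume "matching ?E (\<lambda>v. lookup c v + (if v \<in> U then 0 else k)) M" "\<not> size M < k"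
      then obtain M' where "matching ?E (\<lambda>v. lookup c v + (if v \<in> U then 0 else k)) M'" "size M' = k"
        using sub[of ?E _ M] by (metis not_less)
      moreover have "lookup (c + d) = (\<lambda>v. lookup c v + (if v \<in> U then 0 else k))"
        by (simp add: fun_eq_iff lookup_add d)
      ultimately have "c + d \<in> matching_exponents ?E k" by (auto simp: matching_exponents_def)
      then show False using c(2) d by simp
    qed
    show "\<forall>i \<in> U. \<exists>M. matching ?E (\<lambda>v. lookup c v + (if v \<in> U then 0 else k) + of_bool (v = i)) M \<and> size M = k"
    proof
      fix i assume "i \<in> U"
      then obtain M where M: "matching ?E (lookup (c + Poly_Mapping.single i 1)) M" "size M = k"
        using c(1) by (auto simp: matching_exponents_def)
      have "matching ?E (\<lambda>v. lookup c v + (if v \<in> U then 0 else k) + of_bool (v = i)) M"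
        unfolding matching_def
      proof (intro conjI allI)
        show "set_mset M \<subseteq> ?E" using M(1) by (simp add: matching_def)
        fix v
        have "edge_deg M v \<le> lookup c v + of_bool (v = i)"
          using M(1) by (auto simp: matching_def lookup_add lookup_single when_def dest: spec[of _ v])
        then show "edge_deg M v \<le> lookup c v + (if v \<in> U then 0 else k) + of_bool (v = i)" by linarith
      qed
      then show "\<exists>M. matching ?E (\<lambda>v. lookup c v + (if v \<in> U then 0 else k) + of_bool (v = i)) M \<and> size M = k"
        using M(2) by blast
    qed
  qed
next
  let ?E = "edges G"
  assume ?R
  then obtain W where W: "W \<in> dominant_star_sets G U" "nu_star (induced G W) \<le> real (k - 1)"
    using k by (auto simp: of_nat_diff)
  obtain c where c: "\<forall>d M. (\<forall>v \<in> U. d v = 0) \<longrightarrow> matching ?E (\<lambda>v. c v + d v) M \<longrightarrow> size M \<le> k - 1"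
    "\<forall>i \<in> U. \<exists>M. matching ?E (\<lambda>v. c v + of_bool (v = i)) M \<and> size M = k - 1 + 1"
    using matching_of_dominant_star[OF G W] by blast
  obtain p where p: "lookup p = c" by (rule exponent_function)
  have "p + Poly_Mapping.single v 1 \<in> matching_exponents ?E k" if v: "v \<in> U" for v
  proof -
    have "lookup (p + Poly_Mapping.single v 1) = (\<lambda>u. c u + of_bool (u = v))"
      by (auto simp: fun_eq_iff lookup_add lookup_single when_def p)
    then show ?thesis using c(2) v k by (simp add: matching_exponents_def)
  qed
  moreover have "p + d \<notin> matching_exponents ?E k" if "\<forall>v \<in> U. lookup d v = 0" for d
  proof
    assume "p + d \<in> matching_exponents ?E k"
    then obtain M where M: "matching ?E (lookup (p + d)) M" "size M = k" by (auto simp: matching_exponents_def)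
    have "lookup (p + d) = (\<lambda>v. c v + lookup d v)" by (simp add: fun_eq_iff lookup_add p)
    then have "size M \<le> k - 1" using c(1) that M(1) by metis
    then show False using M(2) k by simp
  qed
  ultimately show ?L by blast
qed

theorem corollary4p10:
  fixes G :: "'v::finite graph" and k :: nat
  assumes "simple_graph G" and "verts G = UNIV"
    and "connected_graph G" and "\<not> bipartite G"
    and "k \<ge> 1"
  shows "associated_primes mvpoly_ring
           (ideal_pow mvpoly_ring (edge_ideal G :: ('v, 'k::field) mvpoly set) k) =
         {var_prime U |U. U \<subseteq> verts G \<and> dominant_star_sets G U \<noteq> {} \<and>
            Min ((\<lambda>W. nu_star (induced G W)) ` dominant_star_sets G U) \<le> real k - 1}"
proof -
  have "\<forall>e \<in> edges G. card e = 2" using assms(1) by (simp add: simple_graph_def)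
  note pow = edge_ideal_pow[OF this]
  have "dominant_star_sets G U \<noteq> {} \<and> Min ((\<lambda>W. nu_star (induced G W)) ` dominant_star_sets G U) \<le> real k - 1
      \<longleftrightarrow> (\<exists>W \<in> dominant_star_sets G U. nu_star (induced G W) \<le> real k - 1)" for U
    by (cases "dominant_star_sets G U = {}") (auto simp: Min_le_iff)
  then show ?thesis
    unfolding pow associated_primes_mon_ideal[OF up_closed_matching_exponents]
      dominant_star_exponents[OF assms(1,2,5)] assms(2) by simp
qed

end
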